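(* Let $R$ be a commutative Noetherian local ring and let $0\to M^{\oplus a}\to K\to(\Omega^n_RM)^{\oplus b}\to0$ be a short exact sequence of finitely generated $R$-modules, where $a,b\ge1$ and $n\ge0$ are integers, such that $\operatorname{cx}_R(K)=c$ for some integer $c\ge0$. Then: (i) if $a<b$, then $\operatorname{cx}_R(M)=\operatorname{cx}_R(K)$; (ii) if $a=b$, then $\operatorname{cx}_R(M)\le\operatorname{cx}_R(K)+1$; (iii) if $a>b$, then either $\operatorname{cx}_R(M)=\operatorname{cx}_R(K)$ or $\operatorname{cx}_R(M)=\infty$.
   Context: $\Omega^n_RM$ is the $n$-th syzygy in a minimal free resolution ($\Omega^0_RM=M$), and $\beta_i(M)$ is the $i$-th Betti number of $M$. The complexity $\operatorname{cx}_R(M)$ is the smallest integer $r\ge0$ such that there is a real number $A$ with $\beta_i(M)\le A\, i^{r-1}$ for all $i\gg0$; it is $\infty$ if no such $r$ exists. *)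

theory Defs
  imports Complex_Main "HOL-Algebra.Ring_Divisibility" "HOL-Algebra.Module"
    "HOL-Library.Extended_Nat"
begin

definition local_ring :: "('a, 'c) ring_scheme \<Rightarrow> bool" where
  "local_ring R \<longleftrightarrow> cring R \<and> (\<exists>!I. maximalideal I R)"

definition noeth_local_ring :: "('a, 'c) ring_scheme \<Rightarrow> bool" where
  "noeth_local_ring R \<longleftrightarrow> cring R \<and> noetherian_ring R \<and> local_ring R"

definition generates ::
  "('a, 'c) ring_scheme \<Rightarrow> ('a, 'm) module \<Rightarrow> nat \<Rightarrow> (nat \<Rightarrow> 'm) \<Rightarrow> bool" where
  "generates R M m g \<longleftrightarrow> (\<forall>i<m. g i \<in> carrier M) \<and>
     carrier M = {finsum M (\<lambda>i. c i \<odot>\<^bsub>M\<^esub> g i) {..<m} | c. \<forall>i<m. c i \<in> carrier R}"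

definition fin_gen :: "('a, 'c) ring_scheme \<Rightarrow> ('a, 'm) module \<Rightarrow> bool" where
  "fin_gen R M \<longleftrightarrow> (\<exists>m g. generates R M m g)"

definition mingens :: "('a, 'c) ring_scheme \<Rightarrow> ('a, 'm) module \<Rightarrow> nat" where
  "mingens R M = (LEAST m. \<exists>g. generates R M m g)"

definition freemod :: "('a, 'c) ring_scheme \<Rightarrow> nat \<Rightarrow> ('a, nat \<Rightarrow> 'a) module" where
  "freemod R m = \<lparr> carrier = {v. (\<forall>i<m. v i \<in> carrier R) \<and> (\<forall>i\<ge>m. v i = \<zero>\<^bsub>R\<^esub>)},
      mult = (\<lambda>v w i. \<zero>\<^bsub>R\<^esub>), one = (\<lambda>i. \<zero>\<^bsub>R\<^esub>),
      zero = (\<lambda>i. \<zero>\<^bsub>R\<^esub>), add = (\<lambda>v w i. v i \<oplus>\<^bsub>R\<^esub> w i),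
      smult = (\<lambda>a v i. a \<otimes>\<^bsub>R\<^esub> v i) \<rparr>"

definition dsum :: "('a, 'c) ring_scheme \<Rightarrow> nat \<Rightarrow> ('a, 'm) module \<Rightarrow> ('a, nat \<Rightarrow> 'm) module" where
  "dsum R a M = \<lparr> carrier = {v. (\<forall>i<a. v i \<in> carrier M) \<and> (\<forall>i\<ge>a. v i = \<zero>\<^bsub>M\<^esub>)},
      mult = (\<lambda>v w i. \<zero>\<^bsub>M\<^esub>), one = (\<lambda>i. \<zero>\<^bsub>M\<^esub>),
      zero = (\<lambda>i. \<zero>\<^bsub>M\<^esub>), add = (\<lambda>v w i. v i \<oplus>\<^bsub>M\<^esub> w i),
      smult = (\<lambda>r v i. r \<odot>\<^bsub>M\<^esub> v i) \<rparr>"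

definition mod_hom ::
  "('a, 'c) ring_scheme \<Rightarrow> ('a, 'm) module \<Rightarrow> ('a, 'n) module \<Rightarrow> ('m \<Rightarrow> 'n) \<Rightarrow> bool" where
  "mod_hom R M N f \<longleftrightarrow> f \<in> carrier M \<rightarrow> carrier N \<and>
     (\<forall>x\<in>carrier M. \<forall>y\<in>carrier M. f (x \<oplus>\<^bsub>M\<^esub> y) = f x \<oplus>\<^bsub>N\<^esub> f y) \<and>
     (\<forall>r\<in>carrier R. \<forall>x\<in>carrier M. f (r \<odot>\<^bsub>M\<^esub> x) = r \<odot>\<^bsub>N\<^esub> f x)"

definition mod_iso :: "('a, 'c) ring_scheme \<Rightarrow> ('a, 'm) module \<Rightarrow> ('a, 'n) module \<Rightarrow> bool" where
  "mod_iso R M N \<longleftrightarrow> (\<exists>f. mod_hom R M N f \<and> bij_betw f (carrier M) (carrier N))"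

definition short_exact ::
  "('a, 'c) ring_scheme \<Rightarrow> ('a, 'x) module \<Rightarrow> ('a, 'y) module \<Rightarrow> ('a, 'z) module
     \<Rightarrow> ('x \<Rightarrow> 'y) \<Rightarrow> ('y \<Rightarrow> 'z) \<Rightarrow> bool" where
  "short_exact R A B C f g \<longleftrightarrow> mod_hom R A B f \<and> mod_hom R B C g \<and>
     inj_on f (carrier A) \<and> g ` carrier B = carrier C \<and>
     f ` carrier A = {y \<in> carrier B. g y = \<zero>\<^bsub>C\<^esub>}"

text \<open>First syzygy: kernel of a minimal free cover R^mu(M) -> M, e_i |-> g i, for a chosen
  minimal generating family g. Over a local ring this is well defined up to isomorphism.\<close>
definition syz1 :: "('a, 'c) ring_scheme \<Rightarrow> ('a, 'm) module \<Rightarrow> ('a, nat \<Rightarrow> 'a) module" where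
  "syz1 R M = (let m = mingens R M; g = (SOME g. generates R M m g) in
     (freemod R m)\<lparr> carrier := {v \<in> carrier (freemod R m).
         finsum M (\<lambda>i. v i \<odot>\<^bsub>M\<^esub> g i) {..<m} = \<zero>\<^bsub>M\<^esub>} \<rparr>)"

definition syz_suc :: "('a, 'c) ring_scheme \<Rightarrow> nat \<Rightarrow> ('a, 'm) module \<Rightarrow> ('a, nat \<Rightarrow> 'a) module" where
  "syz_suc R n M = (syz1 R ^^ n) (syz1 R M)"

definition is_syzygy :: "('a, 'c) ring_scheme \<Rightarrow> nat \<Rightarrow> ('a, 'm) module \<Rightarrow> ('a, 'n) module \<Rightarrow> bool" where
  "is_syzygy R n M N \<longleftrightarrow> (if n = 0 then mod_iso R M N else mod_iso R (syz_suc R (n - 1) M) N)"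

text \<open>Betti numbers: beta_i(M) = mu(Omega^i M), the rank of the i-th free module in a minimal
  free resolution.\<close>
definition betti :: "('a, 'c) ring_scheme \<Rightarrow> ('a, 'm) module \<Rightarrow> nat \<Rightarrow> nat" where
  "betti R M i = (if i = 0 then mingens R M else mingens R (syz_suc R (i - 1) M))"

definition cx_bound :: "('a, 'c) ring_scheme \<Rightarrow> ('a, 'm) module \<Rightarrow> nat \<Rightarrow> bool" where
  "cx_bound R M r \<longleftrightarrow> (\<exists>A::real. \<forall>\<^sub>F i in sequentially.
      real (betti R M i) \<le> A * real i powr (real r - 1))"

definition cx :: "('a, 'c) ring_scheme \<Rightarrow> ('a, 'm) module \<Rightarrow> enat" where
  "cx R M = (if \<exists>r. cx_bound R M r then enat (LEAST r. cx_bound R M r) else \<infinity>)"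

end

(* The long exact Tor sequence is replaced by three inequalities for an exact sequence
   0 -> A -> B -> C -> 0:
     beta_i(B) <= beta_i(A) + beta_i(C),
     beta_(i+1)(C) <= beta_(i+1)(B) + beta_i(A),
     beta_i(A) <= beta_i(B) + beta_(i+1)(C).
   The first is the horseshoe lemma; the others are the first one applied to the rotated sequences
   0 -> Omega B -> Z -> A -> 0, with Z the kernel of R^p -> B -> C, and
   0 -> Omega C -> A (+) R^q -> B -> 0.
   Non-minimal presentations are harmless because Betti numbers are monotone under retracts: over a
   local ring an endomorphism of R^p congruent to the identity modulo the maximal ideal is
   invertible, so a retraction of modules lifts to a retraction of the kernels of their free covers.
   With m_i = beta_i(M), k_i = beta_i(K) the inequalities read k_i <= a m_i + b m_(n+i),
   b m_(n+i+1) <= k_(i+1) + a m_i and a m_i <= k_i + b m_(n+i+1), and the three cases compare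
   polynomial growth: a contraction if a < b, a summation if a = b, and, if a > b, an expansion,
   which can be unrolled to infinity as soon as m has some polynomial bound. *)
theory Submission
  imports Defs "HOL-Real_Asymp.Real_Asymp"
begin

subsection \<open>Homomorphisms and linear combinations\<close>

text \<open>\<open>syz1\<close> depends on an arbitrary choice of minimal generators, and two
  choices give modules related by no given map. Isomorphisms between syzygies are therefore never
  built: modules are compared by retractions in both directions, which survive the passage to
  syzygies and squeeze the Betti numbers into equality. Subadditivity alone would not do for the
  direct sums: M^a and N^b occur on the smaller side of two of the three inequalities, so
  beta_i(M^a) has to be at least a beta_i(M). This calls for a criterion of minimality that can be
  checked on a direct sum of presentations, namely that all coefficients of relations are nonunits.
  Its sufficiency is invariance of dimension over the residue field, phrased inside R by units and
  nonunits, so that no quotient ring or vector space is formed.\<close>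

lemma mod_homI:
  assumes "\<And>x. x \<in> carrier M \<Longrightarrow> f x \<in> carrier N"
    and "\<And>x y. x \<in> carrier M \<Longrightarrow> y \<in> carrier M \<Longrightarrow> f (x \<oplus>\<^bsub>M\<^esub> y) = f x \<oplus>\<^bsub>N\<^esub> f y"
    and "\<And>r x. r \<in> carrier R \<Longrightarrow> x \<in> carrier M \<Longrightarrow> f (r \<odot>\<^bsub>M\<^esub> x) = r \<odot>\<^bsub>N\<^esub> f x"
  shows "mod_hom R M N f"
  using assms by (auto simp: mod_hom_def)

lemma mod_homD:
  assumes "mod_hom R M N f"
  shows "\<And>x. x \<in> carrier M \<Longrightarrow> f x \<in> carrier N"
    and "\<And>x y. x \<in> carrier M \<Longrightarrow> y \<in> carrier M \<Longrightarrow> f (x \<oplus>\<^bsub>M\<^esub> y) = f x \<oplus>\<^bsub>N\<^esub> f y"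
    and "\<And>r x. r \<in> carrier R \<Longrightarrow> x \<in> carrier M \<Longrightarrow> f (r \<odot>\<^bsub>M\<^esub> x) = r \<odot>\<^bsub>N\<^esub> f x"
  using assms by (auto simp: mod_hom_def)

lemma mod_hom_id: "mod_hom R M M (\<lambda>x. x)"
  by (rule mod_homI) auto

lemma mod_hom_comp:
  assumes "mod_hom R M N f" "mod_hom R N P g"
  shows "mod_hom R M P (\<lambda>x. g (f x))"
  by (rule mod_homI) (use assms in \<open>simp_all add: mod_homD[OF assms(1)] mod_homD[OF assms(2)]\<close>)

lemma mod_hom_zero:
  assumes "mod_hom R M N f" "module R M" "module R N"
  shows "f \<zero>\<^bsub>M\<^esub> = \<zero>\<^bsub>N\<^esub>"
proof -
  interpret M: module R M by fact
  interpret N: module R N by fact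
  have "f \<zero>\<^bsub>M\<^esub> = f (\<zero>\<^bsub>R\<^esub> \<odot>\<^bsub>M\<^esub> \<zero>\<^bsub>M\<^esub>)" by simp
  also have "\<dots> = \<zero>\<^bsub>R\<^esub> \<odot>\<^bsub>N\<^esub> f \<zero>\<^bsub>M\<^esub>"
    by (rule mod_homD(3)[OF assms(1)]) auto
  also have "\<dots> = \<zero>\<^bsub>N\<^esub>" by (rule N.smult_l_null) (simp add: mod_homD(1)[OF assms(1)])
  finally show ?thesis .
qed

lemma mod_hom_uminus:
  assumes "mod_hom R M N f" "module R M" "module R N" "x \<in> carrier M"
  shows "f (\<ominus>\<^bsub>M\<^esub> x) = \<ominus>\<^bsub>N\<^esub> f x"
proof -
  interpret M: module R M by fact
  interpret N: module R N by fact
  have fx: "f x \<in> carrier N" by (rule mod_homD(1)[OF assms(1,4)])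
  have "\<ominus>\<^bsub>M\<^esub> x = (\<ominus>\<^bsub>R\<^esub> \<one>\<^bsub>R\<^esub>) \<odot>\<^bsub>M\<^esub> x" 
    using assms(4) by (simp add: M.smult_l_minus)
  then have "f (\<ominus>\<^bsub>M\<^esub> x) = (\<ominus>\<^bsub>R\<^esub> \<one>\<^bsub>R\<^esub>) \<odot>\<^bsub>N\<^esub> f x"
    using assms(4) by (simp add: mod_homD[OF assms(1)])
  then show ?thesis using fx by (simp add: N.smult_l_minus)
qed

lemma mod_hom_minus:
  assumes "mod_hom R M N f" "module R M" "module R N" "x \<in> carrier M" "y \<in> carrier M"
  shows "f (x \<ominus>\<^bsub>M\<^esub> y) = f x \<ominus>\<^bsub>N\<^esub> f y"
proof -
  interpret M: module R M by fact
  show ?thesis using assms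
    by (simp add: a_minus_def mod_homD[OF assms(1)] mod_hom_uminus[OF assms(1-3)])
qed

text \<open>Supplies the maps to A in both rotated sequences and the inverse of an isomorphism: a
  homomorphism with values in the image of an injective f factors through f.\<close>

lemma mod_hom_inv_into:
  assumes f: "mod_hom R A B f" "inj_on f (carrier A)" and "module R A"
    and h: "mod_hom R X B h" and im: "\<And>x. x \<in> carrier X \<Longrightarrow> h x \<in> f ` carrier A"
  shows "mod_hom R X A (\<lambda>x. inv_into (carrier A) f (h x))"
proof -
  interpret A: module R A by fact
  note f' = mod_homD[OF f(1)] and h' = mod_homD[OF h]
  have c: "inv_into (carrier A) f (h x) \<in> carrier A" if "x \<in> carrier X" for x
    by (rule inv_into_into[OF im[OF that]])
  have e: "f (inv_into (carrier A) f (h x)) = h x" if "x \<in> carrier X" for x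
    by (rule f_inv_into_f[OF im[OF that]])
  show ?thesis
  proof (rule mod_homI)
    fix x y assume "x \<in> carrier X" "y \<in> carrier X"
    then show "inv_into (carrier A) f (h (x \<oplus>\<^bsub>X\<^esub> y)) =
      inv_into (carrier A) f (h x) \<oplus>\<^bsub>A\<^esub> inv_into (carrier A) f (h y)"
      by (intro inv_into_f_eq[OF f(2)]) (simp_all add: c e f' h')
  next
    fix r x assume "r \<in> carrier R" "x \<in> carrier X"
    then show "inv_into (carrier A) f (h (r \<odot>\<^bsub>X\<^esub> x)) = r \<odot>\<^bsub>A\<^esub> inv_into (carrier A) f (h x)"
      by (intro inv_into_f_eq[OF f(2)]) (simp_all add: c e f' h')
  qed (rule c)
qed

section \<open>Linear combinations, free modules and kernels of free covers\<close>

definition lincomb :: "('a, 'm) module \<Rightarrow> nat \<Rightarrow> (nat \<Rightarrow> 'a) \<Rightarrow> (nat \<Rightarrow> 'm) \<Rightarrow> 'm" where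
  "lincomb M p v g = (\<Oplus>\<^bsub>M\<^esub>i\<in>{..<p}. v i \<odot>\<^bsub>M\<^esub> g i)"

text \<open>The kernel of R^p -> M for an arbitrary family g. It makes presentations that are not
  minimal comparable with \<open>syz1\<close>, which is the instance of a chosen minimal generating
  family.\<close>

definition relmod :: "('a, 'c) ring_scheme \<Rightarrow> ('a, 'm) module \<Rightarrow> nat \<Rightarrow> (nat \<Rightarrow> 'm)
    \<Rightarrow> ('a, nat \<Rightarrow> 'a) module" where
  "relmod R M p g = (freemod R p)\<lparr>carrier := {v \<in> carrier (freemod R p). lincomb M p v g = \<zero>\<^bsub>M\<^esub>}\<rparr>"

lemma syz1_eq_relmod: "syz1 R M = relmod R M (mingens R M) (SOME g. generates R M (mingens R M) g)"
  by (simp add: syz1_def relmod_def lincomb_def Let_def)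

lemma freemod_simps [simp]:
  "v \<in> carrier (freemod R p) \<longleftrightarrow> (\<forall>i<p. v i \<in> carrier R) \<and> (\<forall>i\<ge>p. v i = \<zero>\<^bsub>R\<^esub>)"
  "\<zero>\<^bsub>freemod R p\<^esub> = (\<lambda>i. \<zero>\<^bsub>R\<^esub>)"
  "v \<oplus>\<^bsub>freemod R p\<^esub> w = (\<lambda>i. v i \<oplus>\<^bsub>R\<^esub> w i)"
  "r \<odot>\<^bsub>freemod R p\<^esub> v = (\<lambda>i. r \<otimes>\<^bsub>R\<^esub> v i)"
  by (auto simp: freemod_def)

lemma relmod_simps [simp]:
  "v \<in> carrier (relmod R M p g) \<longleftrightarrow> v \<in> carrier (freemod R p) \<and> lincomb M p v g = \<zero>\<^bsub>M\<^esub>"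
  "\<zero>\<^bsub>relmod R M p g\<^esub> = \<zero>\<^bsub>freemod R p\<^esub>"
  "v \<oplus>\<^bsub>relmod R M p g\<^esub> w = v \<oplus>\<^bsub>freemod R p\<^esub> w"
  "r \<odot>\<^bsub>relmod R M p g\<^esub> v = r \<odot>\<^bsub>freemod R p\<^esub> v"
  by (simp_all add: relmod_def)

lemma dsum_simps [simp]:
  "v \<in> carrier (dsum R a M) \<longleftrightarrow> (\<forall>i<a. v i \<in> carrier M) \<and> (\<forall>i\<ge>a. v i = \<zero>\<^bsub>M\<^esub>)"
  "\<zero>\<^bsub>dsum R a M\<^esub> = (\<lambda>i. \<zero>\<^bsub>M\<^esub>)"
  "v \<oplus>\<^bsub>dsum R a M\<^esub> w = (\<lambda>i. v i \<oplus>\<^bsub>M\<^esub> w i)"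
  "r \<odot>\<^bsub>dsum R a M\<^esub> v = (\<lambda>i. r \<odot>\<^bsub>M\<^esub> v i)"
  by (auto simp: dsum_def)

definition unitvec :: "('a, 'c) ring_scheme \<Rightarrow> nat \<Rightarrow> nat \<Rightarrow> 'a" where
  "unitvec R i = (\<lambda>j. if j = i then \<one>\<^bsub>R\<^esub> else \<zero>\<^bsub>R\<^esub>)"

text \<open>Serves for generators and for coefficient vectors alike. The length of h is not
  recorded: a vector of R^q vanishes from q on by itself, so appending it to one of R^p gives an
  element of R^(p+q).\<close>

definition append_fam :: "nat \<Rightarrow> (nat \<Rightarrow> 'x) \<Rightarrow> (nat \<Rightarrow> 'x) \<Rightarrow> nat \<Rightarrow> 'x" where
  "append_fam p g h = (\<lambda>i. if i < p then g i else h (i - p))"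

lemma lincomb_0 [simp]: "module R M \<Longrightarrow> lincomb M 0 v g = \<zero>\<^bsub>M\<^esub>"
proof -
  assume "module R M"
  then interpret M: module R M .
  show ?thesis by (simp add: lincomb_def)
qed

lemma lincomb_Suc:
  assumes "module R M" "\<And>i. i < Suc p \<Longrightarrow> v i \<in> carrier R" "\<And>i. i < Suc p \<Longrightarrow> g i \<in> carrier M"
  shows "lincomb M (Suc p) v g = v p \<odot>\<^bsub>M\<^esub> g p \<oplus>\<^bsub>M\<^esub> lincomb M p v g"
proof -
  interpret M: module R M by fact
  show ?thesis using assms by (simp add: lincomb_def lessThan_Suc Pi_def)
qed

lemma lincomb_cong:
  assumes "module R M" "\<And>i. i < p \<Longrightarrow> v i = w i" "\<And>i. i < p \<Longrightarrow> g i = h i"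
    "\<And>i. i < p \<Longrightarrow> v i \<in> carrier R" "\<And>i. i < p \<Longrightarrow> g i \<in> carrier M"
  shows "lincomb M p v g = lincomb M p w h"
proof -
  interpret M: module R M by fact
  have "finsum M (\<lambda>i. v i \<odot>\<^bsub>M\<^esub> g i) {..<p} = finsum M (\<lambda>i. w i \<odot>\<^bsub>M\<^esub> h i) {..<p}"
    by (rule M.finsum_cong') (use assms in auto)
  then show ?thesis by (simp add: lincomb_def)
qed

lemma lincomb_closed:
  assumes "module R M" "\<And>i. i < p \<Longrightarrow> v i \<in> carrier R" "\<And>i. i < p \<Longrightarrow> g i \<in> carrier M"
  shows "lincomb M p v g \<in> carrier M"
proof -
  interpret M: module R M by fact
  show ?thesis unfolding lincomb_def by (rule M.finsum_closed) (use assms in auto)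
qed

lemma lincomb_add:
  assumes "module R M" "\<And>i. i < p \<Longrightarrow> v i \<in> carrier R" "\<And>i. i < p \<Longrightarrow> w i \<in> carrier R"
    "\<And>i. i < p \<Longrightarrow> g i \<in> carrier M"
  shows "lincomb M p (\<lambda>i. v i \<oplus>\<^bsub>R\<^esub> w i) g = lincomb M p v g \<oplus>\<^bsub>M\<^esub> lincomb M p w g"
proof -
  interpret M: module R M by fact
  have "lincomb M p v g \<oplus>\<^bsub>M\<^esub> lincomb M p w g
      = finsum M (\<lambda>i. v i \<odot>\<^bsub>M\<^esub> g i \<oplus>\<^bsub>M\<^esub> w i \<odot>\<^bsub>M\<^esub> g i) {..<p}"
    unfolding lincomb_def by (rule M.finsum_addf[symmetric]) (use assms in auto)
  also have "\<dots> = finsum M (\<lambda>i. (v i \<oplus>\<^bsub>R\<^esub> w i) \<odot>\<^bsub>M\<^esub> g i) {..<p}"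
    by (rule M.finsum_cong') (use assms in \<open>auto simp: M.smult_l_distr\<close>)
  finally show ?thesis by (simp add: lincomb_def)
qed

lemma lincomb_smult:
  assumes "module R M" "r \<in> carrier R" "\<And>i. i < p \<Longrightarrow> v i \<in> carrier R"
    "\<And>i. i < p \<Longrightarrow> g i \<in> carrier M"
  shows "lincomb M p (\<lambda>i. r \<otimes>\<^bsub>R\<^esub> v i) g = r \<odot>\<^bsub>M\<^esub> lincomb M p v g"
proof -
  interpret M: module R M by fact
  have "r \<odot>\<^bsub>M\<^esub> lincomb M p v g = finsum M (\<lambda>i. r \<odot>\<^bsub>M\<^esub> (v i \<odot>\<^bsub>M\<^esub> g i)) {..<p}"
    unfolding lincomb_def by (rule M.finsum_smult_ldistr) (use assms in auto)
  also have "\<dots> = finsum M (\<lambda>i. (r \<otimes>\<^bsub>R\<^esub> v i) \<odot>\<^bsub>M\<^esub> g i) {..<p}"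
    by (rule M.finsum_cong') (use assms in \<open>auto simp: M.smult_assoc1\<close>)
  finally show ?thesis by (simp add: lincomb_def)
qed

lemma lincomb_hom:
  assumes "module R M" "module R N" "mod_hom R M N f"
    "\<And>i. i < p \<Longrightarrow> v i \<in> carrier R" "\<And>i. i < p \<Longrightarrow> g i \<in> carrier M"
  shows "f (lincomb M p v g) = lincomb N p v (\<lambda>i. f (g i))"
  using assms(4,5)
proof (induction p)
  case 0
  then show ?case using assms(1-3) by (simp add: mod_hom_zero)
next
  case (Suc p)
  interpret M: module R M by fact
  interpret N: module R N by fact
  note h = mod_homD[OF assms(3)]
  show ?case using Suc
    by (simp add: lincomb_Suc[OF assms(1)] lincomb_Suc[OF assms(2)] h lincomb_closed[OF assms(1)])
qed

lemma lincomb_append: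
  assumes "module R M" "\<And>i. i < p + q \<Longrightarrow> v i \<in> carrier R"
    "\<And>i. i < p \<Longrightarrow> g i \<in> carrier M" "\<And>i. i < q \<Longrightarrow> h i \<in> carrier M"
  shows "lincomb M (p + q) v (append_fam p g h)
    = lincomb M p v g \<oplus>\<^bsub>M\<^esub> lincomb M q (\<lambda>i. v (p + i)) h"
  using assms(2,4)
proof (induction q)
  case 0
  interpret M: module R M by fact
  have "lincomb M p v g \<in> carrier M" using assms 0 by (intro lincomb_closed) auto
  moreover have "lincomb M p v (append_fam p g h) = lincomb M p v g"
    using assms 0 by (intro lincomb_cong) (auto simp: append_fam_def)
  ultimately show ?case using assms by simp
next
  case (Suc q)
  interpret M: module R M by fact
  have c: "append_fam p g h i \<in> carrier M" if "i < Suc (p + q)" for i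
    using that assms(3) Suc.prems by (auto simp: append_fam_def)
  have "lincomb M p v g \<in> carrier M" "lincomb M q (\<lambda>i. v (p + i)) h \<in> carrier M" "h q \<in> carrier M"
    using assms Suc.prems by (auto intro!: lincomb_closed)
  then show ?case using Suc c
    by (simp add: lincomb_Suc[OF assms(1)]) (simp add: append_fam_def M.a_lcomm)
qed

context cring
begin

lemma freemod_module: "module R (freemod R p)"
proof (rule moduleI)
  show "abelian_group (freemod R p)"
  proof (rule abelian_groupI)
    fix x assume "x \<in> carrier (freemod R p)"
    then show "\<exists>y\<in>carrier (freemod R p). y \<oplus>\<^bsub>freemod R p\<^esub> x = \<zero>\<^bsub>freemod R p\<^esub>"
      by (intro bexI[of _ "\<lambda>i. if i < p then \<ominus> x i else \<zero>"]) (auto simp: l_neg fun_eq_iff)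
  qed (auto simp: fun_eq_iff a_assoc a_comm not_less[symmetric] , (metis a_assoc a_comm l_zero zero_closed)+)
qed (auto simp: fun_eq_iff not_less[symmetric] is_cring, 
  (metis l_distr r_distr m_assoc l_one r_null zero_closed l_zero)+)

end

lemma submod_module:
  assumes "module R M" "S \<subseteq> carrier M" "\<zero>\<^bsub>M\<^esub> \<in> S"
    and "\<And>x y. x \<in> S \<Longrightarrow> y \<in> S \<Longrightarrow> x \<oplus>\<^bsub>M\<^esub> y \<in> S"
    and "\<And>r x. r \<in> carrier R \<Longrightarrow> x \<in> S \<Longrightarrow> r \<odot>\<^bsub>M\<^esub> x \<in> S"
  shows "module R (M\<lparr>carrier := S\<rparr>)"
proof -
  interpret M: module R M by fact
  have "\<ominus>\<^bsub>M\<^esub> x \<in> S" if "x \<in> S" for x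
  proof -
    have "\<ominus>\<^bsub>M\<^esub> x = (\<ominus>\<^bsub>R\<^esub> \<one>\<^bsub>R\<^esub>) \<odot>\<^bsub>M\<^esub> x"
      using that assms(2) by (subst M.smult_l_minus) auto
    then show ?thesis using assms(5) that by simp
  qed
  then have "submodule S R M" using assms by (intro M.submoduleI) auto
  then show ?thesis by (rule submodule.submodule_is_module[OF _ assms(1)])
qed

lemma lincomb_submod:
  assumes "module R M" "module R (M\<lparr>carrier := S\<rparr>)" "S \<subseteq> carrier M"
    "\<And>i. i < p \<Longrightarrow> v i \<in> carrier R" "\<And>i. i < p \<Longrightarrow> g i \<in> S"
  shows "lincomb (M\<lparr>carrier := S\<rparr>) p v g = lincomb M p v g"
proof (rule lincomb_hom[OF assms(2,1)])
  show "mod_hom R (M\<lparr>carrier := S\<rparr>) M (\<lambda>x. x)"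
    by (rule mod_homI) (use assms(3) in auto)
qed (use assms in auto)

lemma relmod_carrier_subset: "carrier (relmod R M p g) \<subseteq> carrier (freemod R p)"
  by auto

context cring
begin

lemma freemod_coord: "v \<in> carrier (freemod R p) \<Longrightarrow> v i \<in> carrier R"
  by (cases "i < p") auto

lemma freemod_mono: "v \<in> carrier (freemod R p) \<Longrightarrow> p \<le> q \<Longrightarrow> v \<in> carrier (freemod R q)"
  using freemod_coord[of v p] by auto

lemma freemod_Suc_zero:
  assumes "v \<in> carrier (freemod R (Suc p))" "v p = \<zero>"
  shows "v \<in> carrier (freemod R p)"
proof -
  have "v i = \<zero>" if "p \<le> i" for i using assms that by (cases "i = p") auto
  then show ?thesis using assms by auto
qed

lemma unitvec_closed [simp]: "i < p \<Longrightarrow> unitvec R i \<in> carrier (freemod R p)"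
  by (auto simp: unitvec_def)

lemma lincomb_mod_hom:
  assumes "module R M" "\<And>i. i < p \<Longrightarrow> g i \<in> carrier M"
  shows "mod_hom R (freemod R p) M (\<lambda>v. lincomb M p v g)"
  by (rule mod_homI) (use assms in \<open>auto simp: lincomb_closed lincomb_add lincomb_smult\<close>)

lemma lincomb_unitvec:
  assumes "module R M" "\<And>i. i < p \<Longrightarrow> g i \<in> carrier M" "i < p"
  shows "lincomb M p (unitvec R i) g = g i"
proof -
  interpret M: module R M by fact
  have "lincomb M p (unitvec R i) g = finsum M (\<lambda>j. if i = j then g j else \<zero>\<^bsub>M\<^esub>) {..<p}"
    unfolding lincomb_def by (rule M.finsum_cong') (use assms in \<open>auto simp: unitvec_def\<close>)
  also have "\<dots> = g i"
    by (rule M.finsum_singleton) (use assms in auto)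
  finally show ?thesis .
qed

lemma lincomb_unitvecs:
  assumes "v \<in> carrier (freemod R p)"
  shows "lincomb (freemod R p) p v (unitvec R) = v"
proof -
  interpret F: module R "freemod R p" by (rule freemod_module)
  \<comment> \<open>The rank stays p while the number k of summands grows; a partial sum is v cut
    off at k.\<close>
  have "lincomb (freemod R p) k v (unitvec R) = (\<lambda>j. if j < k then v j else \<zero>)" if "k \<le> p" for k
    using that
  proof (induction k)
    case 0
    then show ?case by (simp add: lincomb_0[OF freemod_module])
  next
    case (Suc k)
    have "lincomb (freemod R p) (Suc k) v (unitvec R)
        = v k \<odot>\<^bsub>freemod R p\<^esub> unitvec R k \<oplus>\<^bsub>freemod R p\<^esub> lincomb (freemod R p) k v (unitvec R)"
      using Suc.prems assms by (intro lincomb_Suc[OF freemod_module]) (auto simp: unitvec_def)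
    also have "\<dots> = (\<lambda>j. if j < Suc k then v j else \<zero>)"
      unfolding Suc.IH[OF Suc_leD[OF Suc.prems]]
      using Suc.prems assms by (auto simp: unitvec_def fun_eq_iff less_Suc_eq)
    finally show ?case .
  qed
  from this[of p] show ?thesis using assms by (auto simp: fun_eq_iff not_less)
qed

lemma hom_freemod_eq:
  assumes "mod_hom R (freemod R p) M f" "module R M" "v \<in> carrier (freemod R p)"
  shows "f v = lincomb M p v (\<lambda>i. f (unitvec R i))"
proof -
  have "f v = f (lincomb (freemod R p) p v (unitvec R))"
    using assms by (simp add: lincomb_unitvecs)
  also have "\<dots> = lincomb M p v (\<lambda>i. f (unitvec R i))"
    by (rule lincomb_hom[OF freemod_module assms(2,1)]) 
      (use assms in \<open>auto simp: unitvec_def\<close>)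
  finally show ?thesis .
qed

lemma relmod_module:
  assumes "module R M" "\<And>i. i < p \<Longrightarrow> g i \<in> carrier M"
  shows "module R (relmod R M p g)"
  unfolding relmod_def
proof (rule submod_module[OF freemod_module])
  interpret M: module R M by fact
  note h = mod_homD[OF lincomb_mod_hom[OF assms]]
  have "lincomb M p \<zero>\<^bsub>freemod R p\<^esub> g = \<zero>\<^bsub>M\<^esub>"
    by (rule mod_hom_zero[OF lincomb_mod_hom[OF assms] freemod_module assms(1)]) 
  then show "\<zero>\<^bsub>freemod R p\<^esub> \<in> {v \<in> carrier (freemod R p). lincomb M p v g = \<zero>\<^bsub>M\<^esub>}"
    by auto
  show "x \<oplus>\<^bsub>freemod R p\<^esub> y \<in> {v \<in> carrier (freemod R p). lincomb M p v g = \<zero>\<^bsub>M\<^esub>}"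
    if "x \<in> {v \<in> carrier (freemod R p). lincomb M p v g = \<zero>\<^bsub>M\<^esub>}"
      "y \<in> {v \<in> carrier (freemod R p). lincomb M p v g = \<zero>\<^bsub>M\<^esub>}" for x y
    using that by (simp add: h(2) del: freemod_simps(3)) auto
  show "r \<odot>\<^bsub>freemod R p\<^esub> x \<in> {v \<in> carrier (freemod R p). lincomb M p v g = \<zero>\<^bsub>M\<^esub>}"
    if "r \<in> carrier R" "x \<in> {v \<in> carrier (freemod R p). lincomb M p v g = \<zero>\<^bsub>M\<^esub>}" for r x
    using that by (simp add: h(3) del: freemod_simps(4)) auto
qed auto

text \<open>The coefficients in \<open>generates\<close> are arbitrary from m on. Cutting them off
  by zero turns them into elements of R^m, so that generation becomes surjectivity of R^m ->
  M.\<close>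

lemma generates_iff:
  assumes "module R M"
  shows "generates R M m g \<longleftrightarrow> (\<forall>i<m. g i \<in> carrier M) \<and>
    (\<forall>x\<in>carrier M. \<exists>v\<in>carrier (freemod R m). x = lincomb M m v g)"
proof (cases "\<forall>i<m. g i \<in> carrier M")
  case True
  have 1: "lincomb M m c g \<in> carrier M" if "\<forall>i<m. c i \<in> carrier R" for c
    using that True by (intro lincomb_closed[OF assms]) auto
  have 2: "\<exists>v\<in>carrier (freemod R m). lincomb M m c g = lincomb M m v g"
    if "\<forall>i<m. c i \<in> carrier R" for c
    by (rule bexI[of _ "\<lambda>i. if i < m then c i else \<zero>"], rule lincomb_cong[OF assms])
      (use that True in auto)
  have "carrier M = {lincomb M m c g | c. \<forall>i<m. c i \<in> carrier R} \<longleftrightarrow>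
    (\<forall>x\<in>carrier M. \<exists>v\<in>carrier (freemod R m). x = lincomb M m v g)" (is "?L \<longleftrightarrow> ?R")
  proof
    assume ?L
    show ?R
    proof
      fix x assume "x \<in> carrier M"
      with \<open>?L\<close> obtain c where "x = lincomb M m c g" "\<forall>i<m. c i \<in> carrier R" by blast
      with 2 show "\<exists>v\<in>carrier (freemod R m). x = lincomb M m v g" by simp
    qed
  next
    assume R: ?R
    show ?L
    proof (intro equalityI subsetI)
      fix x assume "x \<in> carrier M"
      with R obtain v where "v \<in> carrier (freemod R m)" "x = lincomb M m v g" by blast
      then show "x \<in> {lincomb M m c g | c. \<forall>i<m. c i \<in> carrier R}" by auto
    next
      fix x assume "x \<in> {lincomb M m c g | c. \<forall>i<m. c i \<in> carrier R}"
      with 1 show "x \<in> carrier M" by blast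
    qed
  qed
  with True show ?thesis by (simp add: generates_def lincomb_def)
qed (auto simp: generates_def)

lemma generatesD:
  assumes "generates R M m g" "module R M"
  shows "\<And>i. i < m \<Longrightarrow> g i \<in> carrier M"
    and "\<And>x. x \<in> carrier M \<Longrightarrow> \<exists>v\<in>carrier (freemod R m). x = lincomb M m v g"
  using assms(1) unfolding generates_iff[OF assms(2)] by blast+

lemma generatesI:
  assumes "module R M" "\<And>i. i < m \<Longrightarrow> g i \<in> carrier M"
    and "\<And>x. x \<in> carrier M \<Longrightarrow> \<exists>v. (\<forall>i<m. v i \<in> carrier R) \<and> x = lincomb M m v g"
  shows "generates R M m g"
  unfolding generates_iff[OF assms(1)]
proof (intro conjI ballI allI impI)
  fix x assume "x \<in> carrier M"
  then obtain v where v: "\<forall>i<m. v i \<in> carrier R" "x = lincomb M m v g" using assms(3) by blast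
  show "\<exists>v\<in>carrier (freemod R m). x = lincomb M m v g"
    unfolding v(2)
    by (rule bexI[of _ "\<lambda>i. if i < m then v i else \<zero>"], rule lincomb_cong[OF assms(1)])
      (use v assms(2) in auto)
qed (use assms in auto)

lemma generates_surj:
  assumes "generates R M m g" "module R M" "module R N" "mod_hom R M N f" "f ` carrier M = carrier N"
  shows "generates R N m (\<lambda>i. f (g i))"
proof (rule generatesI[OF assms(3)])
  note g = generatesD[OF assms(1,2)]
  show "f (g i) \<in> carrier N" if "i < m" for i using g(1)[OF that] assms(5) by blast
  fix y assume "y \<in> carrier N"
  then obtain x where x: "x \<in> carrier M" "y = f x" using assms(5) by blast
  then obtain v where v: "v \<in> carrier (freemod R m)" "x = lincomb M m v g" using g(2) by blast
  have "y = lincomb N m v (\<lambda>i. f (g i))"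
    unfolding x v(2) using v(1) g(1) by (intro lincomb_hom[OF assms(2-4)]) auto
  then show "\<exists>v. (\<forall>i<m. v i \<in> carrier R) \<and> y = lincomb N m v (\<lambda>i. f (g i))"
    using v(1) by auto
qed

lemma mingens_le: "generates R M m g \<Longrightarrow> mingens R M \<le> m"
  unfolding mingens_def by (rule Least_le) blast

lemma mingens_generates:
  assumes "fin_gen R M"
  shows "\<exists>g. generates R M (mingens R M) g"
  using assms unfolding mingens_def fin_gen_def by (rule LeastI_ex)

text \<open>The generation half of the horseshoe lemma: subtracting from b a combination of the
  \<gamma> j with the same image in C leaves an element of the image of A.\<close>

lemma ext_generates:
  assumes se: "short_exact R A B C f g" and mods: "module R A" "module R B" "module R C"
    and al: "generates R A p \<alpha>" and ga: "generates R C q (\<lambda>j. g (\<gamma> j))"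
    and gc: "\<And>j. j < q \<Longrightarrow> \<gamma> j \<in> carrier B"
  shows "generates R B (p + q) (append_fam p (\<lambda>i. f (\<alpha> i)) \<gamma>)"
proof (rule generatesI[OF mods(2)])
  interpret A: module R A by fact
  interpret B: module R B by fact
  interpret C: module R C by fact
  have f: "mod_hom R A B f" and g: "mod_hom R B C g" and inj: "inj_on f (carrier A)"
    and surj: "g ` carrier B = carrier C"
    and im: "f ` carrier A = {y \<in> carrier B. g y = \<zero>\<^bsub>C\<^esub>}"
    using se by (auto simp: short_exact_def)
  note al' = generatesD[OF al mods(1)] and ga' = generatesD[OF ga mods(3)]
  have fa: "f (\<alpha> i) \<in> carrier B" if "i < p" for i
    by (rule mod_homD(1)[OF f]) (use al' that in auto)
  show "append_fam p (\<lambda>i. f (\<alpha> i)) \<gamma> i \<in> carrier B" if "i < p + q" for i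
    using that gc fa by (auto simp: append_fam_def)
  fix b assume b: "b \<in> carrier B"
  have "g b \<in> carrier C" using mod_homD(1)[OF g b] .
  then obtain w where w: "w \<in> carrier (freemod R q)" "g b = lincomb C q w (\<lambda>j. g (\<gamma> j))"
    using ga' by blast
  let ?b = "lincomb B q w \<gamma>"
  have b': "?b \<in> carrier B" using w gc by (intro lincomb_closed[OF mods(2)]) auto
  have "g ?b = g b" unfolding w(2)
    using w(1) gc by (intro lincomb_hom[OF mods(2,3) g]) auto
  moreover have "g (b \<ominus>\<^bsub>B\<^esub> ?b) = g b \<ominus>\<^bsub>C\<^esub> g ?b" by (rule mod_hom_minus[OF g mods(2,3) b b'])
  ultimately have "g (b \<ominus>\<^bsub>B\<^esub> ?b) = \<zero>\<^bsub>C\<^esub>"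
    using mod_homD(1)[OF g b] by (simp add: a_minus_def C.r_neg)
  then have "b \<ominus>\<^bsub>B\<^esub> ?b \<in> f ` carrier A" using im b b' by auto
  then obtain a where a: "a \<in> carrier A" "b \<ominus>\<^bsub>B\<^esub> ?b = f a" by blast
  obtain u where u: "u \<in> carrier (freemod R p)" "a = lincomb A p u \<alpha>" using al' a by blast
  have fu: "f a = lincomb B p u (\<lambda>i. f (\<alpha> i))"
    unfolding u(2) using u(1) al'(1) by (intro lincomb_hom[OF mods(1,2) f]) auto
  have "lincomb B (p + q) (append_fam p u w) (append_fam p (\<lambda>i. f (\<alpha> i)) \<gamma>)
    = lincomb B p (append_fam p u w) (\<lambda>i. f (\<alpha> i)) \<oplus>\<^bsub>B\<^esub> lincomb B q (\<lambda>i. append_fam p u w (p + i)) \<gamma>"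
    using u(1) w(1) fa gc by (intro lincomb_append[OF mods(2)]) (auto simp: append_fam_def)
  also have "lincomb B p (append_fam p u w) (\<lambda>i. f (\<alpha> i)) = f a" unfolding fu
    using u(1) w(1) fa gc by (intro lincomb_cong[OF mods(2)]) (auto simp: append_fam_def)
  also have "(\<lambda>i. append_fam p u w (p + i)) = w" by (auto simp: append_fam_def)
  also have "f a \<oplus>\<^bsub>B\<^esub> ?b = b" unfolding a(2)[symmetric] using b b'
    by (simp add: a_minus_def B.a_assoc B.l_neg)
  finally have "b = lincomb B (p + q) (append_fam p u w) (append_fam p (\<lambda>i. f (\<alpha> i)) \<gamma>)" ..
  moreover have "\<forall>i<p+q. append_fam p u w i \<in> carrier R"
    using u w by (auto simp: append_fam_def)
  ultimately show "\<exists>v. (\<forall>i<p+q. v i \<in> carrier R) \<and>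
    b = lincomb B (p + q) v (append_fam p (\<lambda>i. f (\<alpha> i)) \<gamma>)" by blast
qed

section \<open>Finite generation of submodules of R^n over a Noetherian ring, by ideals of
  coordinates\<close>

lemma coord_ideal:
  assumes "S \<subseteq> carrier (freemod R n)" "(\<lambda>i. \<zero>) \<in> S"
    and add: "\<And>x y. x \<in> S \<Longrightarrow> y \<in> S \<Longrightarrow> (\<lambda>i. x i \<oplus> y i) \<in> S"
    and smult: "\<And>r x. r \<in> carrier R \<Longrightarrow> x \<in> S \<Longrightarrow> (\<lambda>i. r \<otimes> x i) \<in> S"
    and k: "k < n"
  shows "ideal ((\<lambda>z. z k) ` S) R"
proof (rule idealI[OF ring_axioms])
  have c: "z k \<in> carrier R" if "z \<in> S" for z using that assms(1) k by auto
  show "subgroup ((\<lambda>z. z k) ` S) (add_monoid R)"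
  proof (rule add.subgroupI)
    show "(\<lambda>z. z k) ` S \<subseteq> carrier R" using c by auto
    show "(\<lambda>z. z k) ` S \<noteq> {}" using assms(2) by auto
    fix a assume "a \<in> (\<lambda>z. z k) ` S"
    then obtain z where z: "z \<in> S" "a = z k" by auto
    have "\<ominus> a = \<ominus> \<one> \<otimes> z k" using c[OF z(1)] z by (simp add: l_minus)
    then show "\<ominus> a \<in> (\<lambda>z. z k) ` S" using smult[of "\<ominus> \<one>" z] z by auto
  next
    fix a b assume "a \<in> (\<lambda>z. z k) ` S" "b \<in> (\<lambda>z. z k) ` S"
    then show "a \<oplus> b \<in> (\<lambda>z. z k) ` S" using add by fastforce
  qed
  fix a x assume a: "a \<in> (\<lambda>z. z k) ` S" and x: "x \<in> carrier R"
  show *: "x \<otimes> a \<in> (\<lambda>z. z k) ` S" using a smult[OF x] by fastforce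
  have "a \<in> carrier R" using a c by auto
  then show "a \<otimes> x \<in> (\<lambda>z. z k) ` S" using * x by (simp add: m_comm)
qed

end

text \<open>The part of the induction step that uses the Noetherian hypothesis: generators of the
  ideal of last coordinates are lifted to Z.\<close>

lemma (in cring) noetherian_coord_generators:
  assumes "noetherian_ring R"
    and Z: "Z \<subseteq> carrier (freemod R (Suc n))" "(\<lambda>i. \<zero>) \<in> Z"
      "\<And>x y. x \<in> Z \<Longrightarrow> y \<in> Z \<Longrightarrow> (\<lambda>i. x i \<oplus> y i) \<in> Z"
      "\<And>r x. r \<in> carrier R \<Longrightarrow> x \<in> Z \<Longrightarrow> (\<lambda>i. r \<otimes> x i) \<in> Z"
  obtains k z where "\<And>i. i < k \<Longrightarrow> z i \<in> Z"
    and "\<And>x. x \<in> Z \<Longrightarrow> \<exists>w\<in>carrier (freemod R k). x n = lincomb (freemod R (Suc n)) k w z n"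
proof -
  let ?F = "freemod R (Suc n)"
  have "ideal ((\<lambda>z. z n) ` Z) R" by (rule coord_ideal[OF Z lessI])
  then obtain A where A: "A \<subseteq> carrier R" "finite A" "(\<lambda>z. z n) ` Z = Idl A"
    using noetherian_ring.finetely_gen[OF assms(1)] by blast
  obtain a where "bij_betw a {0..<card A} A" using ex_bij_betw_nat_finite[OF A(2)] ..
  then have a: "a ` {..<card A} = A" by (simp add: bij_betw_def atLeast0LessThan)
  define k where "k = card A"
  have AZ: "A \<subseteq> (\<lambda>z. z n) ` Z" unfolding A(3) by (rule genideal_self[OF A(1)])
  have "\<exists>z\<in>Z. z n = a i" if "i < k" for i
  proof -
    have "a i \<in> A" using that a by (auto simp: k_def)
    from subsetD[OF AZ this] show ?thesis by (metis imageE)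
  qed
  then obtain z where z: "\<And>i. i < k \<Longrightarrow> z i \<in> Z" "\<And>i. i < k \<Longrightarrow> z i n = a i" by metis
  have zF: "z i \<in> carrier ?F" if "i < k" for i using z(1)[OF that] Z(1) by blast
  have hom: "mod_hom R (freemod R k) ?F (\<lambda>v. lincomb ?F k v z)"
    by (rule lincomb_mod_hom[OF freemod_module zF])
  \<comment> \<open>L is the submodule generated by the lifts. Its last coordinates form an ideal
    containing A, hence containing \<open>Idl A\<close>; thus no element of \<open>Idl A\<close> has
    to be written as an explicit sum.\<close>
  define L where "L = (\<lambda>v. lincomb ?F k v z) ` carrier (freemod R k)"
  have "ideal ((\<lambda>z. z n) ` L) R"
  proof (rule coord_ideal[of _ "Suc n"])
    show "L \<subseteq> carrier ?F" unfolding L_def using mod_homD(1)[OF hom] by blast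
    show "(\<lambda>i. \<zero>) \<in> L" unfolding L_def
      using mod_hom_zero[OF hom freemod_module freemod_module] 
      by (intro image_eqI[of _ _ "\<lambda>i. \<zero>"]) auto
  next
    fix x y assume "x \<in> L" "y \<in> L"
    then obtain v w where vw: "v \<in> carrier (freemod R k)" "w \<in> carrier (freemod R k)"
      "x = lincomb ?F k v z" "y = lincomb ?F k w z" unfolding L_def by blast
    have "(\<lambda>i. x i \<oplus> y i) = lincomb ?F k (v \<oplus>\<^bsub>freemod R k\<^esub> w) z"
      using mod_homD(2)[OF hom vw(1,2)] vw by simp
    moreover have "v \<oplus>\<^bsub>freemod R k\<^esub> w \<in> carrier (freemod R k)" using vw by auto
    ultimately show "(\<lambda>i. x i \<oplus> y i) \<in> L" unfolding L_def by blast
  next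
    fix r x assume "r \<in> carrier R" "x \<in> L"
    then obtain v where vw: "v \<in> carrier (freemod R k)" 
      "x = lincomb ?F k v z" unfolding L_def by blast
    have "(\<lambda>i. r \<otimes> x i) = lincomb ?F k (r \<odot>\<^bsub>freemod R k\<^esub> v) z"
      using mod_homD(3)[OF hom \<open>r \<in> carrier R\<close> vw(1)] vw by simp
    moreover have "r \<odot>\<^bsub>freemod R k\<^esub> v \<in> carrier (freemod R k)" using vw \<open>r \<in> carrier R\<close> by auto
    ultimately show "(\<lambda>i. r \<otimes> x i) \<in> L" unfolding L_def by blast
  qed auto
  moreover have "A \<subseteq> (\<lambda>z. z n) ` L"
  proof
    fix x assume "x \<in> A"
    then obtain i where i: "i < k" "x = a i" using a unfolding k_def by blast
    have "x = lincomb ?F k (unitvec R i) z n"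
      using i by (simp add: lincomb_unitvec[OF freemod_module zF] z)
    then show "x \<in> (\<lambda>z. z n) ` L" unfolding L_def using i unitvec_closed by blast
  qed
  ultimately have JL: "(\<lambda>z. z n) ` Z \<subseteq> (\<lambda>z. z n) ` L" unfolding A(3) by (rule genideal_minimal)
  show thesis
  proof (rule that[OF z(1)])
    fix x assume "x \<in> Z"
    then show "\<exists>w\<in>carrier (freemod R k). x n = lincomb ?F k w z n"
      using JL unfolding L_def by blast
  qed
qed

text \<open>Induction on the rank along 0 -> Z' -> Z -> J -> 0, where J is the ideal of last
  coordinates of Z and Z' is the intersection of Z with R^n. As R^n consists of the vectors
  vanishing from n on, it lies in R^(n+1) without an embedding.\<close>

lemma (in cring) noetherian_submod_fin_gen:
  assumes "noetherian_ring R"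
    and "Z \<subseteq> carrier (freemod R n)" "(\<lambda>i. \<zero>) \<in> Z"
    and add: "\<And>x y. x \<in> Z \<Longrightarrow> y \<in> Z \<Longrightarrow> (\<lambda>i. x i \<oplus> y i) \<in> Z"
    and smult: "\<And>r x. r \<in> carrier R \<Longrightarrow> x \<in> Z \<Longrightarrow> (\<lambda>i. r \<otimes> x i) \<in> Z"
  shows "fin_gen R ((freemod R n)\<lparr>carrier := Z\<rparr>)"
  using assms(2-)
proof (induction n arbitrary: Z)
  case 0
  interpret F: module R "freemod R 0" by (rule freemod_module)
  interpret Z: module R "(freemod R 0)\<lparr>carrier := Z\<rparr>"
    by (rule submod_module[OF freemod_module]) (simp_all add: 0)
  have "Z \<subseteq> {\<lambda>i. \<zero>}" using 0(1) by (auto simp: fun_eq_iff dest!: subsetD)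
  then have "generates R ((freemod R 0)\<lparr>carrier := Z\<rparr>) 0 (\<lambda>_ _. \<zero>)"
    by (intro generatesI[OF Z.module_axioms]) (auto simp: lincomb_0[OF Z.module_axioms])
  then show ?case unfolding fin_gen_def by blast
next
  case (Suc n)
  let ?F = "freemod R (Suc n)"
  let ?Z = "?F\<lparr>carrier := Z\<rparr>"
  let ?Z' = "Z \<inter> carrier (freemod R n)"
  interpret F: module R ?F by (rule freemod_module)
  have Zm: "module R ?Z"
    by (rule submod_module[OF freemod_module]) (simp_all add: Suc.prems)
  obtain k z where z: "\<And>i. i < k \<Longrightarrow> z i \<in> Z"
    and zw: "\<And>x. x \<in> Z \<Longrightarrow> \<exists>w\<in>carrier (freemod R k). x n = lincomb ?F k w z n"
    using noetherian_coord_generators[OF assms(1) Suc.prems] by blast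
  have "fin_gen R ((freemod R n)\<lparr>carrier := ?Z'\<rparr>)"
    by (rule Suc.IH) (simp_all add: Suc.prems)
  then obtain m h where h: "generates R ((freemod R n)\<lparr>carrier := ?Z'\<rparr>) m h"
    unfolding fin_gen_def by blast
  have Z'm: "module R ((freemod R n)\<lparr>carrier := ?Z'\<rparr>)"
    by (rule submod_module[OF freemod_module]) (simp_all add: Suc.prems)
  note h' = generatesD[OF h Z'm]
  have inclh: "mod_hom R ((freemod R n)\<lparr>carrier := ?Z'\<rparr>) ?Z (\<lambda>x. x)"
    by (rule mod_homI) auto
  have "generates R ?Z (m + k) (append_fam m h z)"
  proof (rule generatesI[OF Zm])
    show "append_fam m h z i \<in> carrier ?Z" if "i < m + k" for i
      using that h'(1) z by (auto simp: append_fam_def)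
    fix x assume x: "x \<in> carrier ?Z"
    then obtain w where w: "w \<in> carrier (freemod R k)" "x n = lincomb ?F k w z n"
      using zw[of x] by auto
    have e: "lincomb ?Z k w z = lincomb ?F k w z"
      using w z Suc.prems by (intro lincomb_submod[OF freemod_module Zm]) auto
    have lc: "lincomb ?Z k w z \<in> Z"
      using lincomb_closed[OF Zm, of k w z] w z by auto
    \<comment> \<open>The difference of x and a combination with the same last coordinate, written
      with the scalar -1 because Z is given as closed under sums and scalar multiples.\<close>
    define y where "y = (\<lambda>i. x i \<oplus> (\<ominus> \<one>) \<otimes> lincomb ?Z k w z i)"
    have xc: "x i \<in> carrier R" "lincomb ?Z k w z i \<in> carrier R" for i
      using x lc Suc.prems(1) freemod_coord[of _ "Suc n"] by auto
    have "y \<in> Z" unfolding y_def using x lc by (intro Suc.prems) auto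
    moreover have "y n = \<zero>" unfolding y_def using w xc(2) by (simp add: e[symmetric] l_minus r_neg)
    ultimately have y: "y \<in> ?Z'" using Suc.prems(1) 
      using freemod_Suc_zero[of y n] by blast
    then obtain u where u: "u \<in> carrier (freemod R m)"
      "y = lincomb ((freemod R n)\<lparr>carrier := ?Z'\<rparr>) m u h"
      using h'(2)[of y] by auto
    have yu: "y = lincomb ?Z m u h"
      unfolding u(2) using u(1) h'(1) by (intro lincomb_hom[OF Z'm Zm inclh]) auto
    have "lincomb ?Z (m + k) (append_fam m u w) (append_fam m h z)
      = lincomb ?Z m (append_fam m u w) h \<oplus>\<^bsub>?Z\<^esub> lincomb ?Z k (\<lambda>i. append_fam m u w (m + i)) z"
      using u(1) w(1) z h'(1) by (intro lincomb_append[OF Zm]) (auto simp: append_fam_def)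
    also have "lincomb ?Z m (append_fam m u w) h = y" unfolding yu
      using u(1) h'(1) by (intro lincomb_cong[OF Zm]) (auto simp: append_fam_def)
    also have "(\<lambda>i. append_fam m u w (m + i)) = w" by (auto simp: append_fam_def)
    also have "y \<oplus>\<^bsub>?Z\<^esub> lincomb ?Z k w z = x"
      unfolding y_def using xc by (simp add: fun_eq_iff l_minus a_assoc l_neg)
    finally show "\<exists>v. (\<forall>i<m+k. v i \<in> carrier R) \<and> x = lincomb ?Z (m + k) v (append_fam m h z)"
      using u(1) w(1) by (intro exI[of _ "append_fam m u w"]) (auto simp: append_fam_def)
  qed
  then show ?case unfolding fin_gen_def by blast
qed

lemma (in cring) relmod_fin_gen:
  assumes "noetherian_ring R" "module R M" "\<And>i. i < p \<Longrightarrow> g i \<in> carrier M"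
  shows "fin_gen R (relmod R M p g)"
proof -
  interpret K: module R "relmod R M p g" using assms(2,3) by (rule relmod_module)
  have "fin_gen R ((freemod R p)\<lparr>carrier := carrier (relmod R M p g)\<rparr>)"
  proof (rule noetherian_submod_fin_gen[OF assms(1)])
    show "carrier (relmod R M p g) \<subseteq> carrier (freemod R p)" by (rule relmod_carrier_subset)
    show "(\<lambda>i. \<zero>) \<in> carrier (relmod R M p g)"
      using K.zero_closed unfolding relmod_simps(2) freemod_simps(2) .
    show "(\<lambda>i. x i \<oplus> y i) \<in> carrier (relmod R M p g)"
      if "x \<in> carrier (relmod R M p g)" "y \<in> carrier (relmod R M p g)" for x y
      using K.a_closed[OF that] unfolding relmod_simps(3) freemod_simps(3) .
    show "(\<lambda>i. r \<otimes> x i) \<in> carrier (relmod R M p g)"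
      if "r \<in> carrier R" "x \<in> carrier (relmod R M p g)" for r x
      using K.smult_closed[OF that] unfolding relmod_simps(4) freemod_simps(4) .
  qed
  then show ?thesis by (simp add: relmod_def)
qed

subsection \<open>Local rings and minimal presentations\<close>

locale noeth_local = cring R for R :: "('a, 'c) ring_scheme" (structure) +
  assumes noeth: "noetherian_ring R" and local: "\<exists>!I. maximalideal I R"

lemma noeth_localI: "noeth_local_ring R \<Longrightarrow> noeth_local R"
  by (simp add: noeth_local_ring_def local_ring_def noeth_local_def noeth_local_axioms_def)

text \<open>For a local ring this is the maximal ideal, by \<open>nonunits_ideal\<close>; congruence
  modulo it is always expressed through this set.\<close>

definition nonunits :: "('a, 'c) ring_scheme \<Rightarrow> 'a set" where
  "nonunits R = carrier R - Units R"

text \<open>X is a retract of Y, that is, a direct summand up to isomorphism. Retractions both ways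
  take the place of isomorphisms when Betti numbers are compared.\<close>

definition retr :: "('a, 'c) ring_scheme \<Rightarrow> ('a, 'm) module \<Rightarrow> ('a, 'n) module \<Rightarrow> bool" where
  "retr R X Y \<longleftrightarrow> (\<exists>s r. mod_hom R X Y s \<and> mod_hom R Y X r \<and> (\<forall>x\<in>carrier X. r (s x) = x))"

context cring
begin

lemma nonunits_carrier: "x \<in> nonunits R \<Longrightarrow> x \<in> carrier R"
  by (simp add: nonunits_def)

lemma nonunits_mult:
  assumes "x \<in> nonunits R" "a \<in> carrier R"
  shows "a \<otimes> x \<in> nonunits R"
  using assms unit_factor[of x a] by (auto simp: nonunits_def m_comm)

text \<open>Used to discard a redundant generator: the index map enumerates the numbers up to q
  other than j.\<close>

lemma lincomb_skip:
  assumes "module R M" "j \<le> q"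
    and "\<And>i. i < Suc q \<Longrightarrow> w i \<in> carrier R" "\<And>i. i < Suc q \<Longrightarrow> g i \<in> carrier M" "w j = \<zero>"
  shows "lincomb M (Suc q) w g = lincomb M q (\<lambda>i. w (if i < j then i else Suc i))
    (\<lambda>i. g (if i < j then i else Suc i))"
  using assms(2-)
proof (induction q)
  case 0
  interpret M: module R M by fact
  show ?case by (subst lincomb_Suc[OF assms(1)]) (use 0 in \<open>simp_all add: lincomb_0[OF assms(1)]\<close>)
next
  case (Suc q)
  interpret M: module R M by fact
  have g: "g (Suc q) \<in> carrier M" using Suc.prems by auto
  show ?case
  proof (cases "j = Suc q")
    case True
    have "lincomb M (Suc (Suc q)) w g = w j \<odot>\<^bsub>M\<^esub> g j \<oplus>\<^bsub>M\<^esub> lincomb M (Suc q) w g"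
      unfolding True using Suc.prems by (intro lincomb_Suc[OF assms(1)]) auto
    also have "\<dots> = lincomb M (Suc q) w g"
      using Suc.prems g True by (simp add: lincomb_closed[OF assms(1)])
    also have "\<dots> = lincomb M (Suc q) (\<lambda>i. w (if i < j then i else Suc i))
        (\<lambda>i. g (if i < j then i else Suc i))"
      using Suc.prems True by (intro lincomb_cong[OF assms(1)]) auto
    finally show ?thesis .
  next
    case False
    then have "j \<le> q" using Suc.prems by simp
    have "lincomb M (Suc (Suc q)) w g = w (Suc q) \<odot>\<^bsub>M\<^esub> g (Suc q) \<oplus>\<^bsub>M\<^esub> lincomb M (Suc q) w g"
      using Suc.prems by (intro lincomb_Suc[OF assms(1)]) auto
    also have "lincomb M (Suc q) w g = lincomb M q (\<lambda>i. w (if i < j then i else Suc i))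
        (\<lambda>i. g (if i < j then i else Suc i))"
      using Suc.prems \<open>j \<le> q\<close> by (intro Suc.IH) auto
    also have "w (Suc q) \<odot>\<^bsub>M\<^esub> g (Suc q) \<oplus>\<^bsub>M\<^esub> \<dots> = lincomb M (Suc q)
        (\<lambda>i. w (if i < j then i else Suc i)) (\<lambda>i. g (if i < j then i else Suc i))"
      using Suc.prems \<open>j \<le> q\<close> by (subst lincomb_Suc[OF assms(1)]) auto
    finally show ?thesis .
  qed
qed

text \<open>Freeness of R^p: coefficients are chosen for the images of the generators and extended
  linearly.\<close>

lemma lift_hom:
  assumes "module R M" "module R N" "mod_hom R M N f"
    and "\<And>i. i < p \<Longrightarrow> g i \<in> carrier M" and h: "generates R N q h"
  obtains \<sigma> where "mod_hom R (freemod R p) (freemod R q) \<sigma>"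
    and "\<And>v. v \<in> carrier (freemod R p) \<Longrightarrow> lincomb N q (\<sigma> v) h = f (lincomb M p v g)"
proof -
  note h' = generatesD[OF h assms(2)]
  have "\<forall>i<p. \<exists>v\<in>carrier (freemod R q). f (g i) = lincomb N q v h"
    using h'(2) mod_homD(1)[OF assms(3)] assms(4) by blast
  then obtain S where S: "\<And>i. i < p \<Longrightarrow> S i \<in> carrier (freemod R q)"
    "\<And>i. i < p \<Longrightarrow> f (g i) = lincomb N q (S i) h" by metis
  have hom: "mod_hom R (freemod R q) N (\<lambda>v. lincomb N q v h)"
    by (rule lincomb_mod_hom[OF assms(2) h'(1)])
  show thesis
  proof
    show "mod_hom R (freemod R p) (freemod R q) (\<lambda>v. lincomb (freemod R q) p v S)"
      by (rule lincomb_mod_hom[OF freemod_module S(1)])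
    fix v assume v: "v \<in> carrier (freemod R p)"
    have "lincomb N q (lincomb (freemod R q) p v S) h = lincomb N p v (\<lambda>i. lincomb N q (S i) h)"
      by (rule lincomb_hom[OF freemod_module assms(2) hom]) (use v S in auto)
    also have "\<dots> = lincomb N p v (\<lambda>i. f (g i))"
      by (rule lincomb_cong[OF assms(2)])
        (use v S(2) mod_homD(1)[OF hom S(1)] in auto)
    also have "\<dots> = f (lincomb M p v g)"
      by (rule lincomb_hom[OF assms(1-3), symmetric]) (use v assms(4) in auto)
    finally show "lincomb N q (lincomb (freemod R q) p v S) h = f (lincomb M p v g)" .
  qed
qed

end

section \<open>The maximal ideal, and endomorphisms congruent to the identity modulo it\<close>

context noeth_local
begin

text \<open>A nonempty chain of ideals in a Noetherian ring contains its own union. So the upper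
  bound required by Zorn's lemma is a member of the chain, and in particular proper.\<close>

lemma maximalideal_exists:
  assumes "ideal J R" "J \<noteq> carrier R"
  shows "\<exists>I. maximalideal I R \<and> J \<subseteq> I"
proof -
  define S where "S = {I. ideal I R \<and> J \<subseteq> I \<and> I \<noteq> carrier R}"
  have "\<exists>M\<in>S. \<forall>X\<in>S. M \<subseteq> X \<longrightarrow> X = M"
  proof (rule subset_Zorn_nonempty)
    show "S \<noteq> {}" using assms by (auto simp: S_def)
    fix C assume "C \<noteq> {}" and C: "subset.chain S C"
    then have "\<Union>C \<in> C"
      using noetherian_ring.ideal_chain_is_trivial[OF noeth, of C]
      unfolding pred_on.chain_def S_def by blast
    then show "\<Union>C \<in> S" using C unfolding pred_on.chain_def by blast
  qed
  then obtain M where MS: "M \<in> S" and max: "\<And>X. X \<in> S \<Longrightarrow> M \<subseteq> X \<Longrightarrow> X = M" by blast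
  then have M: "ideal M R" "J \<subseteq> M" "M \<noteq> carrier R" by (auto simp: S_def)
  have "maximalideal M R"
  proof (rule maximalidealI[OF M(1)])
    show "carrier R \<noteq> M" using M(3) by simp
    fix X assume "ideal X R" "M \<subseteq> X"
    then show "X = M \<or> X = carrier R" using max[of X] M(2) by (auto simp: S_def)
  qed
  with M(2) show ?thesis by blast
qed

text \<open>A nonunit generates a proper ideal, which lies in some maximal ideal and hence in the
  only one; conversely a proper ideal contains no unit.\<close>

lemma nonunits_ideal: "ideal (nonunits R) R"
proof -
  obtain I where I: "maximalideal I R" using local by blast
  interpret I: maximalideal I R by fact
  have "nonunits R = I"
  proof
    show "nonunits R \<subseteq> I"
    proof
      fix x assume x: "x \<in> nonunits R"
      then have xc: "x \<in> carrier R" by (rule nonunits_carrier)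
      have "\<one> \<notin> PIdl x"
      proof
        assume "\<one> \<in> PIdl x"
        then obtain y where "y \<in> carrier R" "\<one> = y \<otimes> x" by (auto simp: cgenideal_def)
        then have "x \<in> Units R" using xc m_comm[of x y] unfolding Units_def by force
        then show False using x by (simp add: nonunits_def)
      qed
      then have "PIdl x \<noteq> carrier R" by auto
      then obtain J where "maximalideal J R" "PIdl x \<subseteq> J"
        using maximalideal_exists[OF cgenideal_ideal[OF xc]] by blast
      moreover have "J = I" using local I calculation by blast
      ultimately show "x \<in> I" using cgenideal_self[OF xc] by blast
    qed
    show "I \<subseteq> nonunits R"
    proof
      fix x assume x: "x \<in> I"
      have "x \<notin> Units R"
      proof
        assume u: "x \<in> Units R"
        have "inv x \<otimes> x \<in> I" using x u by (intro I.I_l_closed) auto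
        then have "\<one> \<in> I" using u by simp
        then show False using I.one_imp_carrier I.I_notcarr by simp
      qed
      then show "x \<in> nonunits R" using x I.a_Hcarr by (simp add: nonunits_def)
    qed
  qed
  then show ?thesis using I.ideal_axioms by simp
qed

lemma nonunits_zero: "\<zero> \<in> nonunits R"
  using nonunits_ideal by (simp add: additive_subgroup.zero_closed ideal.axioms(1))

lemma nonunits_add: "x \<in> nonunits R \<Longrightarrow> y \<in> nonunits R \<Longrightarrow> x \<oplus> y \<in> nonunits R"
  using nonunits_ideal by (simp add: additive_subgroup.a_closed ideal.axioms(1))

lemma nonunits_uminus: "x \<in> nonunits R \<Longrightarrow> \<ominus> x \<in> nonunits R"
  using nonunits_ideal by (simp add: additive_subgroup.a_inv_closed ideal.axioms(1))

lemma one_minus_nonunit: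
  assumes "x \<in> nonunits R"
  shows "\<one> \<ominus> x \<in> Units R"
proof (rule ccontr)
  have x: "x \<in> carrier R" using assms by (rule nonunits_carrier)
  assume "\<one> \<ominus> x \<notin> Units R"
  then have "\<one> \<ominus> x \<in> nonunits R" using x by (simp add: nonunits_def)
  then have "(\<one> \<ominus> x) \<oplus> x \<in> nonunits R" using assms by (rule nonunits_add)
  moreover have "(\<one> \<ominus> x) \<oplus> x = \<one>" using x by algebra
  ultimately show False by (simp add: nonunits_def)
qed

lemma lincomb_nonunits:
  assumes "\<And>i. i < p \<Longrightarrow> v i \<in> carrier R" "\<And>i. i < p \<Longrightarrow> c i \<in> carrier (freemod R q)"
    and "\<And>i. i < p \<Longrightarrow> v i \<in> nonunits R \<or> c i j \<in> nonunits R"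
  shows "lincomb (freemod R q) p v c j \<in> nonunits R"
  using assms
proof (induction p)
  case 0
  then show ?case by (simp add: lincomb_0[OF freemod_module] nonunits_zero)
next
  case (Suc p)
  have "lincomb (freemod R q) (Suc p) v c j = v p \<otimes> c p j \<oplus> lincomb (freemod R q) p v c j"
    by (subst lincomb_Suc[OF freemod_module]) (use Suc.prems in auto)
  moreover have "v p \<otimes> c p j \<in> nonunits R"
  proof -
    have "v p \<in> carrier R" "c p j \<in> carrier R"
      using Suc.prems(1)[of p] freemod_coord[OF Suc.prems(2)[of p]] by simp_all
    moreover from this have "v p \<otimes> c p j = c p j \<otimes> v p" by (rule m_comm)
    moreover have "v p \<in> nonunits R \<or> c p j \<in> nonunits R" using Suc.prems(3) by simp
    ultimately show ?thesis using nonunits_mult[of "v p" "c p j"] nonunits_mult[of "c p j" "v p"]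
      by auto
  qed
  moreover have "lincomb (freemod R q) p v c j \<in> nonunits R"
    using Suc.prems by (intro Suc.IH) auto
  ultimately show ?case by (simp add: nonunits_add)
qed

lemma hom_nonunits:
  assumes "mod_hom R (freemod R p) (freemod R q) f" "v \<in> carrier (freemod R p)"
    and "\<And>i. v i \<in> nonunits R"
  shows "f v j \<in> nonunits R"
  unfolding hom_freemod_eq[OF assms(1) freemod_module assms(2)]
proof (rule lincomb_nonunits)
  fix i assume "i < p"
  then show "f (unitvec R i) \<in> carrier (freemod R q)" by (intro mod_homD(1)[OF assms(1)] unitvec_closed)
qed (use assms(2,3) in auto)

text \<open>Nakayama's lemma by elimination, without determinants. Modulo the image of f every
  vector is congruent to one with nonunit entries supported on the first k coordinates; k descends
  from p to 0, where no remainder is left.\<close>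

lemma near_id_surj:
  assumes f: "mod_hom R (freemod R p) (freemod R p) f"
    and near: "\<And>v i. v \<in> carrier (freemod R p) \<Longrightarrow> f v i \<ominus> v i \<in> nonunits R"
    and x: "x \<in> carrier (freemod R p)"
  shows "\<exists>u\<in>carrier (freemod R p). f u = x"
proof -
  have fc: "f v i \<in> carrier R" if "v \<in> carrier (freemod R p)" for v i
    by (rule freemod_coord[OF mod_homD(1)[OF f that]])
  have "\<forall>x\<in>carrier (freemod R p). \<exists>u\<in>carrier (freemod R p). \<exists>w\<in>carrier (freemod R k).
      x = (\<lambda>i. f u i \<oplus> w i) \<and> (\<forall>i. w i \<in> nonunits R)" if "k \<le> p" for k
    using that
  proof (induction rule: inc_induct)
    case base
    show ?case
    proof
      fix x assume x: "x \<in> carrier (freemod R p)"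
      note xc = freemod_coord[OF x]
      have "f x i \<oplus> (x i \<ominus> f x i) = x i" for i using xc[of i] fc[OF x, of i] by algebra
      moreover have "x i \<ominus> f x i \<in> nonunits R" for i
      proof -
        have "x i \<ominus> f x i = \<ominus> (f x i \<ominus> x i)" using xc[of i] fc[OF x, of i] by algebra
        then show ?thesis using near[OF x] nonunits_uminus by simp
      qed
      moreover have "(\<lambda>i. x i \<ominus> f x i) \<in> carrier (freemod R p)"
        using x mod_homD(1)[OF f x] by (auto simp: a_minus_def)
      ultimately show "\<exists>u\<in>carrier (freemod R p). \<exists>w\<in>carrier (freemod R p).
          x = (\<lambda>i. f u i \<oplus> w i) \<and> (\<forall>i. w i \<in> nonunits R)"
        using x by (intro bexI[of _ x] bexI[of _ "\<lambda>i. x i \<ominus> f x i"]) (auto simp: fun_eq_iff)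
    qed
  next
    case (step k)
    have ek: "unitvec R k \<in> carrier (freemod R p)" using step.hyps by (intro unitvec_closed) simp
    \<comment> \<open>The induction hypothesis is applied to the k-th unit vector itself. The entry
      k of its remainder is a nonunit, so 1 - w0 k can be inverted, which expresses this unit vector
      through the image of f and a remainder w1 supported below k.\<close>
    obtain u0 w0 where u0: "u0 \<in> carrier (freemod R p)" and w0: "w0 \<in> carrier (freemod R (Suc k))"
      "unitvec R k = (\<lambda>i. f u0 i \<oplus> w0 i)" "\<And>i. w0 i \<in> nonunits R"
      using bspec[OF step.IH ek] by blast
    note u0c = freemod_coord[OF u0] and w0c = freemod_coord[OF w0(1)]
    have U: "\<one> \<ominus> w0 k \<in> Units R" by (rule one_minus_nonunit[OF w0(3)])
    define t where "t = inv (\<one> \<ominus> w0 k)"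
    have t: "t \<in> carrier R" "t \<otimes> (\<one> \<ominus> w0 k) = \<one>" using U by (auto simp: t_def)
    define w1 where "w1 = (\<lambda>i. if i = k then \<zero> else w0 i)"
    have w1: "w1 \<in> carrier (freemod R k)" using w0(1) by (auto simp: w1_def)
    have w1c: "w1 i \<in> carrier R" for i by (rule freemod_coord[OF w1])
    have eq0: "unitvec R k i = t \<otimes> f u0 i \<oplus> t \<otimes> w1 i" for i
    proof (cases "i = k")
      case True
      have "\<one> = f u0 k \<oplus> w0 k" using fun_cong[OF w0(2), of k] by (simp add: unitvec_def)
      then have "f u0 k = \<one> \<ominus> w0 k" using fc[OF u0, of k] w0c[of k] by algebra
      then show ?thesis using t True by (simp add: unitvec_def w1_def)
    next
      case False
      have "f u0 i \<oplus> w0 i = \<zero>" using fun_cong[OF w0(2), of i] False by (simp add: unitvec_def)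
      then have "t \<otimes> (f u0 i \<oplus> w0 i) = \<zero>" using t by simp
      then show ?thesis using False t fc[OF u0, of i] w0c[of i]
        by (simp add: unitvec_def w1_def r_distr)
    qed
    show ?case
    proof
      fix x assume x: "x \<in> carrier (freemod R p)"
      obtain u w where u: "u \<in> carrier (freemod R p)" and w: "w \<in> carrier (freemod R (Suc k))"
        "x = (\<lambda>i. f u i \<oplus> w i)" "\<And>i. w i \<in> nonunits R"
        using bspec[OF step.IH x] by blast
      note wc = freemod_coord[OF w(1)]
      \<comment> \<open>The entry w k of the remainder is removed by inserting w k times
        \<open>eq0\<close>.\<close>
      define s where "s = w k \<otimes> t"
      have s: "s \<in> carrier R" using wc t by (simp add: s_def)
      let ?u = "\<lambda>i. u i \<oplus> s \<otimes> u0 i" and ?w = "\<lambda>i. (if i = k then \<zero> else w i) \<oplus> s \<otimes> w1 i"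
      have uu: "?u \<in> carrier (freemod R p)" using u u0 s by auto
      have fu: "f ?u i = f u i \<oplus> s \<otimes> f u0 i" for i
      proof -
        have "s \<odot>\<^bsub>freemod R p\<^esub> u0 \<in> carrier (freemod R p)" using u0 s by auto
        then have "f (u \<oplus>\<^bsub>freemod R p\<^esub> s \<odot>\<^bsub>freemod R p\<^esub> u0)
          = f u \<oplus>\<^bsub>freemod R p\<^esub> s \<odot>\<^bsub>freemod R p\<^esub> f u0"
          using mod_homD(2)[OF f u] mod_homD(3)[OF f s u0] by metis
        then show ?thesis by simp
      qed
      have "x i = f ?u i \<oplus> ?w i" for i
      proof -
        define wi where "wi = (if i = k then \<zero> else w i)"
        have wi: "wi \<in> carrier R" using wc by (simp add: wi_def)
        have "x i = f u i \<oplus> wi \<oplus> w k \<otimes> unitvec R k i"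
          using wc fc[OF u] by (simp add: w(2) unitvec_def wi_def)
        also have "\<dots> = f u i \<oplus> wi \<oplus> w k \<otimes> (t \<otimes> f u0 i \<oplus> t \<otimes> w1 i)"
          by (simp only: eq0)
        also have "\<dots> = f u i \<oplus> s \<otimes> f u0 i \<oplus> (wi \<oplus> s \<otimes> w1 i)"
          unfolding s_def using wc[of k] wi fc[OF u, of i] fc[OF u0, of i] t(1) w1c[of i]
          by algebra
        also have "\<dots> = f ?u i \<oplus> ?w i" by (simp only: fu wi_def)
        finally show ?thesis .
      qed
      moreover have "?w \<in> carrier (freemod R k)"
        using w(1) w1 s by auto
      moreover have "?w i \<in> nonunits R" for i
      proof -
        have "w1 i \<in> nonunits R" using w0(3) nonunits_zero by (simp add: w1_def)
        then show ?thesis using w(3) nonunits_zero s by (auto intro!: nonunits_add nonunits_mult)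
      qed
      ultimately show "\<exists>u\<in>carrier (freemod R p). \<exists>w\<in>carrier (freemod R k).
          x = (\<lambda>i. f u i \<oplus> w i) \<and> (\<forall>i. w i \<in> nonunits R)"
        using uu by (intro bexI[of _ ?u] bexI[of _ ?w]) (simp_all add: fun_eq_iff del: freemod_simps)
    qed
  qed
  from this[of 0] obtain u w where u: "u \<in> carrier (freemod R p)" "w \<in> carrier (freemod R 0)"
    "x = (\<lambda>i. f u i \<oplus> w i)" using x by blast
  have "w i = \<zero>" for i using u(2) by simp
  then have "f u = x" unfolding u(3) using fc[OF u(1)] by (simp add: fun_eq_iff)
  then show ?thesis using u(1) by blast
qed

text \<open>Preimages of the unit vectors define h. It is again congruent to the identity, since f
  (h v) - h v = v - h v, so that the lemma can be applied to h in turn.\<close>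

lemma near_id_right_inverse:
  assumes f: "mod_hom R (freemod R p) (freemod R p) f"
    and near: "\<And>v i. v \<in> carrier (freemod R p) \<Longrightarrow> f v i \<ominus> v i \<in> nonunits R"
  obtains h where "mod_hom R (freemod R p) (freemod R p) h"
    "\<And>v. v \<in> carrier (freemod R p) \<Longrightarrow> f (h v) = v"
    "\<And>v i. v \<in> carrier (freemod R p) \<Longrightarrow> h v i \<ominus> v i \<in> nonunits R"
proof -
  have "\<forall>i<p. \<exists>u\<in>carrier (freemod R p). f u = unitvec R i"
    using near_id_surj[OF assms] unitvec_closed by blast
  then obtain c where c: "\<And>i. i < p \<Longrightarrow> c i \<in> carrier (freemod R p)"
    "\<And>i. i < p \<Longrightarrow> f (c i) = unitvec R i" by metis
  let ?h = "\<lambda>v. lincomb (freemod R p) p v c"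
  have h: "mod_hom R (freemod R p) (freemod R p) ?h" by (rule lincomb_mod_hom[OF freemod_module c(1)])
  have fh: "f (?h v) = v" if v: "v \<in> carrier (freemod R p)" for v
  proof -
    have "f (?h v) = lincomb (freemod R p) p v (\<lambda>i. f (c i))"
      by (rule lincomb_hom[OF freemod_module freemod_module f]) (use v c in auto)
    also have "\<dots> = lincomb (freemod R p) p v (unitvec R)"
      by (rule lincomb_cong[OF freemod_module])
        (use v in \<open>auto simp: c(2) mod_homD(1)[OF f c(1)] simp del: freemod_simps(1) dest: freemod_coord\<close>)
    also have "\<dots> = v" by (rule lincomb_unitvecs[OF v])
    finally show ?thesis .
  qed
  show thesis
  proof (rule that[OF h fh])
    fix v i assume v: "v \<in> carrier (freemod R p)"
    note hv = mod_homD(1)[OF h v]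
    have "v i \<ominus> ?h v i \<in> nonunits R" using near[OF hv, of i] by (simp add: fh[OF v])
    moreover have "?h v i \<ominus> v i = \<ominus> (v i \<ominus> ?h v i)"
      using freemod_coord[OF v, of i] freemod_coord[OF hv, of i] by algebra
    ultimately show "?h v i \<ominus> v i \<in> nonunits R" by (simp add: nonunits_uminus)
  qed
qed

text \<open>The right inverse h of f has a right inverse k of its own; then f = f h k = k, hence h f
  = h k is the identity.\<close>

lemma near_id_inverse:
  assumes f: "mod_hom R (freemod R p) (freemod R p) f"
    and near: "\<And>v i. v \<in> carrier (freemod R p) \<Longrightarrow> f v i \<ominus> v i \<in> nonunits R"
  obtains h where "mod_hom R (freemod R p) (freemod R p) h"
    "\<And>v. v \<in> carrier (freemod R p) \<Longrightarrow> f (h v) = v"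
    "\<And>v. v \<in> carrier (freemod R p) \<Longrightarrow> h (f v) = v"
proof -
  obtain h where h: "mod_hom R (freemod R p) (freemod R p) h"
    "\<And>v. v \<in> carrier (freemod R p) \<Longrightarrow> f (h v) = v"
    "\<And>v i. v \<in> carrier (freemod R p) \<Longrightarrow> h v i \<ominus> v i \<in> nonunits R"
    by (rule near_id_right_inverse[OF f]) (erule near, rule that)
  obtain k where k: "mod_hom R (freemod R p) (freemod R p) k"
    "\<And>v. v \<in> carrier (freemod R p) \<Longrightarrow> h (k v) = v"
    by (rule near_id_right_inverse[OF h(1)]) (erule h(3), rule that)
  have "f v = k v" if "v \<in> carrier (freemod R p)" for v
    using h(2)[OF mod_homD(1)[OF k(1) that]] k(2)[OF that] by simp
  then show thesis using that[OF h(1,2)] k(2) by simp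
qed

text \<open>A unit as coefficient j of a relation would express generator j through the others,
  against minimality.\<close>

lemma mingens_relation_nonunits:
  assumes M: "module R M" and g: "generates R M (mingens R M) g"
    and v: "v \<in> carrier (relmod R M (mingens R M) g)"
  shows "v j \<in> nonunits R"
proof (rule ccontr)
  interpret M: module R M by fact
  note g' = generatesD[OF g M]
  assume "v j \<notin> nonunits R"
  moreover have vF: "v \<in> carrier (freemod R (mingens R M))" using v by simp
  note vc = freemod_coord[OF vF]
  ultimately have u: "v j \<in> Units R" using vc by (simp add: nonunits_def)
  then have "v j \<noteq> \<zero>" using nonunits_zero by (auto simp: nonunits_def)
  then have "j < mingens R M" using vF by (auto simp: not_less[symmetric])
  then obtain q where q: "mingens R M = Suc q" "j \<le> q" by (cases "mingens R M") auto
  let ?s = "\<lambda>i. if i < j then i else Suc i"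
  have "generates R M q (\<lambda>i. g (?s i))"
  proof (rule generatesI[OF M])
    show "g (?s i) \<in> carrier M" if "i < q" for i using g'(1)[of "?s i"] that q by auto
    fix x assume "x \<in> carrier M"
    then obtain w where w: "w \<in> carrier (freemod R (Suc q))" "x = lincomb M (Suc q) w g"
      using g'(2) q by metis
    note wc = freemod_coord[OF w(1)]
    \<comment> \<open>Adding r times the relation v keeps the value of the combination and cancels
      its coefficient at j.\<close>
    define r where "r = \<ominus> (w j \<otimes> inv (v j))"
    have r: "r \<in> carrier R" using wc u by (simp add: r_def)
    let ?w = "\<lambda>i. w i \<oplus> r \<otimes> v i"
    have "lincomb M (Suc q) ?w g = lincomb M (Suc q) w g \<oplus>\<^bsub>M\<^esub> lincomb M (Suc q) (\<lambda>i. r \<otimes> v i) g"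
      by (rule lincomb_add[OF M]) (use wc vc r g' q in auto)
    also have "lincomb M (Suc q) (\<lambda>i. r \<otimes> v i) g = r \<odot>\<^bsub>M\<^esub> lincomb M (Suc q) v g"
      by (rule lincomb_smult[OF M]) (use vc r g' q in auto)
    also have "\<dots> = \<zero>\<^bsub>M\<^esub>" using v q r by simp
    also have "lincomb M (Suc q) w g \<oplus>\<^bsub>M\<^esub> \<zero>\<^bsub>M\<^esub> = x"
      using \<open>x \<in> carrier M\<close> w(2) by simp
    finally have x: "x = lincomb M (Suc q) ?w g" ..
    have "?w j = \<zero>" using wc[of j] u
      by (simp add: r_def l_minus m_assoc r_neg Units_closed)
    then have "x = lincomb M q (\<lambda>i. ?w (?s i)) (\<lambda>i. g (?s i))"
      unfolding x using q wc vc r g' by (intro lincomb_skip[OF M]) auto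
    then show "\<exists>v. (\<forall>i<q. v i \<in> carrier R) \<and> x = lincomb M q v (\<lambda>i. g (?s i))"
      using wc vc r by (intro exI[of _ "\<lambda>i. ?w (?s i)"]) auto
  qed
  from mingens_le[OF this] q show False by simp
qed

text \<open>The lifts need not compose to the identity of R^p, but \<rho> (\<sigma> v) - v is a
  relation, hence has nonunit entries by \<open>min\<close>; so the composite can be inverted and
  \<rho> corrected. The presentation of Y is arbitrary, as the presentations produced by the
  horseshoe lemma require.\<close>

lemma retr_relmod:
  assumes X: "module R X" and Y: "module R Y" and "retr R X Y"
    and g: "generates R X p g" and h: "generates R Y q h"
    and min: "\<And>v i. v \<in> carrier (relmod R X p g) \<Longrightarrow> v i \<in> nonunits R"
  shows "retr R (relmod R X p g) (relmod R Y q h)"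
proof -
  obtain s r where s: "mod_hom R X Y s" and r: "mod_hom R Y X r"
    and rs: "\<And>x. x \<in> carrier X \<Longrightarrow> r (s x) = x"
    using \<open>retr R X Y\<close> unfolding retr_def by blast
  note g' = generatesD[OF g X] and h' = generatesD[OF h Y]
  obtain \<sigma> where \<sigma>: "mod_hom R (freemod R p) (freemod R q) \<sigma>"
    "\<And>v. v \<in> carrier (freemod R p) \<Longrightarrow> lincomb Y q (\<sigma> v) h = s (lincomb X p v g)"
    by (rule lift_hom[OF X Y s _ h]) (erule g'(1), rule that)
  obtain \<rho> where \<rho>: "mod_hom R (freemod R q) (freemod R p) \<rho>"
    "\<And>v. v \<in> carrier (freemod R q) \<Longrightarrow> lincomb X p (\<rho> v) g = r (lincomb Y q v h)"
    by (rule lift_hom[OF Y X r _ g]) (erule h'(1), rule that)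
  let ?f = "\<lambda>v. \<rho> (\<sigma> v)"
  have f: "mod_hom R (freemod R p) (freemod R p) ?f" by (rule mod_hom_comp[OF \<sigma>(1) \<rho>(1)])
  interpret X: module R X by fact
  interpret Y: module R Y by fact
  interpret F: module R "freemod R p" by (rule freemod_module)
  have pX: "mod_hom R (freemod R p) X (\<lambda>v. lincomb X p v g)"
    by (rule lincomb_mod_hom[OF X g'(1)])
  have feq: "lincomb X p (?f v) g = lincomb X p v g" if v: "v \<in> carrier (freemod R p)" for v
    using \<sigma>(2)[OF v] \<rho>(2)[OF mod_homD(1)[OF \<sigma>(1) v]] rs mod_homD(1)[OF pX v] by simp
  have near: "?f v i \<ominus> v i \<in> nonunits R" if v: "v \<in> carrier (freemod R p)" for v i
  proof -
    note fv = mod_homD(1)[OF f v]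
    let ?w = "\<lambda>i. ?f v i \<oplus> (\<ominus> \<one>) \<otimes> v i"
    have w: "?f v \<oplus>\<^bsub>freemod R p\<^esub> (\<ominus> \<one>) \<odot>\<^bsub>freemod R p\<^esub> v \<in> carrier (freemod R p)"
      using fv v by (intro F.a_closed F.smult_closed) auto
    have "lincomb X p ?w g = lincomb X p (?f v) g \<oplus>\<^bsub>X\<^esub> (\<ominus> \<one>) \<odot>\<^bsub>X\<^esub> lincomb X p v g"
      using mod_homD(2)[OF pX fv F.smult_closed[OF _ v], of "\<ominus> \<one>"] mod_homD(3)[OF pX _ v, of "\<ominus> \<one>"]
      by simp
    also have "\<dots> = \<zero>\<^bsub>X\<^esub>" using mod_homD(1)[OF pX v]
      by (simp add: feq[OF v] X.smult_l_minus X.r_neg)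
    finally have "?w \<in> carrier (relmod R X p g)" using w by simp
    from min[OF this, of i] show ?thesis
      using freemod_coord[OF v, of i] by (simp add: a_minus_def l_minus)
  qed
  obtain k where k: "mod_hom R (freemod R p) (freemod R p) k"
    "\<And>v. v \<in> carrier (freemod R p) \<Longrightarrow> ?f (k v) = v"
    "\<And>v. v \<in> carrier (freemod R p) \<Longrightarrow> k (?f v) = v"
    by (rule near_id_inverse[OF f]) (erule near, rule that)
  \<comment> \<open>The inverse respects the cover too, so \<rho> followed by k still sends
    relations to relations.\<close>
  have keq: "lincomb X p (k v) g = lincomb X p v g" if v: "v \<in> carrier (freemod R p)" for v
    using feq[OF mod_homD(1)[OF k(1) v]] k(2)[OF v] by simp
  have "mod_hom R (relmod R X p g) (relmod R Y q h) \<sigma>"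
    using mod_homD[OF \<sigma>(1)] \<sigma>(2) mod_hom_zero[OF s X Y]
    by (intro mod_homI) (simp_all del: freemod_simps)
  moreover have "mod_hom R (relmod R Y q h) (relmod R X p g) (\<lambda>v. k (\<rho> v))"
    using mod_homD[OF \<rho>(1)] mod_homD[OF k(1)] keq \<rho>(2) mod_hom_zero[OF r Y X]
    by (intro mod_homI) (simp_all del: freemod_simps)
  ultimately show ?thesis unfolding retr_def using k(3) relmod_carrier_subset by blast
qed

end

text \<open>Linear dependence of p > q vectors of length q over the residue field, stated with units
  and nonunits of R. The proof is Gaussian elimination on the last row q: either it vanishes modulo
  the maximal ideal and can be deleted, or it has a unit entry, which serves as pivot.\<close>

lemma (in noeth_local) hom_dependent:
  assumes "mod_hom R (freemod R p) (freemod R q) \<sigma>" "q < p"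
  shows "\<exists>x\<in>carrier (freemod R p). (\<exists>i. x i \<in> Units R) \<and> (\<forall>j. \<sigma> x j \<in> nonunits R)"
  using assms
proof (induction q arbitrary: p \<sigma>)
  case 0
  have e: "unitvec R 0 \<in> carrier (freemod R p)" using 0 by (intro unitvec_closed) simp
  have "\<sigma> (unitvec R 0) j \<in> nonunits R" for j
    using mod_homD(1)[OF 0(1) e] nonunits_zero by simp
  moreover have "unitvec R 0 0 \<in> Units R" by (simp add: unitvec_def)
  ultimately show ?case using e by blast
next
  case (Suc q)
  note \<sigma> = mod_homD[OF Suc.prems(1)]
  show ?case
  proof (cases "\<forall>y\<in>carrier (freemod R p). \<sigma> y q \<in> nonunits R")
    case True
    let ?t = "\<lambda>y. (\<sigma> y)(q := \<zero>)"
    have "mod_hom R (freemod R p) (freemod R q) ?t"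
    proof (rule mod_homI)
      fix y assume "y \<in> carrier (freemod R p)"
      from \<sigma>(1)[OF this] show "?t y \<in> carrier (freemod R q)" by (auto simp: le_less_Suc_eq)
    qed (auto simp: \<sigma>(2,3)[simplified] fun_eq_iff)
    from Suc.IH[OF this Suc_lessD[OF Suc.prems(2)]] obtain x where x: "x \<in> carrier (freemod R p)"
      "\<exists>i. x i \<in> Units R" "\<And>j. ?t x j \<in> nonunits R" by blast
    have "\<sigma> x j \<in> nonunits R" for j
      using True x(1) x(3)[of j] by (cases "j = q") auto
    then show ?thesis using x by blast
  next
    case False
    have "\<exists>i<p. \<sigma> (unitvec R i) q \<in> Units R"
    proof (rule ccontr)
      assume n: "\<not> ?thesis"
      have "\<sigma> y q \<in> nonunits R" if y: "y \<in> carrier (freemod R p)" for y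
        unfolding hom_freemod_eq[OF Suc.prems(1) freemod_module y]
      proof (rule lincomb_nonunits)
        fix i assume i: "i < p"
        show c: "\<sigma> (unitvec R i) \<in> carrier (freemod R (Suc q))"
          by (rule \<sigma>(1)[OF unitvec_closed[OF i]])
        show "y i \<in> carrier R" using freemod_coord[OF y] .
        show "y i \<in> nonunits R \<or> \<sigma> (unitvec R i) q \<in> nonunits R"
          using n i freemod_coord[OF c] by (auto simp: nonunits_def)
      qed
      then show False using False by blast
    qed
    then obtain i where i: "i < p" "\<sigma> (unitvec R i) q \<in> Units R" by blast
    obtain p' where p': "p = Suc p'" using i by (cases p) auto
    define e where "e = unitvec R i"
    have e: "e \<in> carrier (freemod R p)" unfolding e_def by (rule unitvec_closed[OF i(1)])
    define u where "u = inv (\<sigma> e q)"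
    have u: "u \<in> carrier R" "u \<otimes> \<sigma> e q = \<one>" using i(2) by (auto simp: u_def e_def)
    \<comment> \<open>Embeds R^(p-1) as the vectors with entry 0 at the pivot position i.\<close>
    define \<tau> where "\<tau> = (\<lambda>x k. if k < i then x k else if k = i then \<zero> else x (k - 1) :: 'a)"
    have \<tau>: "mod_hom R (freemod R p') (freemod R p) \<tau>"
      using i(1) by (intro mod_homI) (auto simp: \<tau>_def p' fun_eq_iff)
    \<comment> \<open>Chosen so that correcting \<tau> x by t x times e makes coordinate q of the
      image under \<sigma> vanish.\<close>
    define t where "t = (\<lambda>x. \<ominus> (\<sigma> (\<tau> x) q \<otimes> u))"
    note \<sigma>\<tau> = mod_homD[OF mod_hom_comp[OF \<tau> Suc.prems(1)]]
    have \<sigma>\<tau>c: "\<sigma> (\<tau> x) k \<in> carrier R" if "x \<in> carrier (freemod R p')" for x k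
      by (rule freemod_coord[OF \<sigma>\<tau>(1)[OF that]])
    have tc: "t x \<in> carrier R" if "x \<in> carrier (freemod R p')" for x
      using \<sigma>\<tau>c[OF that, of q] u by (simp add: t_def)
    have tadd: "t (x \<oplus>\<^bsub>freemod R p'\<^esub> y) = t x \<oplus> t y"
      if "x \<in> carrier (freemod R p')" "y \<in> carrier (freemod R p')" for x y
      using \<sigma>\<tau>(2)[OF that] \<sigma>\<tau>c[OF that(1), of q] \<sigma>\<tau>c[OF that(2), of q] u
      by (simp add: t_def l_distr minus_add)
    have tmul: "t (r \<odot>\<^bsub>freemod R p'\<^esub> x) = r \<otimes> t x"
      if "r \<in> carrier R" "x \<in> carrier (freemod R p')" for r x
      using \<sigma>\<tau>(3)[OF that] \<sigma>\<tau>c[OF that(2), of q] that u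
      by (simp add: t_def m_assoc r_minus)
    define \<mu> where "\<mu> = (\<lambda>x. \<tau> x \<oplus>\<^bsub>freemod R p\<^esub> t x \<odot>\<^bsub>freemod R p\<^esub> e)"
    interpret F: module R "freemod R p" by (rule freemod_module)
    have te: "t x \<odot>\<^bsub>freemod R p\<^esub> e \<in> carrier (freemod R p)" if "x \<in> carrier (freemod R p')" for x
      by (rule F.smult_closed[OF tc[OF that] e])
    have \<mu>: "mod_hom R (freemod R p') (freemod R p) \<mu>"
    proof (rule mod_homI)
      fix x assume x: "x \<in> carrier (freemod R p')"
      show "\<mu> x \<in> carrier (freemod R p)" unfolding \<mu>_def
        by (intro F.a_closed mod_homD(1)[OF \<tau>] te x)
      fix y assume y: "y \<in> carrier (freemod R p')"
      show "\<mu> (x \<oplus>\<^bsub>freemod R p'\<^esub> y) = \<mu> x \<oplus>\<^bsub>freemod R p\<^esub> \<mu> y"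
        unfolding \<mu>_def tadd[OF x y] mod_homD(2)[OF \<tau> x y] F.smult_l_distr[OF tc[OF x] tc[OF y] e]
        using mod_homD(1)[OF \<tau>, OF x] mod_homD(1)[OF \<tau>, OF y] te[OF x] te[OF y]
        by (simp del: freemod_simps add: F.a_ac)
    next
      fix r x assume r: "r \<in> carrier R" and x: "x \<in> carrier (freemod R p')"
      show "\<mu> (r \<odot>\<^bsub>freemod R p'\<^esub> x) = r \<odot>\<^bsub>freemod R p\<^esub> \<mu> x"
        unfolding \<mu>_def tmul[OF r x] mod_homD(3)[OF \<tau> r x] F.smult_assoc1[OF r tc[OF x] e]
        using mod_homD(1)[OF \<tau>, OF x] te[OF x] r
        by (simp del: freemod_simps add: F.smult_r_distr)
    qed
    have q0: "\<sigma> (\<mu> x) q = \<zero>" if x: "x \<in> carrier (freemod R p')" for x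
    proof -
      have "\<sigma> (\<mu> x) q = \<sigma> (\<tau> x) q \<oplus> t x \<otimes> \<sigma> e q"
        unfolding \<mu>_def \<sigma>(2)[OF mod_homD(1)[OF \<tau> x] te[OF x]] \<sigma>(3)[OF tc[OF x] e] by simp
      also have "\<dots> = \<zero>"
        using \<sigma>\<tau>c[OF x, of q] u freemod_coord[OF \<sigma>(1)[OF e], of q]
        by (simp add: t_def l_minus m_assoc r_neg)
      finally show ?thesis .
    qed
    note \<sigma>\<mu> = mod_homD[OF mod_hom_comp[OF \<mu> Suc.prems(1)]]
    have "mod_hom R (freemod R p') (freemod R q) (\<lambda>x. \<sigma> (\<mu> x))"
    proof (rule mod_homI)
      fix x assume x: "x \<in> carrier (freemod R p')"
      show "\<sigma> (\<mu> x) \<in> carrier (freemod R q)"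
        by (rule freemod_Suc_zero[OF \<sigma>\<mu>(1)[OF x] q0[OF x]])
      fix y assume y: "y \<in> carrier (freemod R p')"
      show "\<sigma> (\<mu> (x \<oplus>\<^bsub>freemod R p'\<^esub> y)) = \<sigma> (\<mu> x) \<oplus>\<^bsub>freemod R q\<^esub> \<sigma> (\<mu> y)"
        using \<sigma>\<mu>(2)[OF x y] by simp
    next
      fix r x assume r: "r \<in> carrier R" and x: "x \<in> carrier (freemod R p')"
      show "\<sigma> (\<mu> (r \<odot>\<^bsub>freemod R p'\<^esub> x)) = r \<odot>\<^bsub>freemod R q\<^esub> \<sigma> (\<mu> x)"
        using \<sigma>\<mu>(3)[OF r x] by simp
    qed
    moreover have "q < p'" using Suc.prems(2) p' by simp
    ultimately obtain x l where x: "x \<in> carrier (freemod R p')"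
      "x l \<in> Units R" "\<And>j. \<sigma> (\<mu> x) j \<in> nonunits R" using Suc.IH by blast
    \<comment> \<open>The correction affects only entry i, so the unit entry of x survives, moved
      past the pivot.\<close>
    have "\<mu> x (if l < i then l else Suc l) = x l"
      using freemod_coord[OF x(1)] tc[OF x(1)] by (simp add: \<mu>_def \<tau>_def e_def unitvec_def)
    then show ?thesis using x mod_homD(1)[OF \<mu> x(1)] by metis
  qed
qed

section \<open>Minimal presentations and first syzygies\<close>

context noeth_local
begin

text \<open>Converse of \<open>mingens_relation_nonunits\<close>. If q < p generators sufficed, the
  comparison map R^p -> R^q would send some x with a unit entry to a vector of nonunits. Mapped back
  to R^p this still has nonunit entries and differs from x by a relation, so all entries of x would
  be nonunits.\<close>

lemma mingens_eq:
  assumes M: "module R M" and g: "generates R M p g"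
    and min: "\<And>v i. v \<in> carrier (relmod R M p g) \<Longrightarrow> v i \<in> nonunits R"
  shows "mingens R M = p"
proof (rule ccontr)
  interpret M: module R M by fact
  interpret F: module R "freemod R p" by (rule freemod_module)
  assume "mingens R M \<noteq> p"
  define q where "q = mingens R M"
  have qp: "q < p" using mingens_le[OF g] \<open>mingens R M \<noteq> p\<close> by (simp add: q_def)
  have "fin_gen R M" using g unfolding fin_gen_def by blast
  then obtain h where h: "generates R M q h" using mingens_generates unfolding q_def by blast
  note g' = generatesD[OF g M] and h' = generatesD[OF h M]
  obtain \<sigma> where \<sigma>: "mod_hom R (freemod R p) (freemod R q) \<sigma>"
    "\<And>v. v \<in> carrier (freemod R p) \<Longrightarrow> lincomb M q (\<sigma> v) h = lincomb M p v g"
    by (rule lift_hom[OF M M mod_hom_id _ h]) (erule g'(1), rule that)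
  obtain \<rho> where \<rho>: "mod_hom R (freemod R q) (freemod R p) \<rho>"
    "\<And>v. v \<in> carrier (freemod R q) \<Longrightarrow> lincomb M p (\<rho> v) g = lincomb M q v h"
    by (rule lift_hom[OF M M mod_hom_id _ g]) (erule h'(1), rule that)
  obtain x i where x: "x \<in> carrier (freemod R p)" "x i \<in> Units R" "\<And>j. \<sigma> x j \<in> nonunits R"
    using hom_dependent[OF \<sigma>(1) qp] by blast
  have \<sigma>x: "\<sigma> x \<in> carrier (freemod R q)" by (rule mod_homD(1)[OF \<sigma>(1) x(1)])
  let ?y = "\<rho> (\<sigma> x)"
  have y: "?y \<in> carrier (freemod R p)" by (rule mod_homD(1)[OF \<rho>(1) \<sigma>x])
  have yn: "?y i \<in> nonunits R" by (rule hom_nonunits[OF \<rho>(1) \<sigma>x x(3)])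
  have pM: "mod_hom R (freemod R p) M (\<lambda>v. lincomb M p v g)"
    by (rule lincomb_mod_hom[OF M g'(1)])
  let ?z = "x \<ominus>\<^bsub>freemod R p\<^esub> ?y"
  have z: "?z \<in> carrier (freemod R p)" by (rule F.minus_closed[OF x(1) y])
  have "lincomb M p ?z g = lincomb M p x g \<ominus>\<^bsub>M\<^esub> lincomb M p ?y g"
    by (rule mod_hom_minus[OF pM freemod_module M x(1) y])
  also have "\<dots> = \<zero>\<^bsub>M\<^esub>" using \<rho>(2)[OF \<sigma>x] \<sigma>(2)[OF x(1)] mod_homD(1)[OF pM x(1)]
    by (simp add: a_minus_def M.r_neg)
  finally have "?z \<in> carrier (relmod R M p g)" using z by simp
  then have "?z i \<in> nonunits R" by (rule min)
  then have "?z i \<oplus> ?y i \<in> nonunits R" using yn by (rule nonunits_add)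
  moreover have "?z \<oplus>\<^bsub>freemod R p\<^esub> ?y = x"
    using x(1) y by (simp del: freemod_simps add: a_minus_def F.a_assoc F.l_neg)
  then have "?z i \<oplus> ?y i = x i" by (metis freemod_simps(3))
  ultimately show False using x(2) by (simp add: nonunits_def)
qed

text \<open>Hides the choice operator inside \<open>syz1\<close>: later arguments know of the chosen
  family only that it generates minimally.\<close>

lemma minimal_presentation:
  assumes "module R M" "fin_gen R M"
  obtains g where "generates R M (mingens R M) g"
    "syz1 R M = relmod R M (mingens R M) g"
    "\<And>v i. v \<in> carrier (syz1 R M) \<Longrightarrow> v i \<in> nonunits R"
proof -
  define g where "g = (SOME g. generates R M (mingens R M) g)"
  have g: "generates R M (mingens R M) g"
    unfolding g_def by (rule someI_ex[OF mingens_generates[OF assms(2)]])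
  have eq: "syz1 R M = relmod R M (mingens R M) g" by (simp add: syz1_eq_relmod g_def)
  show thesis
  proof (rule that[OF g eq])
    show "v i \<in> nonunits R" if "v \<in> carrier (syz1 R M)" for v i
      using mingens_relation_nonunits[OF assms(1) g] that unfolding eq by blast
  qed
qed

lemma generates_relmod:
  assumes "module R M" "generates R M p g"
  shows "module R (relmod R M p g)" and "fin_gen R (relmod R M p g)"
  using relmod_module[OF assms(1)] relmod_fin_gen[OF noeth assms(1)]
    generatesD(1)[OF assms(2,1)] by blast+

lemma syz1_module:
  assumes "module R M" "fin_gen R M"
  shows "module R (syz1 R M)"
proof -
  obtain g where g: "generates R M (mingens R M) g" "syz1 R M = relmod R M (mingens R M) g"
    using minimal_presentation[OF assms] by blast
  show ?thesis unfolding g(2) by (rule generates_relmod(1)[OF assms(1) g(1)])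
qed

lemma syz1_fin_gen:
  assumes "module R M" "fin_gen R M"
  shows "fin_gen R (syz1 R M)"
proof -
  obtain g where g: "generates R M (mingens R M) g" "syz1 R M = relmod R M (mingens R M) g"
    using minimal_presentation[OF assms] by blast
  show ?thesis unfolding g(2) by (rule generates_relmod(2)[OF assms(1) g(1)])
qed

end

subsection \<open>Betti numbers of retracts and extensions\<close>

lemma retr_refl: "retr R X X"
  unfolding retr_def using mod_hom_id by blast

lemma retrI:
  assumes "mod_hom R X Y s" "mod_hom R Y X r" "\<And>x. x \<in> carrier X \<Longrightarrow> r (s x) = x"
  shows "retr R X Y"
  using assms unfolding retr_def by blast

lemma retr_trans:
  assumes "retr R X Y" "retr R Y Z"
  shows "retr R X Z"
proof -
  obtain s r where s: "mod_hom R X Y s" "mod_hom R Y X r" "\<And>x. x \<in> carrier X \<Longrightarrow> r (s x) = x"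
    using assms(1) unfolding retr_def by blast
  obtain s' r' where s': "mod_hom R Y Z s'" "mod_hom R Z Y r'" "\<And>x. x \<in> carrier Y \<Longrightarrow> r' (s' x) = x"
    using assms(2) unfolding retr_def by blast
  show ?thesis
    by (rule retrI[OF mod_hom_comp[OF s(1) s'(1)] mod_hom_comp[OF s'(2) s(2)]])
      (simp add: s(3) s'(3) mod_homD(1)[OF s(1)])
qed

lemma retr_generates:
  assumes "retr R X Y" "module R X" "module R Y" "generates R Y p g"
  shows "\<exists>h. generates R X p h"
proof -
  obtain s r where s: "mod_hom R X Y s" "mod_hom R Y X r" "\<And>x. x \<in> carrier X \<Longrightarrow> r (s x) = x"
    using assms(1) unfolding retr_def by blast
  interpret X: module R X by fact
  have "r ` carrier Y = carrier X"
  proof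
    show "r ` carrier Y \<subseteq> carrier X" using mod_homD(1)[OF s(2)] by blast
    show "carrier X \<subseteq> r ` carrier Y"
    proof
      fix x assume "x \<in> carrier X"
      then show "x \<in> r ` carrier Y" using s(3)[of x] mod_homD(1)[OF s(1), of x] by (metis imageI)
    qed
  qed
  from X.generates_surj[OF assms(4,3,2) s(2) this] show ?thesis by blast
qed

lemma retr_fin_gen:
  assumes "retr R X Y" "module R X" "module R Y" "fin_gen R Y"
  shows "fin_gen R X"
  using retr_generates[OF assms(1-3)] assms(4) unfolding fin_gen_def by blast

lemma betti_0: "betti R M 0 = mingens R M"
  by (simp add: betti_def)

text \<open>Dimension shift. The definition applies further \<open>syz1\<close> on the outside,
  whereas the inductions on i replace the module by its first syzygy.\<close>

lemma betti_Suc: "betti R M (Suc i) = betti R (syz1 R M) i"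
  by (cases i) (simp_all add: betti_def syz_suc_def funpow_swap1)

context noeth_local
begin

lemma mingens_retr:
  assumes "retr R X Y" "module R X" "module R Y" "fin_gen R Y"
  shows "mingens R X \<le> mingens R Y"
  using retr_generates[OF assms(1-3)] mingens_generates[OF assms(4)] mingens_le by metis

text \<open>With X = Y and \<open>retr_refl\<close> it makes the minimal syzygy a retract of the
  kernel of any finite free cover.\<close>

lemma retr_syz1_relmod:
  assumes "retr R X Y" "module R X" "module R Y" "fin_gen R X" "generates R Y q h"
  shows "retr R (syz1 R X) (relmod R Y q h)"
proof -
  obtain g where g: "generates R X (mingens R X) g" "syz1 R X = relmod R X (mingens R X) g"
    "\<And>v i. v \<in> carrier (syz1 R X) \<Longrightarrow> v i \<in> nonunits R"
    using minimal_presentation[OF assms(2,4)] by blast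
  show ?thesis unfolding g(2)
    by (rule retr_relmod[OF assms(2,3,1) g(1) assms(5)]) (use g(2,3) in simp)
qed

lemma retr_syz1:
  assumes "retr R X Y" "module R X" "module R Y" "fin_gen R Y"
  shows "retr R (syz1 R X) (syz1 R Y)"
proof -
  obtain h where h: "generates R Y (mingens R Y) h" "syz1 R Y = relmod R Y (mingens R Y) h"
    using minimal_presentation[OF assms(3,4)] by blast
  show ?thesis unfolding h(2)
    by (rule retr_syz1_relmod[OF assms(1-3) retr_fin_gen[OF assms] h(1)])
qed

text \<open>A syzygy consists of vectors over R, whatever the element type of the module, and an
  induction hypothesis cannot change types. So the induction is run for modules of vectors, and one
  further step in \<open>betti_retr\<close> reaches arbitrary modules. The same pairing recurs for
  subadditivity and for products.\<close>

lemma betti_retr_vec: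
  fixes X Y :: "('a, nat \<Rightarrow> 'a) module"
  assumes "retr R X Y" "module R X" "module R Y" "fin_gen R Y"
  shows "betti R X i \<le> betti R Y i"
  using assms
proof (induction i arbitrary: X Y)
  case 0
  then show ?case by (simp add: betti_0 mingens_retr)
next
  case (Suc i)
  note p = Suc.prems
  have "fin_gen R X" by (rule retr_fin_gen[OF p])
  then show ?case unfolding betti_Suc
    by (intro Suc.IH retr_syz1 syz1_module syz1_fin_gen p)
qed

lemma betti_retr:
  assumes "retr R X Y" "module R X" "module R Y" "fin_gen R Y"
  shows "betti R X i \<le> betti R Y i"
proof (cases i)
  case 0
  then show ?thesis using assms by (simp add: betti_0 mingens_retr)
next
  case (Suc j)
  have "fin_gen R X" by (rule retr_fin_gen[OF assms])
  then show ?thesis unfolding Suc betti_Suc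
    by (intro betti_retr_vec retr_syz1 syz1_module syz1_fin_gen assms)
qed

text \<open>B is covered through the generators of A and lifts of those of C. This cover is in
  general not minimal, hence \<open>relmod\<close> in the middle. Since R^p is literally contained
  in R^(p+q), the maps of syzygies are the inclusion and the deletion of the first p
  coordinates.\<close>

lemma horseshoe:
  assumes se: "short_exact R A B C f g" and mods: "module R A" "module R B" "module R C"
    and fg: "fin_gen R A" "fin_gen R C"
  obtains \<beta> f' g' where "generates R B (mingens R A + mingens R C) \<beta>"
    "short_exact R (syz1 R A) (relmod R B (mingens R A + mingens R C) \<beta>) (syz1 R C) f' g'"
proof -
  interpret A: module R A by fact
  interpret B: module R B by fact
  interpret C: module R C by fact
  have f: "mod_hom R A B f" and g: "mod_hom R B C g" and inj: "inj_on f (carrier A)"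
    and surj: "g ` carrier B = carrier C"
    and im: "f ` carrier A = {y \<in> carrier B. g y = \<zero>\<^bsub>C\<^esub>}"
    using se by (auto simp: short_exact_def)
  define p q where "p = mingens R A" and "q = mingens R C"
  obtain \<alpha> where \<alpha>: "generates R A p \<alpha>" "syz1 R A = relmod R A p \<alpha>"
    by (rule minimal_presentation[OF mods(1) fg(1), folded p_def]) (rule that)
  obtain \<gamma>' where \<gamma>': "generates R C q \<gamma>'" "syz1 R C = relmod R C q \<gamma>'"
    by (rule minimal_presentation[OF mods(3) fg(2), folded q_def]) (rule that)
  note \<alpha>c = generatesD[OF \<alpha>(1) mods(1)] and \<gamma>'c = generatesD(1)[OF \<gamma>'(1) mods(3)]
  have "\<forall>j<q. \<exists>b\<in>carrier B. g b = \<gamma>' j" using \<gamma>'c surj by (metis imageE)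
  then obtain \<gamma> where \<gamma>: "\<And>j. j < q \<Longrightarrow> \<gamma> j \<in> carrier B" "\<And>j. j < q \<Longrightarrow> g (\<gamma> j) = \<gamma>' j" by metis
  have lcC: "lincomb C q w (\<lambda>j. g (\<gamma> j)) = lincomb C q w \<gamma>'" if "\<And>j. j < q \<Longrightarrow> w j \<in> carrier R" for w
    by (rule lincomb_cong[OF mods(3)]) (use \<gamma> \<gamma>'c that in auto)
  have gen: "generates R C q (\<lambda>j. g (\<gamma> j))"
  proof (rule generatesI[OF mods(3)])
    show "g (\<gamma> i) \<in> carrier C" if "i < q" for i using \<gamma>(2) \<gamma>'c that by simp
    fix x assume "x \<in> carrier C"
    then obtain v where "v \<in> carrier (freemod R q)" "x = lincomb C q v \<gamma>'"
      using generatesD(2)[OF \<gamma>'(1) mods(3)] by blast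
    then show "\<exists>v. (\<forall>i<q. v i \<in> carrier R) \<and> x = lincomb C q v (\<lambda>j. g (\<gamma> j))"
      using lcC by auto
  qed
  let ?\<beta> = "append_fam p (\<lambda>i. f (\<alpha> i)) \<gamma>"
  have \<beta>: "generates R B (p + q) ?\<beta>" by (rule ext_generates[OF se mods \<alpha>(1) gen \<gamma>(1)])
  have fa: "f (\<alpha> i) \<in> carrier B" if "i < p" for i by (rule mod_homD(1)[OF f \<alpha>c(1)[OF that]])
  let ?Z = "relmod R B (p + q) ?\<beta>"
  have lcf: "lincomb B p v (\<lambda>i. f (\<alpha> i)) = f (lincomb A p v \<alpha>)" if "\<And>i. i < p \<Longrightarrow> v i \<in> carrier R" for v
    by (rule lincomb_hom[OF mods(1,2) f that \<alpha>c(1), symmetric])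
  \<comment> \<open>The cover of B split into its two blocks; exactness at each place is read off
    from this formula.\<close>
  have lcB: "lincomb B (p + q) v ?\<beta> = f (lincomb A p v \<alpha>) \<oplus>\<^bsub>B\<^esub> lincomb B q (\<lambda>j. v (p + j)) \<gamma>"
    if "v \<in> carrier (freemod R (p + q))" for v
  proof -
    have "lincomb B (p + q) v ?\<beta> = lincomb B p v (\<lambda>i. f (\<alpha> i)) \<oplus>\<^bsub>B\<^esub> lincomb B q (\<lambda>j. v (p + j)) \<gamma>"
      by (rule lincomb_append[OF mods(2) _ fa \<gamma>(1)]) (use that in auto)
    then show ?thesis using lcf[of v] that by simp
  qed
  have lcAc: "lincomb A p v \<alpha> \<in> carrier A" if "\<And>i. i < p \<Longrightarrow> v i \<in> carrier R" for v
    by (rule lincomb_closed[OF mods(1) that \<alpha>c(1)])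
  have lcBc: "lincomb B q w \<gamma> \<in> carrier B" if "\<And>i. i < q \<Longrightarrow> w i \<in> carrier R" for w
    by (rule lincomb_closed[OF mods(2) that \<gamma>(1)])
  have glc: "g (lincomb B q w \<gamma>) = lincomb C q w \<gamma>'" if "\<And>j. j < q \<Longrightarrow> w j \<in> carrier R" for w
    using lincomb_hom[OF mods(2,3) g that \<gamma>(1)] lcC[OF that] by simp
  have gf: "g (f a) = \<zero>\<^bsub>C\<^esub>" "f a \<in> carrier B" if "a \<in> carrier A" for a using im that by auto
  have f0: "f a = \<zero>\<^bsub>B\<^esub> \<longleftrightarrow> a = \<zero>\<^bsub>A\<^esub>" if "a \<in> carrier A" for a
    using inj_onD[OF inj, of a "\<zero>\<^bsub>A\<^esub>"] mod_hom_zero[OF f mods(1,2)] that by auto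
  let ?d = "\<lambda>v j. v (p + j)"
  have "mod_hom R (freemod R q) B (\<lambda>w. lincomb B q w \<gamma>)"
    by (rule lincomb_mod_hom[OF mods(2) \<gamma>(1)])
  from mod_hom_zero[OF this freemod_module mods(2)] have lc0: "lincomb B q (\<lambda>j. \<zero>) \<gamma> = \<zero>\<^bsub>B\<^esub>"
    by simp
  have incl: "mod_hom R (relmod R A p \<alpha>) ?Z (\<lambda>v. v)"
  proof (rule mod_homI)
    fix v assume v: "v \<in> carrier (relmod R A p \<alpha>)"
    then have "v \<in> carrier (freemod R p)" by simp
    then have vF: "v \<in> carrier (freemod R (p + q))" by (rule freemod_mono) simp
    have "lincomb B q (?d v) \<gamma> = lincomb B q (\<lambda>j. \<zero>) \<gamma>"
      by (rule lincomb_cong[OF mods(2)]) (use v \<gamma> in auto)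
    also have "\<dots> = \<zero>\<^bsub>B\<^esub>" by (rule lc0)
    finally show "v \<in> carrier ?Z" using v vF lcB[OF vF] mod_hom_zero[OF f mods(1,2)] by simp
  qed auto
  have drop: "mod_hom R ?Z (relmod R C q \<gamma>') ?d"
  proof (rule mod_homI)
    fix v assume v: "v \<in> carrier ?Z"
    then have vF: "v \<in> carrier (freemod R (p + q))" by simp
    have va: "lincomb A p v \<alpha> \<in> carrier A" by (rule lcAc) (use vF in auto)
    have "g (lincomb B (p + q) v ?\<beta>) = g (f (lincomb A p v \<alpha>)) \<oplus>\<^bsub>C\<^esub> g (lincomb B q (?d v) \<gamma>)"
      unfolding lcB[OF vF]
      by (rule mod_homD(2)[OF g gf(2)[OF va] lcBc]) (use vF in auto)
    also have "\<dots> = lincomb C q (?d v) \<gamma>'"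
      using gf(1)[OF va] glc[of "?d v"] lincomb_closed[OF mods(3) _ \<gamma>'c, of q "?d v"] vF by simp
    finally have "lincomb C q (?d v) \<gamma>' = \<zero>\<^bsub>C\<^esub>" using v mod_hom_zero[OF g mods(2,3)] by simp
    then show "?d v \<in> carrier (relmod R C q \<gamma>')" using vF by simp
  qed auto
  have "?d ` carrier ?Z = carrier (relmod R C q \<gamma>')"
  proof
    show "?d ` carrier ?Z \<subseteq> carrier (relmod R C q \<gamma>')" using mod_homD(1)[OF drop] by blast
    show "carrier (relmod R C q \<gamma>') \<subseteq> ?d ` carrier ?Z"
    proof
      fix w assume w: "w \<in> carrier (relmod R C q \<gamma>')"
      then have wF: "w \<in> carrier (freemod R q)" by simp
      let ?b = "lincomb B q w \<gamma>"
      have b: "?b \<in> carrier B" by (rule lcBc) (use wF in auto)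
      \<comment> \<open>A relation w of C gives an element of B that dies in C, so its negative
        comes from A; coefficients u of that preimage complete w to a relation of B.\<close>
      have "g (\<ominus>\<^bsub>B\<^esub> ?b) = \<zero>\<^bsub>C\<^esub>"
        using mod_hom_uminus[OF g mods(2,3) b] glc[of w] w by simp
      then have "\<ominus>\<^bsub>B\<^esub> ?b \<in> f ` carrier A" using im b by simp
      then obtain a where a: "a \<in> carrier A" "\<ominus>\<^bsub>B\<^esub> ?b = f a" by blast
      obtain u where u: "u \<in> carrier (freemod R p)" "a = lincomb A p u \<alpha>" using \<alpha>c(2)[OF a(1)] by blast
      let ?v = "append_fam p u w"
      have v: "?v \<in> carrier (freemod R (p + q))" using u(1) wF by (auto simp: append_fam_def)
      have d: "?d ?v = w" by (auto simp: append_fam_def)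
      have "lincomb A p ?v \<alpha> = a" unfolding u(2)
        by (rule lincomb_cong[OF mods(1)]) (use u(1) \<alpha>c in \<open>auto simp: append_fam_def\<close>)
      then have "lincomb B (p + q) ?v ?\<beta> = \<zero>\<^bsub>B\<^esub>"
        using lcB[OF v] b by (simp add: d a(2)[symmetric] B.l_neg)
      then have vZ: "?v \<in> carrier ?Z" using v by simp
      show "w \<in> ?d ` carrier ?Z" by (rule image_eqI[OF _ vZ]) (simp only: d)
    qed
  qed
  moreover have "(\<lambda>v. v) ` carrier (relmod R A p \<alpha>) = {v \<in> carrier ?Z. ?d v = \<zero>\<^bsub>relmod R C q \<gamma>'\<^esub>}"
  proof (intro equalityI subsetI)
    fix v assume "v \<in> (\<lambda>v. v) ` carrier (relmod R A p \<alpha>)"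
    then show "v \<in> {v \<in> carrier ?Z. ?d v = \<zero>\<^bsub>relmod R C q \<gamma>'\<^esub>}"
      using mod_homD(1)[OF incl, of v] by auto
  next
    fix v assume v: "v \<in> {v \<in> carrier ?Z. ?d v = \<zero>\<^bsub>relmod R C q \<gamma>'\<^esub>}"
    then have vF: "v \<in> carrier (freemod R (p + q))" and vd: "?d v = (\<lambda>j. \<zero>)"
      and v0: "lincomb B (p + q) v ?\<beta> = \<zero>\<^bsub>B\<^esub>" by auto
    have "v i = \<zero>" if "i \<ge> p" for i using fun_cong[OF vd, of "i - p"] that by simp
    then have vp: "v \<in> carrier (freemod R p)" using vF by auto
    have va: "lincomb A p v \<alpha> \<in> carrier A" by (rule lcAc) (use vp in auto)
    have "f (lincomb A p v \<alpha>) = \<zero>\<^bsub>B\<^esub>" using v0 lcB[OF vF] gf(2)[OF va] by (simp add: vd lc0)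
    then have "lincomb A p v \<alpha> = \<zero>\<^bsub>A\<^esub>" using f0[OF va] by simp
    then show "v \<in> (\<lambda>v. v) ` carrier (relmod R A p \<alpha>)" using vp by simp
  qed
  ultimately have "short_exact R (relmod R A p \<alpha>) ?Z (relmod R C q \<gamma>') (\<lambda>v. v) ?d"
    unfolding short_exact_def using incl drop by simp
  then show thesis using that \<beta> \<alpha>(2) \<gamma>'(2) unfolding p_def q_def by simp
qed

text \<open>The horseshoe returns an exact sequence of the same kind one step further on.
  \<open>syz1 R B\<close> is a retract of its middle term, so monotonicity closes the
  induction.\<close>

lemma betti_subadditive_vec:
  fixes A B C :: "('a, nat \<Rightarrow> 'a) module"
  assumes "short_exact R A B C f g" "module R A" "module R B" "module R C"
    and "fin_gen R A" "fin_gen R C"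
  shows "betti R B i \<le> betti R A i + betti R C i"
  using assms
proof (induction i arbitrary: A B C f g)
  case 0
  show ?case using horseshoe[OF 0] mingens_le unfolding betti_0 by metis
next
  case (Suc i)
  note p = Suc.prems
  obtain \<beta> f' g' where h: "generates R B (mingens R A + mingens R C) \<beta>"
    "short_exact R (syz1 R A) (relmod R B (mingens R A + mingens R C) \<beta>) (syz1 R C) f' g'"
    using horseshoe[OF p] by blast
  note Z = generates_relmod[OF p(3) h(1)]
  have B: "fin_gen R B" using h(1) unfolding fin_gen_def by blast
  have "betti R (syz1 R B) i \<le> betti R (relmod R B (mingens R A + mingens R C) \<beta>) i"
    by (rule betti_retr[OF retr_syz1_relmod[OF retr_refl p(3,3) B h(1)] syz1_module[OF p(3) B] Z])
  also have "\<dots> \<le> betti R (syz1 R A) i + betti R (syz1 R C) i"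
    by (rule Suc.IH[OF h(2)]) (intro syz1_module syz1_fin_gen Z p)+
  finally show ?case by (simp add: betti_Suc)
qed

lemma betti_subadditive:
  assumes p: "short_exact R A B C f g" "module R A" "module R B" "module R C"
    and "fin_gen R A" "fin_gen R C"
  shows "betti R B i \<le> betti R A i + betti R C i"
proof (cases i)
  case 0
  show ?thesis using horseshoe[OF assms] mingens_le unfolding 0 betti_0 by metis
next
  case (Suc j)
  obtain \<beta> f' g' where h: "generates R B (mingens R A + mingens R C) \<beta>"
    "short_exact R (syz1 R A) (relmod R B (mingens R A + mingens R C) \<beta>) (syz1 R C) f' g'"
    using horseshoe[OF assms] by blast
  note Z = generates_relmod[OF p(3) h(1)]
  have B: "fin_gen R B" using h(1) unfolding fin_gen_def by blast
  have "betti R (syz1 R B) j \<le> betti R (relmod R B (mingens R A + mingens R C) \<beta>) j"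
    by (rule betti_retr[OF retr_syz1_relmod[OF retr_refl p(3,3) B h(1)] syz1_module[OF p(3) B] Z])
  also have "\<dots> \<le> betti R (syz1 R A) j + betti R (syz1 R C) j"
    by (rule betti_subadditive_vec[OF h(2)]) (intro syz1_module syz1_fin_gen Z assms)+
  finally show ?thesis by (simp add: betti_Suc Suc)
qed

end

section \<open>Pointwise operations on homomorphisms, binary products and finite direct sums\<close>

lemma mod_hom_uminus_fun:
  assumes "mod_hom R M N f" "module R N"
  shows "mod_hom R M N (\<lambda>x. \<ominus>\<^bsub>N\<^esub> f x)"
proof -
  interpret N: module R N by fact
  show ?thesis
    by (rule mod_homI) (simp_all add: mod_homD[OF assms(1)] N.minus_add N.smult_r_minus)
qed

lemma mod_hom_add_fun:
  assumes "mod_hom R M N f" "mod_hom R M N h" "module R N"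
  shows "mod_hom R M N (\<lambda>x. f x \<oplus>\<^bsub>N\<^esub> h x)"
proof -
  interpret N: module R N by fact
  show ?thesis
    by (rule mod_homI)
      (simp_all add: mod_homD[OF assms(1)] mod_homD[OF assms(2)] N.a_ac N.smult_r_distr)
qed

text \<open>A binary product, so that \<open>dsum\<close> can be treated by induction on the number
  of summands and a free summand can be added to A. The fields \<open>mult\<close> and
  \<open>one\<close> only fill the ring part of the module record.\<close>

definition prodmod :: "('a, 'm) module \<Rightarrow> ('a, 'n) module \<Rightarrow> ('a, 'm \<times> 'n) module" where
  "prodmod X Y = \<lparr>carrier = carrier X \<times> carrier Y,
     mult = (\<lambda>_ _. (\<zero>\<^bsub>X\<^esub>, \<zero>\<^bsub>Y\<^esub>)), one = (\<zero>\<^bsub>X\<^esub>, \<zero>\<^bsub>Y\<^esub>), zero = (\<zero>\<^bsub>X\<^esub>, \<zero>\<^bsub>Y\<^esub>),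
     add = (\<lambda>x y. (fst x \<oplus>\<^bsub>X\<^esub> fst y, snd x \<oplus>\<^bsub>Y\<^esub> snd y)),
     smult = (\<lambda>r x. (r \<odot>\<^bsub>X\<^esub> fst x, r \<odot>\<^bsub>Y\<^esub> snd x))\<rparr>"

lemma prodmod_simps [simp]:
  "carrier (prodmod X Y) = carrier X \<times> carrier Y"
  "\<zero>\<^bsub>prodmod X Y\<^esub> = (\<zero>\<^bsub>X\<^esub>, \<zero>\<^bsub>Y\<^esub>)"
  "x \<oplus>\<^bsub>prodmod X Y\<^esub> y = (fst x \<oplus>\<^bsub>X\<^esub> fst y, snd x \<oplus>\<^bsub>Y\<^esub> snd y)"
  "r \<odot>\<^bsub>prodmod X Y\<^esub> x = (r \<odot>\<^bsub>X\<^esub> fst x, r \<odot>\<^bsub>Y\<^esub> snd x)"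
  by (simp_all add: prodmod_def)

lemma prodmod_module:
  assumes "module R X" "module R Y"
  shows "module R (prodmod X Y)"
proof -
  interpret X: module R X by fact
  interpret Y: module R Y by fact
  show ?thesis
  proof (rule moduleI)
    show "abelian_group (prodmod X Y)"
    proof (rule abelian_groupI)
      fix x assume "x \<in> carrier (prodmod X Y)"
      then show "\<exists>y\<in>carrier (prodmod X Y). y \<oplus>\<^bsub>prodmod X Y\<^esub> x = \<zero>\<^bsub>prodmod X Y\<^esub>"
        by (intro bexI[of _ "(\<ominus>\<^bsub>X\<^esub> fst x, \<ominus>\<^bsub>Y\<^esub> snd x)"]) (auto simp: X.l_neg Y.l_neg)
    qed (auto simp: X.a_ac Y.a_ac)
  qed (auto simp: X.is_cring X.smult_l_distr Y.smult_l_distr X.smult_r_distr Y.smult_r_distr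
      X.smult_assoc1 Y.smult_assoc1)
qed

lemma mod_hom_fst: "mod_hom R (prodmod X Y) X fst"
  and mod_hom_snd: "mod_hom R (prodmod X Y) Y snd"
  by (auto intro!: mod_homI)

lemma mod_hom_Pair:
  "mod_hom R M X f \<Longrightarrow> mod_hom R M Y h \<Longrightarrow> mod_hom R M (prodmod X Y) (\<lambda>x. (f x, h x))"
  by (auto simp: mod_hom_def)

lemma mod_hom_zero_fun:
  assumes "module R Y"
  shows "mod_hom R X Y (\<lambda>x. \<zero>\<^bsub>Y\<^esub>)"
proof -
  interpret Y: module R Y by fact
  show ?thesis by (rule mod_homI) auto
qed

lemma prodmod_short_exact:
  assumes "module R X" "module R Y"
  shows "short_exact R X (prodmod X Y) Y (\<lambda>x. (x, \<zero>\<^bsub>Y\<^esub>)) snd"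
proof -
  interpret X: module R X by fact
  interpret Y: module R Y by fact
  show ?thesis unfolding short_exact_def
  proof (intro conjI)
    show "mod_hom R X (prodmod X Y) (\<lambda>x. (x, \<zero>\<^bsub>Y\<^esub>))"
      by (intro mod_hom_Pair mod_hom_id mod_hom_zero_fun assms)
    show "snd ` carrier (prodmod X Y) = carrier Y"
      using X.M.zero_closed by (auto simp: image_iff)
  qed (auto intro: mod_hom_snd inj_onI)
qed

lemma dsum_module:
  assumes "module R X"
  shows "module R (dsum R a X)"
proof -
  interpret X: module R X by fact
  have c: "v i \<in> carrier X" if "v \<in> carrier (dsum R a X)" for v i
    using that by (cases "i < a") auto
  show ?thesis
  proof (rule moduleI)
    show "abelian_group (dsum R a X)"
    proof (rule abelian_groupI)
      fix x assume x: "x \<in> carrier (dsum R a X)"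
      then show "\<exists>y\<in>carrier (dsum R a X). y \<oplus>\<^bsub>dsum R a X\<^esub> x = \<zero>\<^bsub>dsum R a X\<^esub>"
        using c[OF x] by (intro bexI[of _ "\<lambda>i. \<ominus>\<^bsub>X\<^esub> x i"]) (auto simp: X.l_neg)
      show "\<zero>\<^bsub>dsum R a X\<^esub> \<oplus>\<^bsub>dsum R a X\<^esub> x = x"
        using c[OF x] by (simp add: fun_eq_iff)
      fix y assume y: "y \<in> carrier (dsum R a X)"
      show "x \<oplus>\<^bsub>dsum R a X\<^esub> y \<in> carrier (dsum R a X)" using x y by simp
      show "x \<oplus>\<^bsub>dsum R a X\<^esub> y = y \<oplus>\<^bsub>dsum R a X\<^esub> x" using c[OF x] c[OF y] by (simp add: X.a_comm)
      fix z assume z: "z \<in> carrier (dsum R a X)"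
      show "x \<oplus>\<^bsub>dsum R a X\<^esub> y \<oplus>\<^bsub>dsum R a X\<^esub> z = x \<oplus>\<^bsub>dsum R a X\<^esub> (y \<oplus>\<^bsub>dsum R a X\<^esub> z)"
        using c[OF x] c[OF y] c[OF z] by (simp add: X.a_assoc)
    qed simp
  next
    fix r s x assume r: "r \<in> carrier R" "s \<in> carrier R" and x: "x \<in> carrier (dsum R a X)"
    show "(r \<oplus>\<^bsub>R\<^esub> s) \<odot>\<^bsub>dsum R a X\<^esub> x = r \<odot>\<^bsub>dsum R a X\<^esub> x \<oplus>\<^bsub>dsum R a X\<^esub> s \<odot>\<^bsub>dsum R a X\<^esub> x"
      using r c[OF x] by (simp add: X.smult_l_distr)
    show "(r \<otimes>\<^bsub>R\<^esub> s) \<odot>\<^bsub>dsum R a X\<^esub> x = r \<odot>\<^bsub>dsum R a X\<^esub> (s \<odot>\<^bsub>dsum R a X\<^esub> x)"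
      using r c[OF x] by (simp add: X.smult_assoc1)
  next
    fix r x y assume r: "r \<in> carrier R" and x: "x \<in> carrier (dsum R a X)" and y: "y \<in> carrier (dsum R a X)"
    show "r \<odot>\<^bsub>dsum R a X\<^esub> (x \<oplus>\<^bsub>dsum R a X\<^esub> y) = r \<odot>\<^bsub>dsum R a X\<^esub> x \<oplus>\<^bsub>dsum R a X\<^esub> r \<odot>\<^bsub>dsum R a X\<^esub> y"
      using r c[OF x] c[OF y] by (simp add: X.smult_r_distr)
  next
    fix x assume x: "x \<in> carrier (dsum R a X)"
    show "\<one>\<^bsub>R\<^esub> \<odot>\<^bsub>dsum R a X\<^esub> x = x" using c[OF x] by simp
  qed (simp_all add: X.is_cring)
qed

text \<open>Entry a is split off and its slot refilled with zero. The two maps are inverse to each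
  other, recorded as two retractions for \<open>betti_retr_eq\<close>.\<close>

lemma dsum_Suc_retr:
  assumes "module R X"
  shows "retr R (dsum R (Suc a) X) (prodmod (dsum R a X) X)"
    and "retr R (prodmod (dsum R a X) X) (dsum R (Suc a) X)"
proof -
  interpret X: module R X by fact
  have s: "mod_hom R (dsum R (Suc a) X) (prodmod (dsum R a X) X) (\<lambda>v. (v(a := \<zero>\<^bsub>X\<^esub>), v a))"
    by (rule mod_homI) (auto simp: fun_eq_iff le_less_Suc_eq)
  have r: "mod_hom R (prodmod (dsum R a X) X) (dsum R (Suc a) X) (\<lambda>z. (fst z)(a := snd z))"
    by (rule mod_homI) (auto simp: fun_eq_iff less_Suc_eq)
  show "retr R (dsum R (Suc a) X) (prodmod (dsum R a X) X)"
    by (rule retrI[OF s r]) simp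
  show "retr R (prodmod (dsum R a X) X) (dsum R (Suc a) X)"
    by (rule retrI[OF r s]) (auto simp: fun_eq_iff)
qed

lemma dsum_1_retr:
  assumes "module R X"
  shows "retr R (dsum R (Suc 0) X) X" and "retr R X (dsum R (Suc 0) X)"
proof -
  interpret X: module R X by fact
  have s: "mod_hom R (dsum R (Suc 0) X) X (\<lambda>v. v 0)" by (rule mod_homI) auto
  have r: "mod_hom R X (dsum R (Suc 0) X) (\<lambda>x i. if i = 0 then x else \<zero>\<^bsub>X\<^esub>)"
    by (rule mod_homI) (auto simp: fun_eq_iff)
  show "retr R (dsum R (Suc 0) X) X"
    by (rule retrI[OF s r]) (auto simp: fun_eq_iff Suc_le_eq)
  show "retr R X (dsum R (Suc 0) X)" by (rule retrI[OF r s]) simp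
qed

lemma mod_iso_retr:
  assumes "mod_iso R X Y" "module R X"
  shows "retr R X Y" and "retr R Y X"
proof -
  interpret X: module R X by fact
  obtain f where f: "mod_hom R X Y f" "bij_betw f (carrier X) (carrier Y)"
    using assms(1) unfolding mod_iso_def by blast
  have inj: "inj_on f (carrier X)" and im: "f ` carrier X = carrier Y"
    using f(2) by (auto simp: bij_betw_def)
  have h: "mod_hom R Y X (\<lambda>y. inv_into (carrier X) f y)"
    by (rule mod_hom_inv_into[OF f(1) inj assms(2) mod_hom_id]) (simp add: im)
  show "retr R X Y" by (rule retrI[OF f(1) h]) (simp add: inj)
  show "retr R Y X" by (rule retrI[OF h f(1)]) (simp add: f_inv_into_f im)
qed

subsection \<open>Rotated sequences and direct sums\<close>

context noeth_local
begin

lemma betti_retr_eq: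
  assumes "retr R X Y" "retr R Y X" "module R X" "module R Y" "fin_gen R X"
  shows "betti R X i = betti R Y i"
  using betti_retr[OF assms(1,3,4) retr_fin_gen[OF assms(2,4,3,5)]] betti_retr[OF assms(2,4,3,5)]
  by (rule antisym)

text \<open>Z is the kernel of the minimal cover of B followed by g. The cover of B sends Z into the
  kernel of g, which is the image of f, whence a map Z -> A with kernel \<open>syz1 R B\<close>. As
  a cover of C this one need not be minimal, so \<open>syz1 R C\<close> enters as a retract of
  Z.\<close>

lemma betti_rotate_left:
  assumes se: "short_exact R A B C f g" and mods: "module R A" "module R B" "module R C"
    and fg: "fin_gen R A" "fin_gen R B"
  shows "betti R C (Suc i) \<le> betti R B (Suc i) + betti R A i"
proof -
  interpret A: module R A by fact
  interpret B: module R B by fact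
  interpret C: module R C by fact
  have f: "mod_hom R A B f" and g: "mod_hom R B C g" and inj: "inj_on f (carrier A)"
    and surj: "g ` carrier B = carrier C"
    and im: "f ` carrier A = {y \<in> carrier B. g y = \<zero>\<^bsub>C\<^esub>}"
    using se by (auto simp: short_exact_def)
  define p where "p = mingens R B"
  obtain \<beta> where \<beta>: "generates R B p \<beta>" "syz1 R B = relmod R B p \<beta>"
    by (rule minimal_presentation[OF mods(2) fg(2), folded p_def]) (rule that)
  note \<beta>c = generatesD[OF \<beta>(1) mods(2)]
  have h: "generates R C p (\<lambda>i. g (\<beta> i))"
    by (rule generates_surj[OF \<beta>(1) mods(2,3) g surj])
  have C: "fin_gen R C" using h unfolding fin_gen_def by blast
  let ?Z = "relmod R C p (\<lambda>i. g (\<beta> i))"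
  note Z = generates_relmod[OF mods(3) h]
  have lc: "lincomb C p v (\<lambda>i. g (\<beta> i)) = g (lincomb B p v \<beta>)" if "v \<in> carrier (freemod R p)" for v
    by (rule lincomb_hom[OF mods(2,3) g, symmetric]) (use that \<beta>c in auto)
  have lcB: "mod_hom R (freemod R p) B (\<lambda>v. lincomb B p v \<beta>)"
    by (rule lincomb_mod_hom[OF mods(2) \<beta>c(1)])
  have lcZ: "mod_hom R ?Z B (\<lambda>v. lincomb B p v \<beta>)"
    using mod_homD[OF lcB] by (intro mod_homI) (simp_all del: freemod_simps)
  have lcim: "lincomb B p v \<beta> \<in> f ` carrier A" if "v \<in> carrier ?Z" for v
    using that lc[of v] mod_homD(1)[OF lcZ that] unfolding im by simp
  let ?h = "\<lambda>v. inv_into (carrier A) f (lincomb B p v \<beta>)"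
  have hh: "mod_hom R ?Z A ?h" by (rule mod_hom_inv_into[OF f inj mods(1) lcZ lcim])
  have f0: "f \<zero>\<^bsub>A\<^esub> = \<zero>\<^bsub>B\<^esub>" by (rule mod_hom_zero[OF f mods(1,2)])
  have g0: "g \<zero>\<^bsub>B\<^esub> = \<zero>\<^bsub>C\<^esub>" by (rule mod_hom_zero[OF g mods(2,3)])
  have "short_exact R (syz1 R B) ?Z A (\<lambda>v. v) ?h"
    unfolding short_exact_def \<beta>(2)
  proof (intro conjI)
    show "mod_hom R (relmod R B p \<beta>) ?Z (\<lambda>v. v)"
    proof (rule mod_homI)
      fix v assume "v \<in> carrier (relmod R B p \<beta>)"
      then show "v \<in> carrier ?Z" using lc[of v] g0 by simp
    qed auto
    show "?h ` carrier ?Z = carrier A"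
    proof (intro equalityI subsetI)
      fix x assume "x \<in> ?h ` carrier ?Z"
      then show "x \<in> carrier A" using mod_homD(1)[OF hh] by blast
    next
      fix x assume x: "x \<in> carrier A"
      then have fx: "f x \<in> carrier B" "g (f x) = \<zero>\<^bsub>C\<^esub>" using im by auto
      obtain v where v: "v \<in> carrier (freemod R p)" "f x = lincomb B p v \<beta>" using \<beta>c(2)[OF fx(1)] by blast
      have vZ: "v \<in> carrier ?Z" using v lc[OF v(1)] fx(2) by simp
      have "?h v = x" using inj x by (simp add: v(2)[symmetric])
      then show "x \<in> ?h ` carrier ?Z" by (intro image_eqI[OF _ vZ]) simp
    qed
    show "(\<lambda>v. v) ` carrier (relmod R B p \<beta>) = {v \<in> carrier ?Z. ?h v = \<zero>\<^bsub>A\<^esub>}"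
    proof (intro equalityI subsetI)
      fix v assume "v \<in> (\<lambda>v. v) ` carrier (relmod R B p \<beta>)"
      then have v: "v \<in> carrier (freemod R p)" "lincomb B p v \<beta> = \<zero>\<^bsub>B\<^esub>" by auto
      have "?h v = \<zero>\<^bsub>A\<^esub>" using inv_into_f_f[OF inj A.M.zero_closed] by (simp add: v(2) f0)
      moreover have "v \<in> carrier ?Z" using v lc[OF v(1)] g0 by simp
      ultimately show "v \<in> {v \<in> carrier ?Z. ?h v = \<zero>\<^bsub>A\<^esub>}" by blast
    next
      fix v assume "v \<in> {v \<in> carrier ?Z. ?h v = \<zero>\<^bsub>A\<^esub>}"
      then have v: "v \<in> carrier ?Z" "?h v = \<zero>\<^bsub>A\<^esub>" by auto
      have "lincomb B p v \<beta> = f (?h v)" by (rule f_inv_into_f[OF lcim[OF v(1)], symmetric])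
      then have "lincomb B p v \<beta> = \<zero>\<^bsub>B\<^esub>" using v(2) f0 by simp
      then show "v \<in> (\<lambda>v. v) ` carrier (relmod R B p \<beta>)" using v(1) by simp
    qed
  qed (use hh in \<open>auto intro: inj_onI\<close>)
  from betti_subadditive[OF this syz1_module[OF mods(2) fg(2)] Z(1) mods(1) syz1_fin_gen[OF mods(2) fg(2)] fg(1)]
  have "betti R ?Z i \<le> betti R (syz1 R B) i + betti R A i" .
  moreover have "betti R (syz1 R C) i \<le> betti R ?Z i"
    by (rule betti_retr[OF retr_syz1_relmod[OF retr_refl mods(3,3) C h] syz1_module[OF mods(3) C] Z])
  ultimately show ?thesis by (simp add: betti_Suc)
qed

text \<open>The middle term is the pullback of B -> C and the cover R^q -> C. Its projection to R^q
  splits, by the lifts \<gamma> of the generators, and so it is A (+) R^q; its projection to B has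
  kernel \<open>syz1 R C\<close>. That A is a retract of it settles every i at once, including i =
  0, where the free summand contributes q.\<close>

lemma betti_rotate_right:
  assumes se: "short_exact R A B C f g" and mods: "module R A" "module R B" "module R C"
    and fg: "fin_gen R A" "fin_gen R B"
  shows "betti R A i \<le> betti R B i + betti R C (Suc i)"
proof -
  interpret A: module R A by fact
  interpret B: module R B by fact
  interpret C: module R C by fact
  have f: "mod_hom R A B f" and g: "mod_hom R B C g" and inj: "inj_on f (carrier A)"
    and surj: "g ` carrier B = carrier C"
    and im: "f ` carrier A = {y \<in> carrier B. g y = \<zero>\<^bsub>C\<^esub>}"
    using se by (auto simp: short_exact_def)
  have C: "fin_gen R C" using fg(2) generates_surj[OF _ mods(2,3) g surj] unfolding fin_gen_def by blast
  define q where "q = mingens R C"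
  obtain \<gamma>' where \<gamma>': "generates R C q \<gamma>'" "syz1 R C = relmod R C q \<gamma>'"
    by (rule minimal_presentation[OF mods(3) C, folded q_def]) (rule that)
  note \<gamma>'c = generatesD[OF \<gamma>'(1) mods(3)]
  have "\<forall>j<q. \<exists>b\<in>carrier B. g b = \<gamma>' j" using \<gamma>'c(1) surj by (metis imageE)
  then obtain \<gamma> where \<gamma>: "\<And>j. j < q \<Longrightarrow> \<gamma> j \<in> carrier B" "\<And>j. j < q \<Longrightarrow> g (\<gamma> j) = \<gamma>' j" by metis
  let ?F = "freemod R q"
  have lcB: "mod_hom R ?F B (\<lambda>v. lincomb B q v \<gamma>)" by (rule lincomb_mod_hom[OF mods(2) \<gamma>(1)])
  have glc: "g (lincomb B q v \<gamma>) = lincomb C q v \<gamma>'" if v: "v \<in> carrier ?F" for v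
  proof -
    have "g (lincomb B q v \<gamma>) = lincomb C q v (\<lambda>j. g (\<gamma> j))"
      by (rule lincomb_hom[OF mods(2,3) g]) (use v \<gamma> in auto)
    also have "\<dots> = lincomb C q v \<gamma>'"
      by (rule lincomb_cong[OF mods(3)]) (use v \<gamma> \<gamma>'c in auto)
    finally show ?thesis .
  qed
  let ?P = "prodmod A ?F"
  let ?S = "relmod R C q \<gamma>'"
  let ?j = "\<lambda>z. f (fst z) \<oplus>\<^bsub>B\<^esub> lincomb B q (snd z) \<gamma>"
  have P: "module R ?P" by (rule prodmod_module[OF mods(1) freemod_module])
  have j: "mod_hom R ?P B ?j"
    by (rule mod_hom_add_fun[OF mod_hom_comp[OF mod_hom_fst f] mod_hom_comp[OF mod_hom_snd lcB] mods(2)])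
  have lcS: "mod_hom R ?S B (\<lambda>v. lincomb B q v \<gamma>)"
    using mod_homD[OF lcB] by (intro mod_homI) (simp_all del: freemod_simps)
  note neg = mod_hom_uminus_fun[OF lcS mods(2)]
  have negim: "\<ominus>\<^bsub>B\<^esub> lincomb B q v \<gamma> \<in> f ` carrier A" if "v \<in> carrier ?S" for v
    using that glc[of v] mod_homD(1)[OF lcS that] unfolding im
    by (simp add: mod_hom_uminus[OF g mods(2,3)])
  \<comment> \<open>The sign makes the pair (\<open>?h v\<close>, v) go to zero under
    \<open>?j\<close>.\<close>
  let ?h = "\<lambda>v. inv_into (carrier A) f (\<ominus>\<^bsub>B\<^esub> lincomb B q v \<gamma>)"
  have h: "mod_hom R ?S A ?h" by (rule mod_hom_inv_into[OF f inj mods(1) neg negim])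
  have fh: "f (?h v) = \<ominus>\<^bsub>B\<^esub> lincomb B q v \<gamma>" if "v \<in> carrier ?S" for v
    by (rule f_inv_into_f[OF negim[OF that]])
  have inc: "mod_hom R ?S ?F (\<lambda>v. v)" by (rule mod_homI) auto
  have "short_exact R ?S ?P B (\<lambda>v. (?h v, v)) ?j"
    unfolding short_exact_def
  proof (intro conjI)
    show i: "mod_hom R ?S ?P (\<lambda>v. (?h v, v))" by (rule mod_hom_Pair[OF h inc])
    show "mod_hom R ?P B ?j" by (rule j)
    show "inj_on (\<lambda>v. (?h v, v)) (carrier ?S)" by (rule inj_onI) simp
    show "?j ` carrier ?P = carrier B"
    proof (intro equalityI subsetI)
      fix b assume "b \<in> ?j ` carrier ?P"
      then show "b \<in> carrier B" using mod_homD(1)[OF j] by blast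
    next
      fix b assume b: "b \<in> carrier B"
      obtain v where v: "v \<in> carrier ?F" "g b = lincomb C q v \<gamma>'"
        using \<gamma>'c(2)[OF mod_homD(1)[OF g b]] by blast
      have lv: "lincomb B q v \<gamma> \<in> carrier B" by (rule mod_homD(1)[OF lcB v(1)])
      have "g (b \<ominus>\<^bsub>B\<^esub> lincomb B q v \<gamma>) = g b \<ominus>\<^bsub>C\<^esub> g (lincomb B q v \<gamma>)"
        by (rule mod_hom_minus[OF g mods(2,3) b lv])
      also have "\<dots> = \<zero>\<^bsub>C\<^esub>" using glc[OF v(1)] v(2) mod_homD(1)[OF g b]
        by (simp add: a_minus_def C.r_neg)
      finally have "b \<ominus>\<^bsub>B\<^esub> lincomb B q v \<gamma> \<in> f ` carrier A" unfolding im using b lv by simp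
      then obtain a where a: "a \<in> carrier A" "b \<ominus>\<^bsub>B\<^esub> lincomb B q v \<gamma> = f a" by blast
      have av: "(a, v) \<in> carrier ?P" using a v by (simp del: freemod_simps)
      have "?j (a, v) = b" using b lv by (simp add: a(2)[symmetric] a_minus_def B.a_assoc B.l_neg)
      then show "b \<in> ?j ` carrier ?P" by (intro image_eqI[OF _ av]) simp
    qed
    show "(\<lambda>v. (?h v, v)) ` carrier ?S = {z \<in> carrier ?P. ?j z = \<zero>\<^bsub>B\<^esub>}"
    proof (intro equalityI subsetI)
      fix z assume "z \<in> (\<lambda>v. (?h v, v)) ` carrier ?S"
      then obtain v where v: "v \<in> carrier ?S" "z = (?h v, v)" by blast
      have "?j z = \<zero>\<^bsub>B\<^esub>" using mod_homD(1)[OF lcS v(1)] by (simp add: v(2) fh[OF v(1)] B.l_neg)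
      then show "z \<in> {z \<in> carrier ?P. ?j z = \<zero>\<^bsub>B\<^esub>}" using mod_homD(1)[OF i v(1)] v(2) by simp
    next
      fix z assume "z \<in> {z \<in> carrier ?P. ?j z = \<zero>\<^bsub>B\<^esub>}"
      then obtain a v where z: "z = (a, v)" "a \<in> carrier A" "v \<in> carrier ?F"
        "f a \<oplus>\<^bsub>B\<^esub> lincomb B q v \<gamma> = \<zero>\<^bsub>B\<^esub>" by auto
      have fa: "f a \<in> carrier B" "g (f a) = \<zero>\<^bsub>C\<^esub>" using im z(2) by auto
      have lv: "lincomb B q v \<gamma> \<in> carrier B" by (rule mod_homD(1)[OF lcB z(3)])
      have fav: "f a = \<ominus>\<^bsub>B\<^esub> lincomb B q v \<gamma>" using B.minus_equality[OF z(4) lv fa(1)] by simp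
      have "lincomb B q v \<gamma> = \<ominus>\<^bsub>B\<^esub> f a" using lv by (simp add: fav)
      then have "g (lincomb B q v \<gamma>) = \<zero>\<^bsub>C\<^esub>"
        using mod_hom_uminus[OF g mods(2,3) fa(1)] fa(2) by simp
      then have v: "v \<in> carrier ?S" using z(3) glc[OF z(3)] by simp
      have "?h v = a" using inj z(2) by (simp add: fav[symmetric])
      then show "z \<in> (\<lambda>v. (?h v, v)) ` carrier ?S" using v z(1) by (intro image_eqI[OF _ v]) simp
    qed
  qed
  note se' = this[folded \<gamma>'(2)]
  have "fin_gen R ?F"
    unfolding fin_gen_def generates_iff[OF freemod_module]
    using lincomb_unitvecs[of _ q] unitvec_closed[of _ q] by metis
  then have Pf: "fin_gen R ?P"
    using horseshoe[OF prodmod_short_exact[OF mods(1) freemod_module] mods(1) P freemod_module fg(1)]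
    unfolding fin_gen_def by metis
  have "retr R A ?P"
    by (rule retrI[OF mod_hom_Pair[OF mod_hom_id mod_hom_zero_fun[OF freemod_module]] mod_hom_fst]) simp
  then have "betti R A i \<le> betti R ?P i" by (rule betti_retr[OF _ mods(1) P Pf])
  also have "\<dots> \<le> betti R (syz1 R C) i + betti R B i"
    by (rule betti_subadditive[OF se' syz1_module[OF mods(3) C] P mods(2) syz1_fin_gen[OF mods(3) C] fg(2)])
  finally show ?thesis by (simp add: betti_Suc)
qed

text \<open>The two families of generators live in different components, so a relation among all of
  them is a pair of relations. The last claim transfers the nonunit criterion from the factors to
  the product.\<close>

lemma prodmod_presentation:
  assumes mods: "module R X" "module R Y" and gens: "generates R X p \<alpha>" "generates R Y q \<gamma>"
  defines "\<delta> \<equiv> append_fam p (\<lambda>i. (\<alpha> i, \<zero>\<^bsub>Y\<^esub>)) (\<lambda>j. (\<zero>\<^bsub>X\<^esub>, \<gamma> j))"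
  shows "generates R (prodmod X Y) (p + q) \<delta>"
    and "retr R (relmod R (prodmod X Y) (p + q) \<delta>) (prodmod (relmod R X p \<alpha>) (relmod R Y q \<gamma>))"
    and "retr R (prodmod (relmod R X p \<alpha>) (relmod R Y q \<gamma>)) (relmod R (prodmod X Y) (p + q) \<delta>)"
    and "\<And>v. v \<in> carrier (relmod R (prodmod X Y) (p + q) \<delta>) \<Longrightarrow>
      (\<lambda>i. if i < p then v i else \<zero>) \<in> carrier (relmod R X p \<alpha>) \<and> (\<lambda>j. v (p + j)) \<in> carrier (relmod R Y q \<gamma>)"
proof -
  interpret X: module R X by fact
  interpret Y: module R Y by fact
  let ?P = "prodmod X Y"
  have P: "module R ?P" by (rule prodmod_module[OF mods])
  interpret P: module R ?P by (rule P)
  note \<alpha> = generatesD[OF gens(1) mods(1)] and \<gamma> = generatesD[OF gens(2) mods(2)]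
  let ?Z = "relmod R ?P (p + q) \<delta>" and ?Q = "prodmod (relmod R X p \<alpha>) (relmod R Y q \<gamma>)"
  have \<delta>c: "\<delta> i \<in> carrier ?P" if "i < p + q" for i
    using that \<alpha>(1) \<gamma>(1) by (auto simp: \<delta>_def append_fam_def)
  have i1: "mod_hom R X ?P (\<lambda>x. (x, \<zero>\<^bsub>Y\<^esub>))"
    by (intro mod_hom_Pair mod_hom_id mod_hom_zero_fun mods)
  have i2: "mod_hom R Y ?P (\<lambda>y. (\<zero>\<^bsub>X\<^esub>, y))"
    by (intro mod_hom_Pair mod_hom_id mod_hom_zero_fun mods)
  \<comment> \<open>Elements of R^p vanish from p on, so the first block has to be cut off; the
    second block of a vector of R^(p+q) vanishes from q on by itself.\<close>
  let ?t = "\<lambda>v i. if i < p then v i else \<zero>" and ?d = "\<lambda>v j. v (p + j)"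
  have lc: "lincomb ?P (p + q) v \<delta> = (lincomb X p (?t v) \<alpha>, lincomb Y q (?d v) \<gamma>)"
    if v: "\<And>i. i < p + q \<Longrightarrow> v i \<in> carrier R" for v
  proof -
    have "lincomb ?P (p + q) v \<delta> = lincomb ?P p v (\<lambda>i. (\<alpha> i, \<zero>\<^bsub>Y\<^esub>)) \<oplus>\<^bsub>?P\<^esub> lincomb ?P q (?d v) (\<lambda>j. (\<zero>\<^bsub>X\<^esub>, \<gamma> j))"
      unfolding \<delta>_def by (rule lincomb_append[OF P v]) (use \<alpha> \<gamma> in auto)
    also have "lincomb ?P p v (\<lambda>i. (\<alpha> i, \<zero>\<^bsub>Y\<^esub>)) = (lincomb X p v \<alpha>, \<zero>\<^bsub>Y\<^esub>)"
      by (rule lincomb_hom[OF mods(1) P i1, symmetric]) (use v \<alpha> in auto)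
    also have "lincomb ?P q (?d v) (\<lambda>j. (\<zero>\<^bsub>X\<^esub>, \<gamma> j)) = (\<zero>\<^bsub>X\<^esub>, lincomb Y q (?d v) \<gamma>)"
      by (rule lincomb_hom[OF mods(2) P i2, symmetric]) (use v \<gamma> in auto)
    also have "lincomb X p v \<alpha> = lincomb X p (?t v) \<alpha>"
      by (rule lincomb_cong[OF mods(1)]) (use v \<alpha> in auto)
    finally show ?thesis
      using lincomb_closed[OF mods(1) _ \<alpha>(1), of p "?t v"] lincomb_closed[OF mods(2) _ \<gamma>(1), of q "?d v"] v
      by simp
  qed
  have ta: "?t (append_fam p u w) = u" if "u \<in> carrier (freemod R p)" for u w
    using that by (auto simp: append_fam_def fun_eq_iff)
  have da: "?d (append_fam p u w) = w" for u w :: "nat \<Rightarrow> 'a"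
    by (auto simp: append_fam_def)
  show "generates R ?P (p + q) \<delta>"
  proof (rule generatesI[OF P \<delta>c])
    fix z assume "z \<in> carrier ?P"
    then obtain x y where z: "z = (x, y)" "x \<in> carrier X" "y \<in> carrier Y" by auto
    obtain u where u: "u \<in> carrier (freemod R p)" "x = lincomb X p u \<alpha>" using \<alpha>(2)[OF z(2)] by blast
    obtain w where w: "w \<in> carrier (freemod R q)" "y = lincomb Y q w \<gamma>" using \<gamma>(2)[OF z(3)] by blast
    have c: "append_fam p u w i \<in> carrier R" if "i < p + q" for i
      using u(1) w(1) that by (auto simp: append_fam_def)
    have "lincomb ?P (p + q) (append_fam p u w) \<delta>
      = (lincomb X p (?t (append_fam p u w)) \<alpha>, lincomb Y q (?d (append_fam p u w)) \<gamma>)"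
      by (rule lc) (erule c)
    then have "z = lincomb ?P (p + q) (append_fam p u w) \<delta>"
      unfolding ta[OF u(1)] da by (simp only: z(1) u(2) w(2))
    then show "\<exists>v. (\<forall>i<p+q. v i \<in> carrier R) \<and> z = lincomb ?P (p + q) v \<delta>" using c by blast
  qed
  have tdZ: "?t v \<in> carrier (relmod R X p \<alpha>)" "?d v \<in> carrier (relmod R Y q \<gamma>)" if "v \<in> carrier ?Z" for v
    using that lc[of v] by auto
  show "?t v \<in> carrier (relmod R X p \<alpha>) \<and> ?d v \<in> carrier (relmod R Y q \<gamma>)" if "v \<in> carrier ?Z" for v
    using tdZ[OF that] by blast
  have s: "mod_hom R ?Z ?Q (\<lambda>v. (?t v, ?d v))"
  proof (rule mod_homI)
    show "(?t v, ?d v) \<in> carrier ?Q" if "v \<in> carrier ?Z" for v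
      unfolding prodmod_simps using tdZ[OF that] by (rule SigmaI)
  qed (auto simp: fun_eq_iff)
  have r: "mod_hom R ?Q ?Z (\<lambda>z. append_fam p (fst z) (snd z))"
  proof (rule mod_homI)
    fix z assume "z \<in> carrier ?Q"
    then have z: "fst z \<in> carrier (relmod R X p \<alpha>)" "snd z \<in> carrier (relmod R Y q \<gamma>)"
      by (auto simp del: relmod_simps freemod_simps)
    then have zF: "fst z \<in> carrier (freemod R p)" "snd z \<in> carrier (freemod R q)" by simp_all
    have c: "append_fam p (fst z) (snd z) \<in> carrier (freemod R (p + q))"
      using zF by (auto simp: append_fam_def)
    then have c': "append_fam p (fst z) (snd z) i \<in> carrier R" if "i < p + q" for i using that by simp
    have "lincomb ?P (p + q) (append_fam p (fst z) (snd z)) \<delta>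
      = (lincomb X p (?t (append_fam p (fst z) (snd z))) \<alpha>,
         lincomb Y q (?d (append_fam p (fst z) (snd z))) \<gamma>)"
      by (rule lc) (erule c')
    then have "lincomb ?P (p + q) (append_fam p (fst z) (snd z)) \<delta> = \<zero>\<^bsub>?P\<^esub>"
      unfolding ta[OF zF(1)] da using z by simp
    then show "append_fam p (fst z) (snd z) \<in> carrier ?Z" using c by simp
  qed (auto simp: append_fam_def fun_eq_iff)
  show "retr R ?Z ?Q" by (rule retrI[OF s r]) (auto simp: append_fam_def fun_eq_iff)
  show "retr R ?Q ?Z"
  proof (rule retrI[OF r s])
    fix z assume "z \<in> carrier ?Q"
    then have "fst z \<in> carrier (freemod R p)" by auto
    from ta[OF this] da show "(?t (append_fam p (fst z) (snd z)), ?d (append_fam p (fst z) (snd z))) = z"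
      by simp
  qed
qed

lemma prodmod_fin_gen:
  assumes "module R X" "module R Y" "fin_gen R X" "fin_gen R Y"
  shows "fin_gen R (prodmod X Y)"
  using assms(3,4) prodmod_presentation(1)[OF assms(1,2)] unfolding fin_gen_def by blast

text \<open>Each entry of a relation of the product is an entry of a relation of a factor, hence a
  nonunit. So the concatenated family is minimal by \<open>mingens_eq\<close>, and its kernel and
  \<open>syz1\<close> of the product are retracts of each other.\<close>

lemma prodmod_syz1:
  assumes mods: "module R X" "module R Y" and fg: "fin_gen R X" "fin_gen R Y"
  shows "mingens R (prodmod X Y) = mingens R X + mingens R Y"
    and "retr R (syz1 R (prodmod X Y)) (prodmod (syz1 R X) (syz1 R Y))"
    and "retr R (prodmod (syz1 R X) (syz1 R Y)) (syz1 R (prodmod X Y))"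
proof -
  let ?P = "prodmod X Y"
  have P: "module R ?P" by (rule prodmod_module[OF mods])
  have Pf: "fin_gen R ?P" by (rule prodmod_fin_gen[OF mods fg])
  define p q where "p = mingens R X" and "q = mingens R Y"
  obtain \<alpha> where \<alpha>: "generates R X p \<alpha>" "syz1 R X = relmod R X p \<alpha>"
    "\<And>v i. v \<in> carrier (syz1 R X) \<Longrightarrow> v i \<in> nonunits R"
    by (rule minimal_presentation[OF mods(1) fg(1), folded p_def]) (rule that)
  obtain \<gamma> where \<gamma>: "generates R Y q \<gamma>" "syz1 R Y = relmod R Y q \<gamma>"
    "\<And>v i. v \<in> carrier (syz1 R Y) \<Longrightarrow> v i \<in> nonunits R"
    by (rule minimal_presentation[OF mods(2) fg(2), folded q_def]) (rule that)
  define \<delta> where "\<delta> = append_fam p (\<lambda>i. (\<alpha> i, \<zero>\<^bsub>Y\<^esub>)) (\<lambda>j. (\<zero>\<^bsub>X\<^esub>, \<gamma> j))"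
  note pres = prodmod_presentation[OF mods \<alpha>(1) \<gamma>(1), folded \<delta>_def]
  have min: "v i \<in> nonunits R" if v: "v \<in> carrier (relmod R ?P (p + q) \<delta>)" for v i
  proof (cases "i < p")
    case True
    then show ?thesis using \<alpha>(3)[of "\<lambda>i. if i < p then v i else \<zero>" i] pres(4)[OF v] by (simp add: \<alpha>(2))
  next
    case False
    then show ?thesis using \<gamma>(3)[of "\<lambda>j. v (p + j)" "i - p"] pres(4)[OF v] by (simp add: \<gamma>(2))
  qed
  show m: "mingens R ?P = mingens R X + mingens R Y"
    unfolding p_def[symmetric] q_def[symmetric] by (rule mingens_eq[OF P pres(1)]) (erule min)
  have pm: "p + q = mingens R ?P" by (simp add: m p_def q_def)
  obtain g where g: "generates R ?P (mingens R ?P) g" "syz1 R ?P = relmod R ?P (mingens R ?P) g"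
    by (rule minimal_presentation[OF P Pf]) (rule that)
  have "retr R (syz1 R ?P) (relmod R ?P (p + q) \<delta>)"
    by (rule retr_syz1_relmod[OF retr_refl P P Pf pres(1)])
  then show "retr R (syz1 R ?P) (prodmod (syz1 R X) (syz1 R Y))"
    unfolding \<alpha>(2) \<gamma>(2) using pres(2) by (rule retr_trans)
  have "retr R (relmod R ?P (p + q) \<delta>) (syz1 R ?P)"
    unfolding g(2) by (rule retr_relmod[OF P P retr_refl pres(1) g(1)]) (erule min)
  with pres(3) show "retr R (prodmod (syz1 R X) (syz1 R Y)) (syz1 R ?P)"
    unfolding \<alpha>(2) \<gamma>(2) by (rule retr_trans)
qed

lemma betti_prodmod_vec:
  fixes X Y :: "('a, nat \<Rightarrow> 'a) module"
  assumes "module R X" "module R Y" "fin_gen R X" "fin_gen R Y"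
  shows "betti R (prodmod X Y) i = betti R X i + betti R Y i"
  using assms
proof (induction i arbitrary: X Y)
  case 0
  then show ?case by (simp add: betti_0 prodmod_syz1(1))
next
  case (Suc i)
  note p = Suc.prems
  have "betti R (syz1 R (prodmod X Y)) i = betti R (prodmod (syz1 R X) (syz1 R Y)) i"
    by (rule betti_retr_eq[OF prodmod_syz1(2,3)[OF p]])
      (intro syz1_module syz1_fin_gen prodmod_module prodmod_fin_gen p)+
  also have "\<dots> = betti R (syz1 R X) i + betti R (syz1 R Y) i"
    by (intro Suc.IH syz1_module syz1_fin_gen p)
  finally show ?case by (simp add: betti_Suc)
qed

lemma betti_prodmod:
  assumes p: "module R X" "module R Y" "fin_gen R X" "fin_gen R Y"
  shows "betti R (prodmod X Y) i = betti R X i + betti R Y i"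
proof (cases i)
  case 0
  then show ?thesis using p by (simp add: betti_0 prodmod_syz1(1))
next
  case (Suc j)
  have "betti R (syz1 R (prodmod X Y)) j = betti R (prodmod (syz1 R X) (syz1 R Y)) j"
    by (rule betti_retr_eq[OF prodmod_syz1(2,3)[OF p]])
      (intro syz1_module syz1_fin_gen prodmod_module prodmod_fin_gen p)+
  also have "\<dots> = betti R (syz1 R X) j + betti R (syz1 R Y) j"
    by (intro betti_prodmod_vec syz1_module syz1_fin_gen p)
  finally show ?thesis by (simp add: betti_Suc Suc)
qed

text \<open>Induction from one summand on, which spares the Betti numbers of the zero
  module.\<close>

lemma betti_dsum:
  assumes X: "module R X" "fin_gen R X"
  shows "betti R (dsum R (Suc a) X) i = Suc a * betti R X i \<and> fin_gen R (dsum R (Suc a) X)"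
proof (induction a)
  case 0
  have f: "fin_gen R (dsum R (Suc 0) X)"
    by (rule retr_fin_gen[OF dsum_1_retr(1)[OF X(1)] dsum_module[OF X(1)] X])
  then show ?case
    using betti_retr_eq[OF dsum_1_retr[OF X(1)] dsum_module[OF X(1)] X(1) f] by simp
next
  case (Suc a)
  let ?P = "prodmod (dsum R (Suc a) X) X"
  have P: "module R ?P" "fin_gen R ?P"
    using Suc.IH by (auto intro: prodmod_module prodmod_fin_gen dsum_module X)
  have f: "fin_gen R (dsum R (Suc (Suc a)) X)"
    by (rule retr_fin_gen[OF dsum_Suc_retr(1)[OF X(1)] dsum_module[OF X(1)] P])
  have "betti R (dsum R (Suc (Suc a)) X) i = betti R ?P i"
    by (rule betti_retr_eq[OF dsum_Suc_retr[OF X(1)] dsum_module[OF X(1)] P(1) f])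
  also have "\<dots> = betti R (dsum R (Suc a) X) i + betti R X i"
    using Suc.IH by (intro betti_prodmod dsum_module X) simp
  finally show ?case using Suc.IH f by simp
qed

end

subsection \<open>Polynomially bounded sequences\<close>

text \<open>The condition of \<open>cx_bound\<close> for a bare sequence, so that the recursions can
  be studied without modules.\<close>

definition growth_bound :: "(nat \<Rightarrow> nat) \<Rightarrow> nat \<Rightarrow> bool" where
  "growth_bound m r \<longleftrightarrow> (\<exists>A::real. \<forall>\<^sub>F i in sequentially. real (m i) \<le> A * real i powr (real r - 1))"

lemma growth_boundE:
  assumes "growth_bound m r"
  obtains A N where "A > 0" "N \<ge> 1" "\<And>i. i \<ge> N \<Longrightarrow> real (m i) \<le> A * real i powr (real r - 1)"
proof -
  obtain A where "\<forall>\<^sub>F i in sequentially. real (m i) \<le> A * real i powr (real r - 1)"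
    using assms unfolding growth_bound_def by blast
  then obtain N where N: "\<And>i. i \<ge> N \<Longrightarrow> real (m i) \<le> A * real i powr (real r - 1)"
    unfolding eventually_sequentially by blast
  show thesis
  proof (rule that[of "max A 1" "max N 1"])
    fix i assume "i \<ge> max N 1"
    then have "real (m i) \<le> A * real i powr (real r - 1)" using N by simp
    also have "\<dots> \<le> max A 1 * real i powr (real r - 1)" by (rule mult_right_mono) auto
    finally show "real (m i) \<le> max A 1 * real i powr (real r - 1)" .
  qed auto
qed

lemma growth_boundI:
  assumes "\<And>i. i \<ge> N \<Longrightarrow> real (m i) \<le> A * real i powr (real r - 1)"
  shows "growth_bound m r"
  using assms unfolding growth_bound_def eventually_sequentially by blast

text \<open>For r = 0 the exponent is -1, and a natural number at most A / i is zero once i >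
  A.\<close>

lemma growth_bound_0D:
  assumes "growth_bound m 0"
  obtains N where "\<And>i. i \<ge> N \<Longrightarrow> m i = 0"
proof -
  obtain A N where A: "A > 0" "N \<ge> 1" "\<And>i. i \<ge> N \<Longrightarrow> real (m i) \<le> A * real i powr (real 0 - 1)"
    using growth_boundE[OF assms] by blast
  show thesis
  proof (rule that[of "max N (nat \<lceil>A\<rceil> + 1)"])
    fix i assume i: "i \<ge> max N (nat \<lceil>A\<rceil> + 1)"
    then have "real i > A" "i \<ge> 1" using A(2) by linarith+
    have "real (m i) \<le> A / real i" using A(3)[of i] i \<open>i \<ge> 1\<close> by (simp add: powr_minus_divide)
    also have "\<dots> < 1" using \<open>real i > A\<close> \<open>i \<ge> 1\<close> by simp
    finally show "m i = 0" by simp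
  qed
qed

text \<open>The ratio of the two powers tends to 1 for every real exponent, including the -1 of r =
  0. Both directions are given because the sign of e decides which power is larger.\<close>

lemma powr_shift_ratio:
  fixes e :: real
  assumes "\<epsilon> > 1"
  obtains N where "N \<ge> 1" "\<And>i. i \<ge> N \<Longrightarrow> real i powr e \<le> \<epsilon> * real (i + s) powr e"
    "\<And>i. i \<ge> N \<Longrightarrow> real (i + s) powr e \<le> \<epsilon> * real i powr e"
proof -
  have 1: "(\<lambda>i. real i powr e / real (i + s) powr e) \<longlonglongrightarrow> 1"
    by real_asymp
  have 2: "(\<lambda>i. real (i + s) powr e / real i powr e) \<longlonglongrightarrow> 1"
    by real_asymp
  have "\<forall>\<^sub>F i in sequentially. real i powr e / real (i + s) powr e < \<epsilon> \<and>
      real (i + s) powr e / real i powr e < \<epsilon>"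
    using order_tendstoD(2)[OF 1 assms] order_tendstoD(2)[OF 2 assms] by eventually_elim auto
  then obtain N where N: "\<And>i. i \<ge> N \<Longrightarrow> real i powr e / real (i + s) powr e < \<epsilon> \<and>
      real (i + s) powr e / real i powr e < \<epsilon>"
    unfolding eventually_sequentially by blast
  show thesis
  proof (rule that[of "max N 1"])
    fix i assume i: "i \<ge> max N 1"
    then have p: "real i powr e > 0" "real (i + s) powr e > 0" by auto
    then show "real i powr e \<le> \<epsilon> * real (i + s) powr e" "real (i + s) powr e \<le> \<epsilon> * real i powr e"
      using N[of i] i by (auto simp: divide_simps split: if_splits)
  qed simp
qed

lemma growth_bound_sum_shift:
  assumes "\<And>i. k i \<le> a * m i + b * m (n + i)" "growth_bound m r"
  shows "growth_bound k r"
proof -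
  obtain A N where A: "A > 0" "N \<ge> 1" "\<And>i. i \<ge> N \<Longrightarrow> real (m i) \<le> A * real i powr (real r - 1)"
    using growth_boundE[OF assms(2)] by blast
  obtain N' where N': "N' \<ge> 1"
    "\<And>i. i \<ge> N' \<Longrightarrow> real (i + n) powr (real r - 1) \<le> 2 * real i powr (real r - 1)"
    by (rule powr_shift_ratio[of 2 "real r - 1" n]) (simp, rule that)
  show ?thesis
  proof (rule growth_boundI[of "max N N'" _ "a * A + 2 * b * A"])
    fix i assume i: "i \<ge> max N N'"
    let ?x = "real i powr (real r - 1)"
    have "real (k i) \<le> real (a * m i + b * m (n + i))" using assms(1) of_nat_mono by blast
    also have "\<dots> = a * real (m i) + b * real (m (n + i))" by simp
    also have "\<dots> \<le> a * (A * ?x) + b * (A * real (n + i) powr (real r - 1))"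
      using i by (intro add_mono mult_left_mono A(3)) auto
    also have "\<dots> \<le> a * (A * ?x) + b * (A * (2 * ?x))"
      using i A(1) N'(2)[of i] by (intro add_mono mult_left_mono) (auto simp: add.commute)
    finally show "real (k i) \<le> (a * A + 2 * b * A) * ?x" by (simp add: algebra_simps)
  qed
qed

text \<open>Up to k, each step of length s multiplies m by at most a / b < 1. This absorbs the
  slight change of \<open>real i powr e\<close> under the shift, so a bound with a fixed constant C
  propagates.\<close>

lemma growth_bound_contraction:
  assumes rec: "\<And>i. b * m (i + s) \<le> k (Suc i) + a * m i" and ab: "a < b" and s: "s \<ge> 1"
    and k: "growth_bound k r"
  shows "growth_bound m r"
proof -
  define e where "e = real r - 1"
  obtain A N where A: "A > 0" "N \<ge> 1" "\<And>i. i \<ge> N \<Longrightarrow> real (k i) \<le> A * real i powr e"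
    using growth_boundE[OF k] unfolding e_def by blast
  define \<theta> where "\<theta> = real a / real b"
  have \<theta>: "0 \<le> \<theta>" "\<theta> < 1" using ab by (auto simp: \<theta>_def)
  \<comment> \<open>Midpoint between \<theta> and 1. The shift of the index may cost a factor
    \<epsilon> as long as \<theta> * \<epsilon> \<le> \<theta>', which suggests \<epsilon> =
    \<theta>' / \<theta>; for \<theta> = 0 the definition gives 2.\<close>
  define \<theta>' where "\<theta>' = (1 + \<theta>) / 2"
  have \<theta>': "\<theta>' < 1" using \<theta> by (simp add: \<theta>'_def)
  define \<epsilon> where "\<epsilon> = \<theta>' / (if \<theta> = 0 then \<theta>' / 2 else \<theta>)"
  have \<epsilon>: "\<epsilon> > 1" using \<theta> by (auto simp: \<epsilon>_def \<theta>'_def field_simps)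
  have \<theta>\<epsilon>: "\<theta> * \<epsilon> \<le> \<theta>'" using \<theta> by (auto simp: \<epsilon>_def \<theta>'_def)
  obtain N1 where N1: "N1 \<ge> 1" "\<And>i. i \<ge> N1 \<Longrightarrow> real i powr e \<le> \<epsilon> * real (i + s) powr e"
    by (rule powr_shift_ratio[OF \<epsilon>]) (rule that)
  \<comment> \<open>k is evaluated at i + 1 but compared with j = (i + 1) + (s - 1), which costs the
    factor 2 in C.\<close>
  obtain N2 where N2: "N2 \<ge> 1" "\<And>i. i \<ge> N2 \<Longrightarrow> real i powr e \<le> 2 * real (i + (s - 1)) powr e"
    by (rule powr_shift_ratio[of 2 e "s - 1"]) (simp, rule that)
  define J where "J = N + N1 + N2"
  \<comment> \<open>D settles the first s indices, the start of the recursion of step s; C is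
    moreover so large that 2 * A + C * \<theta>' \<le> C.\<close>
  define D where "D = Max ((\<lambda>j. real (m j) / real j powr e) ` {J..<J+s})"
  define C where "C = max D (2 * A / (1 - \<theta>'))"
  have J: "J \<ge> 1" using A(2) by (simp add: J_def)
  have C2: "2 * A \<le> C * (1 - \<theta>')" using \<theta>' by (simp add: C_def field_simps max_def)
  have Cnn: "C \<ge> 0" using A(1) \<theta>' by (auto simp: C_def intro: max.coboundedI2)
  have bound: "real (m j) \<le> C * real j powr e" if "j \<ge> J" for j
    using that
  proof (induction j rule: less_induct)
    case (less j)
    show ?case
    proof (cases "j < J + s")
      case True
      have "real (m j) / real j powr e \<le> D"
        unfolding D_def using True less.prems by (intro Max_ge) auto
      then have "real (m j) / real j powr e \<le> C" by (simp add: C_def)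
      moreover have "real j powr e > 0" using less.prems J by simp
      ultimately show ?thesis by (simp add: divide_simps)
    next
      case False
      define i where "i = j - s"
      have i: "j = i + s" "i \<ge> J" "i < j" using False s by (auto simp: i_def)
      have IH: "real (m i) \<le> C * real i powr e" by (rule less.IH[OF i(3,2)])
      have "real b * real (m j) \<le> real (k (Suc i)) + real a * real (m i)"
        using rec[of i] unfolding i(1) by (metis of_nat_add of_nat_mono of_nat_mult)
      moreover have "real b \<ge> 1" using ab by simp
      moreover have "real (k (Suc i)) \<le> real b * real (k (Suc i))"
        using \<open>real b \<ge> 1\<close> by (simp add: mult_le_cancel_right1)
      moreover have "real b * (real (k (Suc i)) + \<theta> * real (m i)) = real b * real (k (Suc i)) + real a * real (m i)"
        using \<open>real b \<ge> 1\<close> by (simp add: \<theta>_def distrib_left)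
      ultimately have "real b * real (m j) \<le> real b * (real (k (Suc i)) + \<theta> * real (m i))"
        by linarith
      then have "real (m j) \<le> real (k (Suc i)) + \<theta> * real (m i)"
        using \<open>real b \<ge> 1\<close> by (simp add: mult_le_cancel_left)
      also have "real (k (Suc i)) \<le> A * real (Suc i) powr e"
        using i by (intro A(3)) (simp add: J_def)
      also have "real (Suc i) powr e \<le> 2 * real j powr e"
        using N2(2)[of "Suc i"] i s by (simp add: J_def)
      also have "\<theta> * real (m i) \<le> \<theta> * (C * (\<epsilon> * real j powr e))"
      proof -
        have "C * real i powr e \<le> C * (\<epsilon> * real j powr e)"
          using N1(2)[of i] i Cnn by (intro mult_left_mono) (auto simp: J_def)
        with IH show ?thesis using \<theta>(1) by (intro mult_left_mono) auto
      qed
      finally have "real (m j) \<le> A * (2 * real j powr e) + \<theta> * (C * (\<epsilon> * real j powr e))"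
        using A(1) by simp
      also have "\<dots> = (2 * A + C * (\<theta> * \<epsilon>)) * real j powr e" by (simp add: algebra_simps)
      also have "\<dots> \<le> (2 * A + C * \<theta>') * real j powr e"
        using \<theta>\<epsilon> Cnn by (intro mult_right_mono add_left_mono mult_left_mono) auto
      also have "\<dots> \<le> C * real j powr e"
        using C2 by (intro mult_right_mono) (auto simp: algebra_simps)
      finally show ?thesis .
    qed
  qed
  then show ?thesis unfolding e_def by (rule growth_boundI)
qed

text \<open>Discrete integration: summing increments of order r - 1 gives order r, which is the
  bound for Suc r.\<close>

lemma growth_bound_sum:
  assumes rec: "\<And>i. m (i + s) \<le> k (Suc i) + m i" and s: "s \<ge> 1" and k: "growth_bound k r"
  shows "growth_bound m (Suc r)"
proof -
  \<comment> \<open>k is dominated by the increments of A * i^r, which makes the recursion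
    telescope. For r = 0 these increments vanish, and so does k eventually.\<close>
  have "\<exists>A\<ge>0. \<exists>N\<ge>1. \<forall>i\<ge>N. real (k (Suc i)) \<le> A * (real (i + s) ^ r - real i ^ r)"
  proof (cases r)
    case 0
    then obtain N where N: "\<And>i. i \<ge> N \<Longrightarrow> k i = 0" using growth_bound_0D k by blast
    then show ?thesis using 0 by (intro exI[of _ "0::real"] exI[of _ "max N 1"] conjI) auto
  next
    case (Suc d)
    obtain A N where A: "A > 0" "N \<ge> 1" "\<And>i. i \<ge> N \<Longrightarrow> real (k i) \<le> A * real i powr (real r - 1)"
      using growth_boundE[OF k] by blast
    have "real (k (Suc i)) \<le> A * (real (i + s) ^ r - real i ^ r)" if i: "i \<ge> N" for i
    proof -
      have "real (k (Suc i)) \<le> A * real (Suc i) ^ d"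
        using A(3)[of "Suc i"] i Suc powr_realpow[of "real (Suc i)" d] by simp
      also have "\<dots> \<le> A * (real s * real (i + s) ^ d)"
      proof (rule mult_left_mono)
        have "real (Suc i) ^ d \<le> real (i + s) ^ d" using s by (intro power_mono) auto
        also have "\<dots> \<le> real s * real (i + s) ^ d" using s by (simp add: mult_le_cancel_right1)
        finally show "real (Suc i) ^ d \<le> real s * real (i + s) ^ d" .
      qed (use A(1) in simp)
      also have "real s * real (i + s) ^ d \<le> real (i + s) ^ r - real i ^ r"
      proof -
        have "real i * real i ^ d \<le> real i * real (i + s) ^ d"
          by (intro mult_left_mono power_mono) auto
        then show ?thesis by (simp add: Suc algebra_simps)
      qed
      finally show ?thesis using A(1) by simp
    qed
    then show ?thesis using A(1,2) by (intro exI[of _ A] conjI exI[of _ N]) auto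
  qed
  then obtain A N where A: "A \<ge> 0" "N \<ge> 1"
    "\<And>i. i \<ge> N \<Longrightarrow> real (k (Suc i)) \<le> A * (real (i + s) ^ r - real i ^ r)" by blast
  define D where "D = Max ((\<lambda>j. real (m j)) ` {N..<N+s})"
  have "D \<ge> real (m N)" unfolding D_def using s by (intro Max_ge) auto
  then have D: "D \<ge> 0" by linarith
  have bound: "real (m j) \<le> D + A * real j ^ r" if "j \<ge> N" for j
    using that
  proof (induction j rule: less_induct)
    case (less j)
    show ?case
    proof (cases "j < N + s")
      case True
      have "real (m j) \<le> D" unfolding D_def using True less.prems by (intro Max_ge) auto
      then show ?thesis using A(1) by (simp add: add_increasing2)
    next
      case False
      define i where "i = j - s"
      have i: "j = i + s" "i \<ge> N" "i < j" using False s by (auto simp: i_def)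
      have "real (m j) \<le> real (k (Suc i)) + real (m i)"
        using rec[of i] unfolding i(1) by (metis of_nat_add of_nat_mono)
      also have "\<dots> \<le> A * (real j ^ r - real i ^ r) + (D + A * real i ^ r)"
        using A(3)[OF i(2)] less.IH[OF i(3,2)] i(1) by (intro add_mono) simp_all
      finally show ?thesis by (simp add: algebra_simps)
    qed
  qed
  show ?thesis
  proof (rule growth_boundI[of N _ "D + A"])
    fix j assume j: "j \<ge> N"
    have "D \<le> D * real j ^ r" using j A(2) D by (simp add: mult_le_cancel_left1)
    then have "real (m j) \<le> (D + A) * real j ^ r" using bound[OF j] by (simp add: algebra_simps)
    then show "real (m j) \<le> (D + A) * real j powr (real (Suc r) - 1)"
      using j A(2) by (simp add: powr_realpow)
  qed
qed

text \<open>Any a priori polynomial bound is multiplied by a factor less than 1 each time the recursion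
  is unrolled, so only the contribution of \<open>k\<close> survives in the limit.\<close>

lemma growth_bound_expansion:
  assumes rec: "\<And>i. a * m i \<le> k i + b * m (i + s)" and ab: "b < a"
    and k: "growth_bound k r" and m: "growth_bound m d"
  shows "growth_bound m r"
proof -
  define e where "e = real r - 1"
  define e' where "e' = real d - 1"
  obtain A N where A: "A > 0" "N \<ge> 1" "\<And>i. i \<ge> N \<Longrightarrow> real (k i) \<le> A * real i powr e"
    using growth_boundE[OF k] unfolding e_def by blast
  obtain D N0 where D: "D > 0" "N0 \<ge> 1" "\<And>i. i \<ge> N0 \<Longrightarrow> real (m i) \<le> D * real i powr e'"
    using growth_boundE[OF m] unfolding e'_def by blast
  define \<theta> where "\<theta> = real b / real a"
  have \<theta>: "0 \<le> \<theta>" "\<theta> < 1" using ab by (auto simp: \<theta>_def)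
  \<comment> \<open>The same margin for the index shift as in
    \<open>growth_bound_contraction\<close>.\<close>
  define \<theta>' where "\<theta>' = (1 + \<theta>) / 2"
  have \<theta>': "0 \<le> \<theta>'" "\<theta>' < 1" using \<theta> by (simp_all add: \<theta>'_def)
  define \<epsilon> where "\<epsilon> = \<theta>' / (if \<theta> = 0 then \<theta>' / 2 else \<theta>)"
  have \<epsilon>: "\<epsilon> > 1" using \<theta> by (auto simp: \<epsilon>_def \<theta>'_def field_simps)
  have \<theta>\<epsilon>: "\<theta> * \<epsilon> \<le> \<theta>'" using \<theta> by (auto simp: \<epsilon>_def \<theta>'_def)
  obtain N1 where N1: "\<And>i. i \<ge> N1 \<Longrightarrow> real (i + s) powr e \<le> \<epsilon> * real i powr e"
    by (rule powr_shift_ratio[OF \<epsilon>]) (rule that)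
  obtain N2 where N2: "\<And>i. i \<ge> N2 \<Longrightarrow> real (i + s) powr e' \<le> \<epsilon> * real i powr e'"
    by (rule powr_shift_ratio[OF \<epsilon>]) (rule that)
  define J where "J = N + N0 + N1 + N2"
  \<comment> \<open>The fixed point C = A + C * \<theta>': each unrolling reproduces the main term,
    while the a priori term gains a factor \<theta>'.\<close>
  define C where "C = A / (1 - \<theta>')"
  have C: "C \<ge> 0" "A + C * \<theta>' = C" using A(1) \<theta>' by (auto simp: C_def field_simps)
  \<comment> \<open>The threshold J serves all n, because unrolling never moves to a smaller
    index.\<close>
  have step: "real (m i) \<le> C * real i powr e + D * \<theta>' ^ n * real i powr e'" if "i \<ge> J" for n i
    using that
  proof (induction n arbitrary: i)
    case 0
    then have "real (m i) \<le> D * real i powr e'" by (intro D(3)) (simp add: J_def)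
    then show ?case using C(1) by (simp add: add_increasing)
  next
    case (Suc n)
    note i = Suc.prems
    have "real a * real (m i) \<le> real (k i) + real b * real (m (i + s))"
      using rec[of i] by (metis of_nat_add of_nat_mono of_nat_mult)
    moreover have "real a \<ge> 1" using ab by simp
    moreover have "real (k i) \<le> real a * real (k i)"
      using \<open>real a \<ge> 1\<close> by (simp add: mult_le_cancel_right1)
    moreover have "real a * (real (k i) + \<theta> * real (m (i + s))) = real a * real (k i) + real b * real (m (i + s))"
      using \<open>real a \<ge> 1\<close> by (simp add: \<theta>_def distrib_left)
    ultimately have "real a * real (m i) \<le> real a * (real (k i) + \<theta> * real (m (i + s)))"
      by linarith
    then have "real (m i) \<le> real (k i) + \<theta> * real (m (i + s))"
      using \<open>real a \<ge> 1\<close> by (simp add: mult_le_cancel_left)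
    also have "\<dots> \<le> A * real i powr e
        + \<theta> * (C * real (i + s) powr e + D * \<theta>' ^ n * real (i + s) powr e')"
      using i by (intro add_mono A(3) mult_left_mono Suc.IH \<theta>(1)) (auto simp: J_def)
    also have "\<dots> \<le> A * real i powr e
        + \<theta> * (C * (\<epsilon> * real i powr e) + D * \<theta>' ^ n * (\<epsilon> * real i powr e'))"
      using i C(1) D(1) \<theta>'(1) by (intro add_mono order_refl mult_left_mono N1 N2 \<theta>(1)) (auto simp: J_def)
    also have "\<dots> = (A + C * (\<theta> * \<epsilon>)) * real i powr e + D * \<theta>' ^ n * (\<theta> * \<epsilon>) * real i powr e'"
      by (simp add: algebra_simps)
    also have "\<dots> \<le> (A + C * \<theta>') * real i powr e + D * \<theta>' ^ n * \<theta>' * real i powr e'"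
      using C(1) D(1) \<theta>'(1) \<theta>\<epsilon> by (intro add_mono mult_right_mono mult_left_mono order_refl) auto
    also have "\<dots> = C * real i powr e + D * \<theta>' ^ Suc n * real i powr e'" by (simp add: C(2) mult_ac)
    finally show ?case .
  qed
  show ?thesis
  proof (rule growth_boundI[of J _ C])
    fix i assume i: "i \<ge> J"
    \<comment> \<open>Now i is fixed and n tends to infinity, which removes the a priori
      term.\<close>
    have "(\<lambda>n. \<theta>' ^ n) \<longlonglongrightarrow> 0" using \<theta>' by (intro LIMSEQ_power_zero) simp
    from tendsto_add[OF tendsto_const tendsto_mult[OF tendsto_mult[OF tendsto_const this] tendsto_const]]
    have "(\<lambda>n. C * real i powr e + D * \<theta>' ^ n * real i powr e')
        \<longlonglongrightarrow> C * real i powr e + D * 0 * real i powr e'" .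
    from LIMSEQ_le_const[OF this, of "real (m i)"] step[OF i]
    have "real (m i) \<le> C * real i powr e" by simp
    then show "real (m i) \<le> C * real i powr (real r - 1)" by (simp add: e_def)
  qed
qed

subsection \<open>Complexity\<close>

lemma cx_bound_iff: "cx_bound R M r \<longleftrightarrow> growth_bound (betti R M) r"
  by (simp add: cx_bound_def growth_bound_def)

lemma cx_eqI:
  assumes "\<And>r. cx_bound R M r \<longleftrightarrow> cx_bound R K r"
  shows "cx R M = cx R K"
proof -
  have "cx_bound R M = cx_bound R K" using assms by (intro ext)
  then show ?thesis by (simp add: cx_def)
qed

lemma cx_enatD:
  assumes "cx R M = enat c"
  shows "cx_bound R M c"
proof -
  have ex: "\<exists>r. cx_bound R M r" using assms by (auto simp: cx_def split: if_splits)
  then have "c = (LEAST r. cx_bound R M r)" using assms by (simp add: cx_def)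
  then show ?thesis using LeastI_ex[OF ex] by simp
qed

lemma cx_le: "cx_bound R M r \<Longrightarrow> cx R M \<le> enat r"
  by (auto simp: cx_def intro: Least_le)

text \<open>\<open>syz_suc R k M\<close> is the syzygy of index k + 1: positive syzygies consist of
  vectors over R, while the zeroth keeps the element type of M. Hence the case split on n.\<close>

lemma (in noeth_local) betti_is_syzygy:
  assumes "module R M" "fin_gen R M" "module R N" "is_syzygy R n M N"
  shows "fin_gen R N \<and> betti R N i = betti R M (n + i)"
proof (cases n)
  case 0
  then have "mod_iso R M N" using assms(4) by (simp add: is_syzygy_def)
  note r = mod_iso_retr[OF this assms(1)]
  show ?thesis
    using retr_fin_gen[OF r(2) assms(3,1,2)] betti_retr_eq[OF r assms(1,3,2), of i] 0 by simp
next
  case (Suc k)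
  then have iso: "mod_iso R (syz_suc R k M) N" using assms(4) by (simp add: is_syzygy_def)
  have S: "module R (syz_suc R k M) \<and> fin_gen R (syz_suc R k M)"
    by (induction k) (use assms(1,2) in \<open>auto simp: syz_suc_def intro: syz1_module syz1_fin_gen\<close>)
  then have S1: "module R (syz_suc R k M)" and S2: "fin_gen R (syz_suc R k M)" by simp_all
  note r = mod_iso_retr[OF iso S1]
  have "betti R (syz_suc R k M) i = betti R M (Suc k + i)"
    by (cases i) (simp_all add: betti_def syz_suc_def funpow_add add.commute flip: funpow_swap1)
  then show ?thesis
    using retr_fin_gen[OF r(2) assms(3) S1 S2] betti_retr_eq[OF r S1 assms(3) S2, of i] Suc by simp
qed

theorem theorem4p2:
  fixes R :: "('a, 'c) ring_scheme"
    and M :: "('a, 'm) module" and K :: "('a, 'k) module" and N :: "('a, 'n) module"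
    and f :: "(nat \<Rightarrow> 'm) \<Rightarrow> 'k" and g :: "'k \<Rightarrow> (nat \<Rightarrow> 'n)"
    and a b n c :: nat
  assumes "noeth_local_ring R"
    and "module R M" and "fin_gen R M"
    and "module R K" and "fin_gen R K"
    and "module R N" and "is_syzygy R n M N"
    and "a \<ge> 1" and "b \<ge> 1"
    and "short_exact R (dsum R a M) K (dsum R b N) f g"
    and "cx R K = enat c"
  shows "(a < b \<longrightarrow> cx R M = cx R K)
       \<and> (a = b \<longrightarrow> cx R M \<le> cx R K + 1)
       \<and> (a > b \<longrightarrow> cx R M = cx R K \<or> cx R M = \<infinity>)"
proof -
  interpret noeth_local R by (rule noeth_localI) fact
  define m where "m = betti R M"
  define k where "k = betti R K"
  note N = betti_is_syzygy[OF assms(2,3,6,7)]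
  have A: "module R (dsum R a M)" "fin_gen R (dsum R a M)" "\<And>i. betti R (dsum R a M) i = a * m i"
    using betti_dsum[OF assms(2,3), of "a - 1"] assms(8) dsum_module[OF assms(2)]
    by (auto simp: m_def)
  have C: "module R (dsum R b N)" "fin_gen R (dsum R b N)" "\<And>i. betti R (dsum R b N) i = b * m (n + i)"
    using betti_dsum[OF assms(6), of "b - 1"] N assms(9) dsum_module[OF assms(6)]
    by (auto simp: m_def)
  note mods = A(1) assms(4) C(1)
  have mid: "k i \<le> a * m i + b * m (n + i)" for i
    using betti_subadditive[OF assms(10) mods A(2) C(2), of i] by (simp add: A(3) C(3) k_def)
  \<comment> \<open>The index n + (i + 1) is read as i + (n + 1), so the recursions have step n + 1,
    which is positive even for n = 0.\<close>
  have left: "b * m (i + Suc n) \<le> k (Suc i) + a * m i" for i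
    using betti_rotate_left[OF assms(10) mods A(2) assms(5), of i]
    by (simp add: A(3) C(3) k_def add.commute)
  have right: "a * m i \<le> k i + b * m (i + Suc n)" for i
    using betti_rotate_right[OF assms(10) mods A(2) assms(5), of i]
    by (simp add: A(3) C(3) k_def add.commute)
  \<comment> \<open>Bounds pass from M to K for all a and b; the cases a < b and a > b then need
    only the converse.\<close>
  have MK: "cx_bound R K r" if "cx_bound R M r" for r
    using growth_bound_sum_shift[of k a m b n r, OF mid] that by (simp add: cx_bound_iff m_def k_def)
  have Kc: "growth_bound k c" using cx_enatD[OF assms(11)] by (simp add: cx_bound_iff k_def)
  show ?thesis
  proof (intro conjI impI)
    assume ab: "a < b"
    have "cx_bound R M r" if "cx_bound R K r" for r
      using growth_bound_contraction[of b m "Suc n" k a r, OF left ab] that by (simp add: cx_bound_iff m_def k_def)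
    with MK show "cx R M = cx R K" by (intro cx_eqI) blast
  next
    assume ab: "a = b"
    have "m (i + Suc n) \<le> k (Suc i) + m i" for i
    proof -
      \<comment> \<open>In \<open>left\<close> the coefficient of k is 1; enlarging it to b lets the
        common factor b be cancelled.\<close>
      have "k (Suc i) \<le> b * k (Suc i)" using assms(9) by simp
      then have "b * m (i + Suc n) \<le> b * (k (Suc i) + m i)"
        using left[of i] unfolding ab distrib_left by linarith
      then show ?thesis using assms(9) by simp
    qed
    from growth_bound_sum[of m "Suc n" k c, OF this _ Kc] have "cx_bound R M (Suc c)"
      by (simp add: cx_bound_iff m_def)
    from cx_le[OF this] show "cx R M \<le> cx R K + 1"
      by (simp add: assms(11) one_enat_def)
  next
    assume ab: "b < a"
    show "cx R M = cx R K \<or> cx R M = \<infinity>"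
    proof (cases "\<exists>d. cx_bound R M d")
      case True
      then obtain d where d: "growth_bound m d" by (auto simp: cx_bound_iff m_def)
      have "cx_bound R M r" if "cx_bound R K r" for r
        using growth_bound_expansion[of a m k b "Suc n" r d, OF right ab _ d] that by (simp add: cx_bound_iff m_def k_def)
      with MK show ?thesis by (intro disjI1 cx_eqI) blast
    qed (simp add: cx_def)
  qed
qed

end
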